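(* Every split graph that has no induced subgraph isomorphic to $\overline{H}$ and is independent-Sperner has clique-width at most $5$. Moreover, given such a graph $G$, one can compute a $5$-expression of $G$ in time $\mathcal{O}(|V(G)|^4)$.
   Context: A split partition of $G$ is a partition $(K,I)$ of $V(G)$ into a clique $K$ and an independent set $I$; $G$ is split if it has one. A split graph $G$ is independent-Sperner if it has a split partition $(K,I)$ such that for all $u,v\in I$, $N(u)\subseteq N(v)$ implies $u=v$. $H$ is the graph on vertices $c_1,c_2,x_1,y_1,x_2,y_2$ with edges $c_1c_2,c_1x_1,c_1y_1,c_2x_2,c_2y_2$, and $\overline{H}$ its complement. A $k$-graph is a graph with vertex labels from $\{1,\dots,k\}$. A $k$-expression is an expression built from: $i(v)$ (create vertex $v$ with label $i$), $\oplus$ (disjoint union), $\rho_{i\to j}$ (relabel label $i$ to $j$), and $\eta_{i,j}$ for $i\ne j$ (add all edges between vertices labeled $i$ and $j$). The clique-width of $G$ is the least $k$ such that some $k$-expression produces a $k$-graph isomorphic to $G$. *)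

theory Defs
  imports
    "Graph_Theory.Graph_Theory"
    "HOL-Library.Extended_Nat"
    "HOL-Library.Landau_Symbols"
begin

section \<open>Split graphs\<close>

text \<open>
  A finite simple graph is a \<^locale>\<open>pair_graph\<close>: a symmetric, loop-free, finite
  digraph in which an edge is the pair of its two opposite arcs.
\<close>

definition nbhd :: "'a pair_pre_digraph \<Rightarrow> 'a \<Rightarrow> 'a set" where
  "nbhd G u = {v \<in> pverts G. (u, v) \<in> parcs G}"

definition is_clique :: "'a pair_pre_digraph \<Rightarrow> 'a set \<Rightarrow> bool" where
  "is_clique G K \<longleftrightarrow> K \<subseteq> pverts G \<and> (\<forall>u\<in>K. \<forall>v\<in>K. u \<noteq> v \<longrightarrow> (u, v) \<in> parcs G)"

definition is_independent :: "'a pair_pre_digraph \<Rightarrow> 'a set \<Rightarrow> bool" where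
  "is_independent G I \<longleftrightarrow> I \<subseteq> pverts G \<and> (\<forall>u\<in>I. \<forall>v\<in>I. (u, v) \<notin> parcs G)"

text \<open>As usual for split graphs, either part may be empty.\<close>

definition split_partition :: "'a pair_pre_digraph \<Rightarrow> 'a set \<Rightarrow> 'a set \<Rightarrow> bool" where
  "split_partition G K I \<longleftrightarrow>
     K \<union> I = pverts G \<and> K \<inter> I = {} \<and> is_clique G K \<and> is_independent G I"

definition split_graph :: "'a pair_pre_digraph \<Rightarrow> bool" where
  "split_graph G \<longleftrightarrow> pair_graph G \<and> (\<exists>K I. split_partition G K I)"

definition independent_Sperner :: "'a pair_pre_digraph \<Rightarrow> bool" where
  "independent_Sperner G \<longleftrightarrow>
     (\<exists>K I. split_partition G K I \<and>
        (\<forall>u\<in>I. \<forall>v\<in>I. nbhd G u \<subseteq> nbhd G v \<longrightarrow> u = v))"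

definition complement_graph :: "'a pair_pre_digraph \<Rightarrow> 'a pair_pre_digraph" where
  "complement_graph G =
     \<lparr> pverts = pverts G,
       parcs = {(u, v). u \<in> pverts G \<and> v \<in> pverts G \<and> u \<noteq> v \<and> (u, v) \<notin> parcs G} \<rparr>"

definition has_induced :: "'a pair_pre_digraph \<Rightarrow> 'b pair_pre_digraph \<Rightarrow> bool" where
  "has_induced G F \<longleftrightarrow>
     (\<exists>G'. induced_subgraph G' (with_proj G) \<and> digraph_iso G' (with_proj F))"

datatype H_vertex = HC1 | HC2 | HX1 | HY1 | HX2 | HY2

definition H_graph :: "H_vertex pair_pre_digraph" where
  "H_graph =
     (let E = {(HC1, HC2), (HC1, HX1), (HC1, HY1), (HC2, HX2), (HC2, HY2)}
      in \<lparr> pverts = {HC1, HC2, HX1, HY1, HX2, HY2}, parcs = E \<union> E\<inverse> \<rparr>)"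


section \<open>Clique-width\<close>

datatype 'v kexp =
    Create nat 'v
  | Disj_Union "'v kexp" "'v kexp"
  | Relabel nat nat "'v kexp"
  | Join nat nat "'v kexp"

text \<open>
  The \<open>k\<close>-graph produced by an expression is its graph \<open>kexp_graph\<close> together
  with its labelling \<open>kexp_label\<close>, a map whose domain is the set of vertices.
\<close>

primrec kexp_label :: "'v kexp \<Rightarrow> 'v \<rightharpoonup> nat" where
  "kexp_label (Create i v) = [v \<mapsto> i]"
| "kexp_label (Disj_Union e f) = kexp_label e ++ kexp_label f"
| "kexp_label (Relabel i j e) = map_option (\<lambda>l. if l = i then j else l) \<circ> kexp_label e"
| "kexp_label (Join i j e) = kexp_label e"

primrec kexp_graph :: "'v kexp \<Rightarrow> 'v pair_pre_digraph" where
  "kexp_graph (Create i v) = \<lparr> pverts = {v}, parcs = {} \<rparr>"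
| "kexp_graph (Disj_Union e f) =
     \<lparr> pverts = pverts (kexp_graph e) \<union> pverts (kexp_graph f),
       parcs = parcs (kexp_graph e) \<union> parcs (kexp_graph f) \<rparr>"
| "kexp_graph (Relabel i j e) = kexp_graph e"
| "kexp_graph (Join i j e) =
     (let A = {(u, v). kexp_label e u = Some i \<and> kexp_label e v = Some j}
      in \<lparr> pverts = pverts (kexp_graph e), parcs = parcs (kexp_graph e) \<union> A \<union> A\<inverse> \<rparr>)"

primrec k_expression :: "nat \<Rightarrow> 'v kexp \<Rightarrow> bool" where
  "k_expression k (Create i v) \<longleftrightarrow> i \<in> {1..k}"
| "k_expression k (Disj_Union e f) \<longleftrightarrow>
     k_expression k e \<and> k_expression k f \<and> pverts (kexp_graph e) \<inter> pverts (kexp_graph f) = {}"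
| "k_expression k (Relabel i j e) \<longleftrightarrow> k_expression k e \<and> i \<in> {1..k} \<and> j \<in> {1..k}"
| "k_expression k (Join i j e) \<longleftrightarrow>
     k_expression k e \<and> i \<in> {1..k} \<and> j \<in> {1..k} \<and> i \<noteq> j"

text \<open>
  The graph is only produced up to isomorphism, so natural numbers suffice as
  vertices of the expressions. The value is \<open>\<infinity>\<close> if there is no expression at
  all, as for the graph without vertices.
\<close>

definition clique_width :: "'a pair_pre_digraph \<Rightarrow> enat" where
  "clique_width G =
     (INF k \<in> {k. \<exists>e :: nat kexp. k_expression k e \<and>
                    digraph_iso (with_proj (kexp_graph e)) (with_proj G)}. enat k)"


section \<open>Machine model\<close>

text \<open>
  Running times refer to a word RAM with structured control flow. A machine has
  registers and a memory of words, both indexed by natural numbers; a program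
  mentions only finitely many registers, while memory addresses are computed.
  Words are the numbers below a bound \<open>w\<close>, and a program that computes a number
  outside this range is stuck. Every operation costs one unit of time.
\<close>

record ram_state =
  reg :: "nat \<Rightarrow> nat"
  mem :: "nat \<Rightarrow> nat"

datatype ram_exp =
    Lit nat
  | Reg nat
  | Mem ram_exp
  | Plus ram_exp ram_exp
  | Minus ram_exp ram_exp
  | Times ram_exp ram_exp

primrec ram_val :: "ram_state \<Rightarrow> ram_exp \<Rightarrow> nat" where
  "ram_val s (Lit c) = c"
| "ram_val s (Reg r) = reg s r"
| "ram_val s (Mem a) = mem s (ram_val s a)"
| "ram_val s (Plus a b) = ram_val s a + ram_val s b"
| "ram_val s (Minus a b) = ram_val s a - ram_val s b"
| "ram_val s (Times a b) = ram_val s a * ram_val s b"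

primrec ram_fits :: "nat \<Rightarrow> ram_state \<Rightarrow> ram_exp \<Rightarrow> bool" where
  "ram_fits w s (Lit c) \<longleftrightarrow> ram_val s (Lit c) < w"
| "ram_fits w s (Reg r) \<longleftrightarrow> ram_val s (Reg r) < w"
| "ram_fits w s (Mem a) \<longleftrightarrow> ram_fits w s a \<and> ram_val s (Mem a) < w"
| "ram_fits w s (Plus a b) \<longleftrightarrow> ram_fits w s a \<and> ram_fits w s b \<and> ram_val s (Plus a b) < w"
| "ram_fits w s (Minus a b) \<longleftrightarrow> ram_fits w s a \<and> ram_fits w s b \<and> ram_val s (Minus a b) < w"
| "ram_fits w s (Times a b) \<longleftrightarrow> ram_fits w s a \<and> ram_fits w s b \<and> ram_val s (Times a b) < w"

primrec ram_cost :: "ram_exp \<Rightarrow> nat" where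
  "ram_cost (Lit c) = 1"
| "ram_cost (Reg r) = 1"
| "ram_cost (Mem a) = ram_cost a + 1"
| "ram_cost (Plus a b) = ram_cost a + ram_cost b + 1"
| "ram_cost (Minus a b) = ram_cost a + ram_cost b + 1"
| "ram_cost (Times a b) = ram_cost a + ram_cost b + 1"

datatype ram_prog =
    Set_Reg nat ram_exp
  | Set_Mem ram_exp ram_exp
  | Seq ram_prog ram_prog
  | Cond ram_exp ram_prog ram_prog
  | While ram_exp ram_prog

text \<open>
  \<open>ram_exec w p s t s'\<close>: with words below \<open>w\<close>, program \<open>p\<close> started in \<open>s\<close> halts in
  \<open>s'\<close> after time \<open>t\<close>. The tests of \<^const>\<open>Cond\<close> and \<^const>\<open>While\<close> succeed if the
  value is nonzero.
\<close>

inductive ram_exec :: "nat \<Rightarrow> ram_prog \<Rightarrow> ram_state \<Rightarrow> nat \<Rightarrow> ram_state \<Rightarrow> bool"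
  for w :: nat
where
  Set_Reg: "ram_fits w s a \<Longrightarrow>
     ram_exec w (Set_Reg r a) s (ram_cost a + 1) (s\<lparr>reg := (reg s)(r := ram_val s a)\<rparr>)"
| Set_Mem: "ram_fits w s a \<Longrightarrow> ram_fits w s b \<Longrightarrow>
     ram_exec w (Set_Mem a b) s (ram_cost a + ram_cost b + 1)
       (s\<lparr>mem := (mem s)(ram_val s a := ram_val s b)\<rparr>)"
| Seq: "ram_exec w p s t s' \<Longrightarrow> ram_exec w q s' t' s'' \<Longrightarrow>
     ram_exec w (Seq p q) s (t + t') s''"
| Cond_True: "ram_fits w s a \<Longrightarrow> ram_val s a \<noteq> 0 \<Longrightarrow> ram_exec w p s t s' \<Longrightarrow>
     ram_exec w (Cond a p q) s (ram_cost a + 1 + t) s'"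
| Cond_False: "ram_fits w s a \<Longrightarrow> ram_val s a = 0 \<Longrightarrow> ram_exec w q s t s' \<Longrightarrow>
     ram_exec w (Cond a p q) s (ram_cost a + 1 + t) s'"
| While_True: "ram_fits w s a \<Longrightarrow> ram_val s a \<noteq> 0 \<Longrightarrow>
     ram_exec w p s t s' \<Longrightarrow> ram_exec w (While a p) s' t' s'' \<Longrightarrow>
     ram_exec w (While a p) s (ram_cost a + 1 + t + t') s''"
| While_False: "ram_fits w s a \<Longrightarrow> ram_val s a = 0 \<Longrightarrow>
     ram_exec w (While a p) s (ram_cost a + 1) s"

text \<open>
  Input: a graph with vertices \<open>0, \<dots>, n - 1\<close>, given by \<open>n\<close> in register 0 and its
  adjacency matrix, row by row, in memory cells \<open>0, \<dots>, n * n - 1\<close>. All other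
  registers and cells are 0.
\<close>

definition graph_input :: "nat \<Rightarrow> nat pair_pre_digraph \<Rightarrow> ram_state" where
  "graph_input n G =
     \<lparr> reg = (\<lambda>r. if r = 0 then n else 0),
       mem = (\<lambda>c. if c < n * n \<and> (c div n, c mod n) \<in> parcs G then 1 else 0) \<rparr>"

text \<open>
  Output: the sequence of words in a contiguous block of memory, whose start is in
  register 0 and whose length is in register 1.
\<close>

definition ram_output :: "ram_state \<Rightarrow> nat list" where
  "ram_output s = map (mem s) [reg s 0 ..< reg s 0 + reg s 1]"

text \<open>Expressions are output in Polish (prefix) notation.\<close>

primrec encode_kexp :: "nat kexp \<Rightarrow> nat list" where
  "encode_kexp (Create i v) = [0, i, v]"
| "encode_kexp (Disj_Union e f) = 1 # encode_kexp e @ encode_kexp f"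
| "encode_kexp (Relabel i j e) = 2 # i # j # encode_kexp e"
| "encode_kexp (Join i j e) = 3 # i # j # encode_kexp e"

lemma encode_kexp_append_eq:
  "encode_kexp e @ xs = encode_kexp f @ ys \<Longrightarrow> e = f \<and> xs = ys"
proof (induction e arbitrary: f xs ys)
  case (Create i v)
  then show ?case by (cases f) simp_all
next
  case (Disj_Union e1 e2)
  show ?case
  proof (cases f)
    case f: (Disj_Union f1 f2)
    have "encode_kexp e1 @ encode_kexp e2 @ xs = encode_kexp f1 @ encode_kexp f2 @ ys"
      using Disj_Union.prems by (simp add: f)
    then have "e1 = f1" "encode_kexp e2 @ xs = encode_kexp f2 @ ys"
      using Disj_Union.IH(1) by blast+
    then show ?thesis
      using Disj_Union.IH(2) f by blast
  qed (use Disj_Union.prems in simp_all)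
next
  case (Relabel i j e)
  show ?case
  proof (cases f)
    case f: (Relabel i' j' f')
    have "i = i'" "j = j'" "encode_kexp e @ xs = encode_kexp f' @ ys"
      using Relabel.prems by (simp_all add: f)
    then show ?thesis
      using Relabel.IH f by blast
  qed (use Relabel.prems in simp_all)
next
  case (Join i j e)
  show ?case
  proof (cases f)
    case f: (Join i' j' f')
    have "i = i'" "j = j'" "encode_kexp e @ xs = encode_kexp f' @ ys"
      using Join.prems by (simp_all add: f)
    then show ?thesis
      using Join.IH f by blast
  qed (use Join.prems in simp_all)
qed

lemma inj_encode_kexp: "inj encode_kexp"
  using encode_kexp_append_eq[of _ "[]" _ "[]"] by (auto intro: injI)

end

theory Submission
  imports Defs
begin

text \<open>
  The neighbourhoods of the independent vertices form a Sperner hypergraph on the clique in which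
  two edges always differ by a single vertex in one direction. If \<open>a\<close> is an edge of minimum and \<open>b\<close>
  one of maximum size, then \<open>a\<close> has exactly one vertex \<open>z\<close> outside \<open>b\<close>, and every edge through \<open>z\<close>
  lies, up to \<open>z\<close>, inside every edge avoiding \<open>z\<close>. So the graph without \<open>z\<close> falls into two parts that
  interact only through complete or empty joins, and recursion needs two labels for each part and
  one for \<open>z\<close>.

  The program runs this recursion with an explicit stack: the vertices of a pending part carry its
  stack level, and the part on top is split by sorting its independent vertices by degree. The
  expression is written in prefix order while parts are taken from the stack. A suitable split
  partition is read off the vertex degrees.
\<close>

section \<open>Gluing of 1-Sperner hypergraphs\<close>

text \<open>In the complement of H the four leaves form a clique, the two centres are non-adjacent,
  and each centre sees exactly the leaves of the other. An induced copy is therefore what two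
  independent vertices with two private neighbours each produce; excluding it gives the
  single-vertex difference.

  Five labels occur at once because the joins are asymmetric: \<open>z\<close> sees all of the first
  part but only the clique of the second, and the first clique sees the second independent set but
  not conversely. Afterwards the labels are merged back to two.

  The Sperner partition is not part of the input, and a split graph may have several. The degree
  rule may find another one than the given one, but only in nearly complete graphs, where it serves
  equally well.

  No expression tree is stored: the prefix code of a glued expression starts with tokens that depend
  only on \<open>z\<close> and on which parts are empty, and ends with the codes of the parts, so it
  can be written before the parts are split. A split finishes one vertex and opens one level, so at
  most \<open>2 * n + 1\<close> rounds of quadratic time occur, cubic in total.\<close>

lemma card_diff_le_of_card_le:
  assumes "finite A" "finite B" "card A \<le> card B"
  shows "card (A - B) \<le> card (B - A)"
proof -
  have "card A = card (A \<inter> B) + card (A - B)" "card B = card (A \<inter> B) + card (B - A)"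
    using card_Int_Diff[OF assms(1), of B] card_Int_Diff[OF assms(2), of A] by (simp_all add: Int_commute)
  with assms(3) show ?thesis by simp
qed

text \<open>Edges are indexed by \<open>E\<close> and taken as traces of \<open>N e\<close> on
  \<open>V\<close>, so that recursion can shrink \<open>V\<close> and \<open>E\<close> while keeping
  \<open>N\<close>. Together with non-inclusion, the cardinality condition says that the smaller of
  the two differences has exactly one element, as in 1-Sperner hypergraphs.\<close>

definition one_Sperner :: "'v set \<Rightarrow> 'e set \<Rightarrow> ('e \<Rightarrow> 'v set) \<Rightarrow> bool" where
  "one_Sperner V E N \<longleftrightarrow>
     (\<forall>e\<in>E. \<forall>f\<in>E. e \<noteq> f \<longrightarrow> \<not> N e \<inter> V \<subseteq> N f \<and>
        (card (N e \<inter> V - N f) \<le> 1 \<or> card (N f \<inter> V - N e) \<le> 1))"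

lemma one_SpernerD:
  assumes "one_Sperner V E N" "e \<in> E" "f \<in> E" "e \<noteq> f"
  shows "\<not> N e \<inter> V \<subseteq> N f" "card (N e \<inter> V - N f) \<le> 1 \<or> card (N f \<inter> V - N e) \<le> 1"
  using assms unfolding one_Sperner_def by blast+

text \<open>The edge of smaller size has the smaller difference, so the bound 1 applies to it; the
  Sperner property makes this difference nonempty.\<close>

lemma one_Sperner_smaller:
  assumes "one_Sperner V E N" "finite V" "e \<in> E" "f \<in> E" "e \<noteq> f"
    and "card (N e \<inter> V) \<le> card (N f \<inter> V)"
  shows "\<exists>z. N e \<inter> V - N f = {z}"
proof -
  have "card (N e \<inter> V - N f \<inter> V) \<le> card (N f \<inter> V - N e \<inter> V)"
    using assms by (intro card_diff_le_of_card_le) auto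
  moreover have "N e \<inter> V - N f \<inter> V = N e \<inter> V - N f" "N f \<inter> V - N e \<inter> V = N f \<inter> V - N e" by auto
  ultimately have "card (N e \<inter> V - N f) \<le> 1"
    using one_SpernerD(2)[OF assms(1,3-5)] by auto
  moreover have "N e \<inter> V - N f \<noteq> {}" using one_SpernerD(1)[OF assms(1,3-5)] by auto
  moreover have "finite (N e \<inter> V - N f)" using assms(2) by auto
  ultimately have "card (N e \<inter> V - N f) = 1"
    by (metis One_nat_def card_0_eq le_neq_implies_less less_Suc0)
  then show ?thesis by (simp add: card_1_singleton_iff)
qed

text \<open>Every edge other than \<open>b\<close> has a single vertex outside \<open>b\<close>, and by the Sperner property
  all edges whose outside vertex agrees with that of \<open>a\<close> lie, up to it, below the other edges.\<close>

lemma gluing_vertex: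
  assumes H: "one_Sperner V E N" "finite V"
    and a: "a \<in> E" "\<And>f. f \<in> E \<Longrightarrow> card (N a \<inter> V) \<le> card (N f \<inter> V)"
    and b: "b \<in> E" "\<And>f. f \<in> E \<Longrightarrow> card (N f \<inter> V) \<le> card (N b \<inter> V)"
    and z: "z \<in> V" "z \<in> N a" "z \<notin> N b"
    and e: "e \<in> E" "z \<in> N e" and f: "f \<in> E" "z \<notin> N f"
  shows "N e \<inter> V - {z} \<subseteq> N f"
proof -
  have out: "\<exists>y. N g \<inter> V - N b = {y}" if "g \<in> E" "g \<noteq> b" for g
    using one_Sperner_smaller[OF H that(1) b(1) that(2)] b(2)[OF that(1)] by blast
  have "e \<noteq> b" using z e by auto
  then obtain y where "N e \<inter> V - N b = {y}" using out e(1) by blast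
  moreover have "z \<in> N e \<inter> V - N b" using z e by blast
  ultimately have eb: "N e \<inter> V - N b = {z}" by simp
  show ?thesis
  proof (cases "f = b")
    case False
    then obtain y where fb: "N f \<inter> V - N b = {y}" using out f by blast
    have ef: "e \<noteq> f" using e(2) f(2) by blast
    have af: "a \<noteq> f" using z(2) f(2) by blast
    have y: "y \<in> N f" "y \<in> V" "y \<notin> N b" using fb by blast+
    have ye: "y \<notin> N e"
    proof
      assume "y \<in> N e"
      then have "y \<in> N e \<inter> V - N b" using y by simp
      then show False using eb y f(2) by simp
    qed
    \<comment> \<open>As \<open>a\<close> has minimum size, it leaves \<open>f\<close> in one vertex
      only, and \<open>z\<close> is such a vertex.\<close>
    obtain x where x: "N a \<inter> V - N f = {x}" using one_Sperner_smaller[OF H a(1) f(1) af a(2)[OF f(1)]] by blast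
    have "z \<in> N a \<inter> V - N f" using z f by simp
    then have "N a \<inter> V - N f = {z}" using x by simp
    then have af': "N a \<inter> V - {z} \<subseteq> N f" by blast
    consider "card (N e \<inter> V - N f) \<le> 1" | "card (N f \<inter> V - N e) \<le> 1"
      using one_SpernerD(2)[OF H(1) e(1) f(1) ef] by blast
    then show ?thesis
    proof cases
      case 1
      have "N e \<inter> V - N f \<subseteq> {z}"
        using card_le_Suc0_iff_eq[of "N e \<inter> V - N f"] 1 H(2) z(1) e(2) f(2) by simp blast
      then show ?thesis by blast
    next
      case 2
      \<comment> \<open>Here \<open>a\<close> is shown to be \<open>e\<close>: its only vertex
        outside \<open>b\<close> is \<open>z\<close>, so it misses \<open>y\<close>; the rest of
        \<open>a\<close> lies in \<open>f\<close> without \<open>y\<close>, hence in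
        \<open>e\<close>. The Sperner property then identifies the two edges.\<close>
      have fe: "N f \<inter> V - N e \<subseteq> {y}"
        using card_le_Suc0_iff_eq[of "N f \<inter> V - N e"] 2 H(2) y ye by simp blast
      have "a \<noteq> b" using z by blast
      then obtain x where "N a \<inter> V - N b = {x}" using out a(1) by blast
      moreover have "z \<in> N a \<inter> V - N b" using z by simp
      ultimately have "N a \<inter> V - N b = {z}" by simp
      moreover have "y \<noteq> z" using e(2) ye by blast
      ultimately have "y \<notin> N a" using y by blast
      then have "N a \<inter> V \<subseteq> N e" using af' fe e(2) by blast
      then have "a = e" using one_SpernerD(1)[OF H(1) a(1) e(1)] by blast
      then show ?thesis using af' by simp
    qed
  qed (use eb in blast)
qed

text \<open>The property speaks only of differences of edges, inclusion being an empty difference.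
  So it survives any restriction that leaves all differences unchanged.\<close>

lemma one_Sperner_mono:
  assumes "one_Sperner V E N" "E' \<subseteq> E"
    and "\<And>e f. e \<in> E' \<Longrightarrow> f \<in> E' \<Longrightarrow> N e \<inter> V' - N f = N e \<inter> V - N f"
  shows "one_Sperner V' E' N"
proof -
  have "(N e \<inter> X \<subseteq> N f) = (N e \<inter> X - N f = {})" for e f X by blast
  with assms show ?thesis unfolding one_Sperner_def by (metis subsetD)
qed

text \<open>Label 1 is for the clique and 2 for the independent set of a finished part; the first part is moved
  to labels 3 and 4, and a clique vertex \<open>z\<close> enters with \<open>l = 5\<close>. If \<open>z\<close> is a lone independent
  vertex, then \<open>l = 2\<close> and the joins have no effect.\<close>

definition glue :: "nat \<Rightarrow> 'v \<Rightarrow> 'v kexp option \<Rightarrow> 'v kexp option \<Rightarrow> 'v kexp" where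
  "glue l z o1 o2 =
    (let a = (case o1 of None \<Rightarrow> Create l z
                | Some e \<Rightarrow> Disj_Union (Create l z) (Relabel 1 3 (Relabel 2 4 e)));
         b = (case o2 of None \<Rightarrow> a | Some f \<Rightarrow> Disj_Union a f)
     in Relabel 5 1 (Relabel 4 2 (Relabel 3 1
          (Join 5 4 (Join 5 3 (Join 5 1 (Join 3 1 (Join 3 2 b))))))))"

lemma kexp_graph_Join:
  "pverts (kexp_graph (Join i j e)) = pverts (kexp_graph e)"
  "parcs (kexp_graph (Join i j e)) = parcs (kexp_graph e)
     \<union> {(u, v). kexp_label e u = Some i \<and> kexp_label e v = Some j}
     \<union> {(u, v). kexp_label e u = Some i \<and> kexp_label e v = Some j}\<inverse>"
  by (simp_all add: Let_def)

declare kexp_graph.simps(4) [simp del] kexp_graph_Join [simp]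

definition encode_opt :: "nat kexp option \<Rightarrow> nat list" where
  "encode_opt o1 = (case o1 of None \<Rightarrow> [] | Some e \<Rightarrow> encode_kexp e)"

text \<open>Everything apart from the codes of the two parts comes before them, and the first part
  precedes the second. This dictates that the first part lies above the second on the stack.\<close>

lemma encode_glue:
  "encode_kexp (glue l z o1 o2) =
     [2, 5, 1, 2, 4, 2, 2, 3, 1, 3, 5, 4, 3, 5, 3, 3, 5, 1, 3, 3, 1, 3, 3, 2]
     @ (if o2 = None then [] else [1]) @ (if o1 = None then [] else [1]) @ [0, l, z]
     @ (if o1 = None then [] else [2, 1, 3, 2, 2, 4]) @ encode_opt o1 @ encode_opt o2"
  by (cases o1; cases o2) (simp_all add: glue_def encode_opt_def)

section \<open>Expressions for split relations and their decomposition\<close>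

locale split_relation =
  fixes adj :: "'v \<Rightarrow> 'v \<Rightarrow> bool" and V I :: "'v set"
  assumes fin: "finite V"
    and adj_sym: "u \<in> V \<Longrightarrow> v \<in> V \<Longrightarrow> adj u v \<Longrightarrow> adj v u"
    and adj_irrefl: "u \<in> V \<Longrightarrow> \<not> adj u u"
    and independent: "u \<in> V \<Longrightarrow> v \<in> V \<Longrightarrow> u \<in> I \<Longrightarrow> v \<in> I \<Longrightarrow> \<not> adj u v"
    and clique: "u \<in> V \<Longrightarrow> v \<in> V \<Longrightarrow> u \<notin> I \<Longrightarrow> v \<notin> I \<Longrightarrow> u \<noteq> v \<Longrightarrow> adj u v"
begin

definition builds :: "'v kexp \<Rightarrow> 'v set \<Rightarrow> bool" where
  "builds e S \<longleftrightarrow> k_expression 5 e \<and> pverts (kexp_graph e) = S \<and>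
     parcs (kexp_graph e) = {(u, v). u \<in> S \<and> v \<in> S \<and> adj u v} \<and>
     kexp_label e = (\<lambda>v. if v \<in> S then Some (if v \<in> I then 2 else 1) else None)"

text \<open>Every expression creates at least one vertex, so an empty part has to be represented by
  \<open>None\<close>.\<close>

definition builds_opt :: "'v kexp option \<Rightarrow> 'v set \<Rightarrow> bool" where
  "builds_opt o1 S \<longleftrightarrow> (case o1 of None \<Rightarrow> S = {} | Some e \<Rightarrow> S \<noteq> {} \<and> builds e S)"

definition sub_Sperner :: "'v set \<Rightarrow> bool" where
  "sub_Sperner S \<longleftrightarrow> one_Sperner (S - I) (S \<inter> I) (\<lambda>u. {v. adj u v})"

text \<open>The pairs of labels that are never joined are 4-1, 4-2 and 5-2, apart from pairs inside
  one part. The condition on clique vertices \<open>z\<close> says that exactly these pairs carry no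
  edges, while the pairs 5-4 and 3-2 are complete; the remaining joins connect clique
  vertices.\<close>

lemma builds_glue:
  assumes S: "S \<subseteq> V" "S = insert z (B1 \<union> B2)" "z \<notin> B1" "z \<notin> B2" "B1 \<inter> B2 = {}"
    and b1: "builds_opt o1 B1" and b2: "builds_opt o2 B2"
    and K: "z \<notin> I \<Longrightarrow> (\<forall>u\<in>B1 \<inter> I. adj u z) \<and> (\<forall>u\<in>B2 \<inter> I. \<not> adj u z) \<and>
       (\<forall>u\<in>B1 \<inter> I. \<forall>v\<in>B2 - I. \<not> adj u v) \<and> (\<forall>u\<in>B2 \<inter> I. \<forall>v\<in>B1 - I. adj u v)"
    and I: "z \<in> I \<Longrightarrow> B1 = {} \<and> B2 = {}"
    and l: "l = (if z \<in> I then 2 else 5)"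
  shows "builds (glue l z o1 o2) S"
proof -
  define a where "a = (case o1 of None \<Rightarrow> Create l z
                | Some e \<Rightarrow> Disj_Union (Create l z) (Relabel 1 3 (Relabel 2 4 e)))"
  define b where "b = (case o2 of None \<Rightarrow> a | Some f \<Rightarrow> Disj_Union a f)"
  have a: "k_expression 5 a" "pverts (kexp_graph a) = insert z B1"
     "parcs (kexp_graph a) = {(u, v). u \<in> B1 \<and> v \<in> B1 \<and> adj u v}"
     "kexp_label a = (\<lambda>v. if v = z then Some l else
        if v \<in> B1 then Some (if v \<in> I then 4 else 3) else None)"
  proof -
    show "k_expression 5 a" "pverts (kexp_graph a) = insert z B1"
     "parcs (kexp_graph a) = {(u, v). u \<in> B1 \<and> v \<in> B1 \<and> adj u v}"
      using b1 S(3) l by (cases o1; simp add: a_def builds_opt_def builds_def)+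
    show "kexp_label a = (\<lambda>v. if v = z then Some l else
        if v \<in> B1 then Some (if v \<in> I then 4 else 3) else None)"
      using b1 S(3) by (cases o1; simp add: a_def builds_opt_def builds_def fun_eq_iff map_add_def)
  qed
  have b: "k_expression 5 b" "pverts (kexp_graph b) = S"
     "parcs (kexp_graph b) = {(u, v). u \<in> B1 \<and> v \<in> B1 \<and> adj u v} \<union> {(u, v). u \<in> B2 \<and> v \<in> B2 \<and> adj u v}"
     "kexp_label b = (\<lambda>v. if v = z then Some l else
        if v \<in> B1 then Some (if v \<in> I then 4 else 3) else
        if v \<in> B2 then Some (if v \<in> I then 2 else 1) else None)"
  proof -
    show "k_expression 5 b"
      using b2 S(2-5) a(1,2) by (cases o2; auto simp: b_def builds_opt_def builds_def)
    show "pverts (kexp_graph b) = S"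
      using b2 S(2-5) a(2) by (cases o2; auto simp: b_def builds_opt_def builds_def)
    show "parcs (kexp_graph b) = {(u, v). u \<in> B1 \<and> v \<in> B1 \<and> adj u v} \<union> {(u, v). u \<in> B2 \<and> v \<in> B2 \<and> adj u v}"
      using b2 a(3) by (cases o2; simp add: b_def builds_opt_def builds_def)
    \<comment> \<open>In \<open>++\<close> the right map takes precedence, whereas the stated
      labelling tests \<open>z\<close> and \<open>B1\<close> first; disjointness reconciles the
      two.\<close>
    have "v \<notin> B2" if "v = z \<or> v \<in> B1" for v using that S by blast
    then show "kexp_label b = (\<lambda>v. if v = z then Some l else
        if v \<in> B1 then Some (if v \<in> I then 4 else 3) else
        if v \<in> B2 then Some (if v \<in> I then 2 else 1) else None)"
      using b2 a(4) by (cases o2; simp add: b_def builds_opt_def builds_def fun_eq_iff map_add_def)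
  qed
  have g: "glue l z o1 o2 = Relabel 5 1 (Relabel 4 2 (Relabel 3 1
          (Join 5 4 (Join 5 3 (Join 5 1 (Join 3 1 (Join 3 2 b)))))))"
    unfolding glue_def Let_def b_def a_def ..
  have lab: "kexp_label (glue l z o1 o2) = (\<lambda>v. if v \<in> S then Some (if v \<in> I then 2 else 1) else None)"
    using S(2) l I unfolding g by (simp add: b(4) fun_eq_iff)
  show ?thesis
  proof (cases "z \<in> I")
    case True
    then have "B1 = {}" "B2 = {}" "S = {z}" "l = 2" using I S l by auto
    moreover have "parcs (kexp_graph (glue l z o1 o2)) = {}"
      unfolding g by (simp add: b(3,4) \<open>B1 = {}\<close> \<open>B2 = {}\<close> \<open>l = 2\<close>)
    moreover have "{(u, v). u = z \<and> v = z \<and> adj u v} = {}" using adj_irrefl[of z] S by auto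
    moreover have "k_expression 5 (glue l z o1 o2)" "pverts (kexp_graph (glue l z o1 o2)) = S"
      unfolding g by (simp_all add: b(1,2))
    ultimately show ?thesis unfolding builds_def lab by simp
  next
    case False
    note K = K[OF False]
    have l5: "l = 5" using l False by simp
    define J where "J i j = {(u, v). kexp_label b u = Some i \<and> kexp_label b v = Some j}" for i j
    have p: "parcs (kexp_graph (glue l z o1 o2)) =
       parcs (kexp_graph b) \<union> (J 5 4 \<union> (J 5 4)\<inverse>) \<union> (J 5 3 \<union> (J 5 3)\<inverse>) \<union> (J 5 1 \<union> (J 5 1)\<inverse>)
         \<union> (J 3 1 \<union> (J 3 1)\<inverse>) \<union> (J 3 2 \<union> (J 3 2)\<inverse>)"
      unfolding g J_def by (simp add: Un_ac)
    \<comment> \<open>A join leaves labels unchanged, so all five joins refer to the labelling of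
      \<open>b\<close> and are products of its label classes.\<close>
    have Jp: "J i j = {x. kexp_label b x = Some i} \<times> {x. kexp_label b x = Some j}" for i j
      unfolding J_def by blast
    have "{x. kexp_label b x = Some 1} = B2 - I" "{x. kexp_label b x = Some 2} = B2 \<inter> I"
      "{x. kexp_label b x = Some 3} = B1 - I" "{x. kexp_label b x = Some 4} = B1 \<inter> I"
      "{x. kexp_label b x = Some 5} = {z}"
      unfolding b(4) l5 using S(3-5) by (auto split: if_split_asm)
    then have J: "J 5 4 = {z} \<times> (B1 \<inter> I)" "J 5 3 = {z} \<times> (B1 - I)" "J 5 1 = {z} \<times> (B2 - I)"
       "J 3 1 = (B1 - I) \<times> (B2 - I)" "J 3 2 = (B1 - I) \<times> (B2 \<inter> I)"
      unfolding Jp by simp_all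
    have S1: "x \<noteq> z \<and> x \<notin> B2" if "x \<in> B1" for x using that S by blast
    have S2: "x \<noteq> z \<and> x \<notin> B1" if "x \<in> B2" for x using that S by blast
    have "(u, v) \<in> parcs (kexp_graph (glue l z o1 o2)) \<longleftrightarrow> u \<in> S \<and> v \<in> S \<and> adj u v" for u v
    proof (cases "u \<in> S \<and> v \<in> S")
      case True
      then have V: "u \<in> V" "v \<in> V" "z \<in> V" using S by auto
      have sym: "adj v u = adj u v" using adj_sym V by blast
      note c = clique[OF V(1,2)] and i = independent[OF V(1,2)]
      consider "u = z" "v = z" | "u = z" "v \<in> B1" | "u = z" "v \<in> B2" | "u \<in> B1" "v = z" | "u \<in> B2" "v = z"
        | "u \<in> B1" "v \<in> B1" | "u \<in> B1" "v \<in> B2" | "u \<in> B2" "v \<in> B1" | "u \<in> B2" "v \<in> B2"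
        using True S(2) by blast
      then show ?thesis
      proof cases
        case 1
        then show ?thesis using S(3,4) adj_irrefl[OF V(3)] unfolding p J b(3) by simp
      next
        case 2
        then have "adj u v" using K c False S1[of v] sym by blast
        then show ?thesis using True 2 S1[of v] S(3,4) unfolding p J b(3) by simp
      next
        case 3
        then have "adj u v \<longleftrightarrow> v \<notin> I" using K c False S2[of v] sym by blast
        then show ?thesis using True 3 S2[of v] S(3,4) unfolding p J b(3) by simp
      next
        case 4
        then have "adj u v" using K c False S1[of u] sym by blast
        then show ?thesis using True 4 S1[of u] S(3,4) unfolding p J b(3) by simp
      next
        case 5
        then have "adj u v \<longleftrightarrow> u \<notin> I" using K c False S2[of u] sym by blast
        then show ?thesis using True 5 S2[of u] S(3,4) unfolding p J b(3) by simp
      next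
        case 6
        then show ?thesis using True S1[of u] S1[of v] unfolding p J b(3) by simp
      next
        case 7
        then have "adj u v \<longleftrightarrow> u \<notin> I" using K c i S1[of u] sym by blast
        then show ?thesis using True 7 S1[of u] S2[of v] unfolding p J b(3) by auto
      next
        case 8
        then have "adj u v \<longleftrightarrow> v \<notin> I" using K c i S1[of v] sym by blast
        then show ?thesis using True 8 S2[of u] S1[of v] unfolding p J b(3) by auto
      next
        case 9
        then show ?thesis using True S2[of u] S2[of v] unfolding p J b(3) by simp
      qed
    next
      case False
      then show ?thesis using S(2) unfolding p J b(3) by auto
    qed
    then have "parcs (kexp_graph (glue l z o1 o2)) = {(u, v). u \<in> S \<and> v \<in> S \<and> adj u v}" by auto
    then show ?thesis unfolding builds_def lab using b by (simp add: g)
  qed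
qed

text \<open>The first part of the gluing at \<open>z\<close>: the edges through \<open>z\<close> and the clique vertices that they cover.\<close>

definition attached :: "'v set \<Rightarrow> 'v \<Rightarrow> 'v set" where
  "attached S z = {v \<in> S - {z}. if v \<in> I then adj v z else \<exists>u\<in>S \<inter> I. adj u z \<and> adj u v}"

text \<open>For a clique vertex this is the conclusion of \<open>gluing_vertex\<close>, freed from
  the edges of extremal size. An independent vertex qualifies only as the base case of the
  recursion.\<close>

definition gluing :: "'v set \<Rightarrow> 'v \<Rightarrow> bool" where
  "gluing S z \<longleftrightarrow> z \<in> S \<and> (if z \<in> I then S = {z} else
     \<forall>u\<in>S \<inter> I. \<forall>v\<in>S \<inter> I. \<forall>x\<in>S - I - {z}. adj u z \<longrightarrow> \<not> adj v z \<longrightarrow> adj u x \<longrightarrow> adj v x)"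

lemma attached_I: "v \<in> I \<Longrightarrow> v \<in> attached S z \<longleftrightarrow> v \<in> S \<and> v \<noteq> z \<and> adj v z"
  and attached_K: "v \<notin> I \<Longrightarrow> v \<in> attached S z \<longleftrightarrow> v \<in> S \<and> v \<noteq> z \<and> (\<exists>u\<in>S \<inter> I. adj u z \<and> adj u v)"
  by (auto simp: attached_def)

lemma attached_subset: "attached S z \<subseteq> S - {z}"
  by (auto simp: attached_def)

lemma gluingD:
  assumes "gluing S z" "z \<notin> I" "u \<in> S" "u \<in> I" "v \<in> S" "v \<in> I" "x \<in> S" "x \<notin> I" "x \<noteq> z"
    and "adj u z" "\<not> adj v z" "adj u x"
  shows "adj v x"
  using assms(1,3-) unfolding gluing_def if_not_P[OF assms(2)] by blast

lemma gluing_singleton: "gluing S z \<Longrightarrow> z \<in> I \<Longrightarrow> S = {z}"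
  by (simp add: gluing_def)

lemma attached_singleton: "attached {z} z = {}"
  by (auto simp: attached_def)

text \<open>An edge through \<open>z\<close> misses the clique of the second part because
  \<open>attached\<close> collects all clique vertices that such edges cover. An edge avoiding
  \<open>z\<close> contains the clique of the first part by the gluing property.\<close>

lemma builds_attached:
  assumes S: "S \<subseteq> V" and z: "gluing S z"
    and b: "builds_opt o1 (attached S z)" "builds_opt o2 (S - {z} - attached S z)"
    and l: "l = (if z \<in> I then 2 else 5)"
  shows "builds (glue l z o1 o2) S"
proof (rule builds_glue[OF S _ _ _ _ b _ _ l])
  show "S = insert z (attached S z \<union> (S - {z} - attached S z))"
    using z unfolding gluing_def attached_def by blast
  show "z \<in> I \<Longrightarrow> attached S z = {} \<and> S - {z} - attached S z = {}"
    using gluing_singleton[OF z] by (simp add: attached_singleton)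
  assume zI: "z \<notin> I"
  have "adj u v" if uv: "u \<in> S - {z} - attached S z" "u \<in> I" "v \<in> attached S z" "v \<notin> I" for u v
  proof -
    obtain w where w: "w \<in> S" "w \<in> I" "adj w z" "adj w v" using uv(3) attached_K[OF uv(4)] by blast
    have "u \<in> S" "\<not> adj u z" "v \<in> S" "v \<noteq> z"
      using uv(1,3) attached_I[OF uv(2)] attached_subset[of S z] by blast+
    then show ?thesis using gluingD[OF z zI w(1,2) _ uv(2) _ uv(4) _ w(3) _ w(4)] by simp
  qed
  then show "(\<forall>u\<in>attached S z \<inter> I. adj u z) \<and> (\<forall>u\<in>(S - {z} - attached S z) \<inter> I. \<not> adj u z) \<and>
    (\<forall>u\<in>attached S z \<inter> I. \<forall>v\<in>S - {z} - attached S z - I. \<not> adj u v) \<and>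
    (\<forall>u\<in>(S - {z} - attached S z) \<inter> I. \<forall>v\<in>attached S z - I. adj u v)"
    by (auto simp: attached_I attached_K)
qed (auto simp: attached_def)

text \<open>In the first part all edges contain \<open>z\<close> and their other vertices stay in
  the part. In the second part no edge contains \<open>z\<close>, and all of them contain the
  removed clique vertices. Hence no difference of two edges changes, and
  \<open>one_Sperner_mono\<close> applies.\<close>

lemma sub_Sperner_attached:
  assumes "sub_Sperner S" "gluing S z"
  shows "sub_Sperner (attached S z)" "sub_Sperner (S - {z} - attached S z)"
proof -
  let ?N = "\<lambda>u. {v. adj u v}"
  have H: "one_Sperner (S - I) (S \<inter> I) ?N" using assms(1) by (simp add: sub_Sperner_def)
  have "sub_Sperner (attached S z) \<and> sub_Sperner (S - {z} - attached S z)"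
  proof (cases "z \<in> I")
    case True
    then have "S = {z}" by (rule gluing_singleton[OF assms(2)])
    then show ?thesis by (simp add: attached_singleton sub_Sperner_def one_Sperner_def)
  next
    case False
    have 1: "?N e \<inter> (attached S z - I) - ?N f = ?N e \<inter> (S - I) - ?N f"
      if "e \<in> attached S z \<inter> I" "f \<in> attached S z \<inter> I" for e f
    proof -
      have e: "e \<in> S" "e \<in> I" "adj e z" "adj f z"
        using that attached_I[of e] attached_I[of f] by simp_all
      then have "x \<in> attached S z" if "adj e x" "x \<in> S - I" "x \<noteq> z" for x
        using that e attached_K[of x] by blast
      then show ?thesis using e attached_subset[of S z] by blast
    qed
    have 2: "?N e \<inter> (S - {z} - attached S z - I) - ?N f = ?N e \<inter> (S - I) - ?N f"
      if "e \<in> (S - {z} - attached S z) \<inter> I" "f \<in> (S - {z} - attached S z) \<inter> I" for e f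
    proof -
      have nz: "\<not> adj e z" and fS: "f \<in> S" "f \<in> I" "\<not> adj f z"
        using that attached_I[of e] attached_I[of f] by auto
      have "adj f x" if x: "x \<in> attached S z" "x \<notin> I" for x
      proof -
        obtain w where w: "w \<in> S" "w \<in> I" "adj w z" "adj w x" using x(1) attached_K[OF x(2)] by blast
        have "x \<in> S" "x \<noteq> z" using x attached_subset[of S z] by blast+
        then show ?thesis using gluingD[OF assms(2) False w(1,2) fS(1,2) _ x(2) _ w(3) fS(3) w(4)] by simp
      qed
      then show ?thesis using nz by blast
    qed
    show ?thesis unfolding sub_Sperner_def
    proof
      show "one_Sperner (attached S z - I) (attached S z \<inter> I) ?N"
        by (rule one_Sperner_mono[OF H _ 1]) (use attached_subset[of S z] in blast)
      show "one_Sperner (S - {z} - attached S z - I) ((S - {z} - attached S z) \<inter> I) ?N"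
        by (rule one_Sperner_mono[OF H _ 2]) blast
    qed
  qed
  then show "sub_Sperner (attached S z)" "sub_Sperner (S - {z} - attached S z)" by auto
qed

text \<open>Without clique vertices all edges are empty, and the Sperner property leaves room for
  only one of them.\<close>

lemma gluing_no_clique:
  assumes "S \<subseteq> V" "sub_Sperner S" "z \<in> S" "S - I = {}"
  shows "gluing S z"
proof -
  have I: "u \<in> S \<inter> I" if "u \<in> S" for u using assms(4) that by blast
  have "u = z" if "u \<in> S" for u
    using assms(2) one_SpernerD(1)[OF _ I[OF that] I[OF assms(3)]] unfolding sub_Sperner_def assms(4) by blast
  then have "S = {z}" using assms(3) by blast
  then show ?thesis using I[OF assms(3)] by (simp add: gluing_def)
qed

lemma gluing_min_max:
  assumes "S \<subseteq> V" "sub_Sperner S" "z \<in> S - I"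
    and a: "a \<in> S \<inter> I" "\<And>f. f \<in> S \<inter> I \<Longrightarrow> card {x \<in> S - I. adj a x} \<le> card {x \<in> S - I. adj f x}"
    and b: "b \<in> S \<inter> I" "\<And>f. f \<in> S \<inter> I \<Longrightarrow> card {x \<in> S - I. adj f x} \<le> card {x \<in> S - I. adj b x}"
    and z: "adj a z" "\<not> adj b z"
  shows "gluing S z"
proof -
  let ?N = "\<lambda>u. {v. adj u v}"
  have N: "?N u \<inter> (S - I) = {x \<in> S - I. adj u x}" for u by auto
  have "finite (S - I)" using finite_subset[OF assms(1) fin] by blast
  then have "?N e \<inter> (S - I) - {z} \<subseteq> ?N f"
    if "e \<in> S \<inter> I" "f \<in> S \<inter> I" "adj e z" "\<not> adj f z" for e f
    using gluing_vertex[of "S - I" "S \<inter> I" ?N a b z e f, unfolded N] assms that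
    unfolding sub_Sperner_def by blast
  then show ?thesis using assms(3) unfolding gluing_def by auto
qed

lemma min_max_vertex_exists:
  assumes "S \<subseteq> V" "sub_Sperner S"
    and "a \<in> S \<inter> I" "b \<in> S \<inter> I" "a \<noteq> b" 
  shows "\<exists>z\<in>S - I. adj a z \<and> \<not> adj b z"
proof -
  have "\<not> {v. adj a v} \<inter> (S - I) \<subseteq> {v. adj b v}"
    using one_SpernerD(1)[OF _ assms(3-5)] assms(2) unfolding sub_Sperner_def by blast
  then show ?thesis by blast
qed

text \<open>An edge through \<open>z\<close> and an edge avoiding \<open>z\<close> cannot coexist
  here, so any clique vertex will do.\<close>

lemma gluing_at_most_one:
  assumes "z \<in> S - I" "\<And>u v. u \<in> S \<inter> I \<Longrightarrow> v \<in> S \<inter> I \<Longrightarrow> u = v"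
  shows "gluing S z"
proof -
  have *: "adj v z" if "u \<in> S \<inter> I" "v \<in> S \<inter> I" "adj u z" for u v
    using that(3) unfolding assms(2)[OF that(1,2)] .
  have z: "z \<in> S" "z \<notin> I" using assms(1) by simp_all
  show ?thesis unfolding gluing_def if_not_P[OF z(2)]
    by (intro conjI ballI impI z(1)) (use * in blast)
qed

end

section \<open>Array programs on the word RAM\<close>

text \<open>Time enters only as an upper bound, so that bounds can be rounded to multiples of powers
  of \<open>n\<close> after composition.\<close>

definition runs :: "nat \<Rightarrow> ram_prog \<Rightarrow> ram_state \<Rightarrow> nat \<Rightarrow> ram_state \<Rightarrow> bool" where
  "runs w p s T s' \<longleftrightarrow> (\<exists>t\<le>T. ram_exec w p s t s')"

lemma runs_mono: "runs w p s T s' \<Longrightarrow> T \<le> T' \<Longrightarrow> runs w p s T' s'"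
  unfolding runs_def by (meson le_trans)

lemma runs_Seq: "runs w p s T s' \<Longrightarrow> runs w q s' T' s'' \<Longrightarrow> runs w (Seq p q) s (T + T') s''"
  unfolding runs_def by (meson add_mono ram_exec.Seq)

lemma runs_Cond:
  assumes "ram_fits w s a" "runs w (if ram_val s a \<noteq> 0 then p else q) s T s'"
  shows "runs w (Cond a p q) s (ram_cost a + 1 + T) s'"
proof -
  obtain t where "t \<le> T" "ram_exec w (if ram_val s a \<noteq> 0 then p else q) s t s'"
    using assms(2) unfolding runs_def by blast
  then have "ram_exec w (Cond a p q) s (ram_cost a + 1 + t) s'"
    using ram_exec.Cond_True[OF assms(1), of p t s' q] ram_exec.Cond_False[OF assms(1), of q t s' p]
    by (cases "ram_val s a = 0") simp_all
  then show ?thesis using \<open>t \<le> T\<close> unfolding runs_def by (meson add_left_mono)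
qed

lemma runs_While_step:
  assumes "ram_fits w s a" "ram_val s a \<noteq> 0" "runs w p s T s'" "runs w (While a p) s' T' s''"
  shows "runs w (While a p) s (ram_cost a + 1 + T + T') s''"
proof -
  obtain t t' where t: "t \<le> T" "t' \<le> T'" "ram_exec w p s t s'" "ram_exec w (While a p) s' t' s''"
    using assms(3,4) unfolding runs_def by blast
  from While_True[OF assms(1,2) t(3,4)] t(1,2) show ?thesis unfolding runs_def
    by (intro exI[of _ "ram_cost a + 1 + t + t'"]) simp
qed

lemma runs_While_stop:
  "ram_fits w s a \<Longrightarrow> ram_val s a = 0 \<Longrightarrow> runs w (While a p) s (ram_cost a + 1) s"
  unfolding runs_def using While_False by blast

section \<open>Bounds on values that exclude word overflow\<close>

primrec max_lit :: "ram_exp \<Rightarrow> nat" where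
  "max_lit (Lit c) = c"
| "max_lit (Reg r) = 0"
| "max_lit (Mem a) = max_lit a"
| "max_lit (Plus a b) = max (max_lit a) (max_lit b)"
| "max_lit (Minus a b) = max (max_lit a) (max_lit b)"
| "max_lit (Times a b) = max (max_lit a) (max_lit b)"

definition bounded :: "nat \<Rightarrow> ram_state \<Rightarrow> bool" where
  "bounded B s \<longleftrightarrow> (\<forall>r. reg s r \<le> B) \<and> (\<forall>c. mem s c \<le> B)"

text \<open>The exponent \<open>i + j + 1\<close> is the cost of a binary operation whose operands
  cost \<open>i\<close> and \<open>j\<close>, which lets cost serve as exponent in
  \<open>ram_val_le\<close>.\<close>

lemma power_add_le:
  assumes "2 \<le> (B::nat)" shows "B ^ i + B ^ j \<le> B ^ (i + j + 1)"
proof -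
  have "B ^ i \<le> B ^ (i + j)" "B ^ j \<le> B ^ (i + j)" using assms by (auto intro: power_increasing)
  then have "B ^ i + B ^ j \<le> 2 * B ^ (i + j)" by linarith
  also have "\<dots> \<le> B * B ^ (i + j)" using assms by simp
  finally show ?thesis by simp
qed

text \<open>Expressions of constant size over numbers below \<open>B\<close> stay below a fixed power of \<open>B\<close>. Hence word
  overflow is excluded by bounds on the stored numbers alone.\<close>

lemma ram_val_le:
  assumes "bounded B s" "2 \<le> B" "max_lit e \<le> B"
  shows "ram_val s e \<le> B ^ ram_cost e"
  using assms(3)
proof (induction e)
  case (Mem a)
  have "mem s (ram_val s a) \<le> B ^ 1" using assms(1) by (simp add: bounded_def)
  also have "\<dots> \<le> B ^ ram_cost (Mem a)" using assms(2) by (intro power_increasing) auto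
  finally show ?case by simp
next
  case (Plus a b)
  then show ?case using power_add_le[OF assms(2), of "ram_cost a" "ram_cost b"] by auto
next
  case (Minus a b)
  then show ?case using power_add_le[OF assms(2), of "ram_cost a" "ram_cost b"] by auto
next
  case (Times a b)
  then have "ram_val s a * ram_val s b \<le> B ^ ram_cost a * B ^ ram_cost b" by (auto intro: mult_mono)
  also have "\<dots> = B ^ (ram_cost a + ram_cost b)" by (simp add: power_add)
  also have "\<dots> \<le> B ^ ram_cost (Times a b)" using assms(2) by (intro power_increasing) auto
  finally show ?case by simp
qed (use assms in \<open>auto simp: bounded_def\<close>)

text \<open>Fitting also concerns all subexpressions; these cost less, so the one bound for the
  whole expression covers them.\<close>

lemma ram_fitsI:
  assumes "bounded B s" "2 \<le> B" "max_lit e \<le> B" "B ^ ram_cost e < w"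
  shows "ram_fits w s e"
  using assms(3,4)
proof (induction e)
  case (Mem a)
  have "B ^ ram_cost a \<le> B ^ ram_cost (Mem a)" using assms(2) by (intro power_increasing) auto
  then have "ram_fits w s a" using Mem by (metis le_less_trans max_lit.simps(3))
  then show ?case using Mem.prems(2) ram_val_le[OF assms(1,2) Mem.prems(1)] by simp
next
  case (Plus a b)
  have "B ^ ram_cost a \<le> B ^ ram_cost (Plus a b)" "B ^ ram_cost b \<le> B ^ ram_cost (Plus a b)"
    using assms(2) by (intro power_increasing; simp)+
  then have "ram_fits w s a" "ram_fits w s b"
    using Plus.IH Plus.prems by (simp_all only: max_lit.simps max.bounded_iff; linarith)+
  then show ?case using Plus.prems(2) ram_val_le[OF assms(1,2) Plus.prems(1)] by simp
next
  case (Minus a b)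
  have "B ^ ram_cost a \<le> B ^ ram_cost (Minus a b)" "B ^ ram_cost b \<le> B ^ ram_cost (Minus a b)"
    using assms(2) by (intro power_increasing; simp)+
  then have "ram_fits w s a" "ram_fits w s b"
    using Minus.IH Minus.prems by (simp_all only: max_lit.simps max.bounded_iff; linarith)+
  then show ?case using Minus.prems(2) ram_val_le[OF assms(1,2) Minus.prems(1)] by simp
next
  case (Times a b)
  have "B ^ ram_cost a \<le> B ^ ram_cost (Times a b)" "B ^ ram_cost b \<le> B ^ ram_cost (Times a b)"
    using assms(2) by (intro power_increasing; simp)+
  then have "ram_fits w s a" "ram_fits w s b"
    using Times.IH Times.prems by (simp_all only: max_lit.simps max.bounded_iff; linarith)+
  then show ?case using Times.prems(2) ram_val_le[OF assms(1,2) Times.prems(1)] by simp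
next
  case (Reg r)
  have "reg s r \<le> B" using assms(1) by (simp add: bounded_def)
  then show ?case using Reg.prems(2) by simp
qed simp

section \<open>Arithmetic codes of conditions and loop programs over arrays\<close>

abbreviation St :: "(nat \<Rightarrow> nat) \<Rightarrow> (nat \<Rightarrow> nat) \<Rightarrow> ram_state" where
  "St R M \<equiv> \<lparr>reg = R, mem = M\<rparr>"

definition adj_exp :: "ram_exp \<Rightarrow> ram_exp \<Rightarrow> ram_exp" where
  "adj_exp a b = Mem (Plus (Times a (Reg 0)) b)"

definition addr_exp :: "nat \<Rightarrow> ram_exp \<Rightarrow> ram_exp" where
  "addr_exp k a = Plus (Plus (Times (Reg 0) (Reg 0)) (Times (Lit k) (Reg 0))) a"

definition arr_exp :: "nat \<Rightarrow> ram_exp \<Rightarrow> ram_exp" where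
  "arr_exp k a = Mem (addr_exp k a)"

definition not_exp :: "ram_exp \<Rightarrow> ram_exp" where
  "not_exp a = Minus (Lit 1) a"

text \<open>Subtraction is truncated, so the sum of both differences is the distance, and
  \<open>1\<close> minus it tests for distance 0.\<close>

definition eq_exp :: "ram_exp \<Rightarrow> ram_exp \<Rightarrow> ram_exp" where
  "eq_exp a b = Minus (Lit 1) (Plus (Minus a b) (Minus b a))"

lemma ram_val_not_exp [simp]: "ram_val s (not_exp a) = of_bool (ram_val s a = 0)"
  by (simp add: not_exp_def)

lemma ram_val_eq_exp [simp]: "ram_val s (eq_exp a b) = of_bool (ram_val s a = ram_val s b)"
  by (simp add: eq_exp_def)

text \<open>Registers 1, 2 and 3 hold the accumulator and the inner and outer loop indices; they are
  0 outside of loops, so that each of the following programs has an exact final state.\<close>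

definition iter_prog :: "ram_exp \<Rightarrow> ram_prog" where
  "iter_prog e = While (Minus (Reg 0) (Reg 2)) (Seq (Set_Reg 1 e) (Set_Reg 2 (Plus (Reg 2) (Lit 1))))"

definition fold_prog :: "nat \<Rightarrow> ram_exp \<Rightarrow> ram_prog" where
  "fold_prog r e = Seq (iter_prog e) (Seq (Set_Reg r (Reg 1)) (Seq (Set_Reg 1 (Lit 0)) (Set_Reg 2 (Lit 0))))"

text \<open>The inner loop recomputes register 1 from \<open>e\<close>, which must therefore mention
  \<open>Reg 1\<close> to accumulate; \<open>e'\<close> then turns the result into the entry at
  index register 3.\<close>

definition map_prog :: "nat \<Rightarrow> ram_exp \<Rightarrow> ram_exp \<Rightarrow> ram_prog" where
  "map_prog k e e' = Seq (While (Minus (Reg 0) (Reg 3))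
     (Seq (iter_prog e) (Seq (Set_Mem (addr_exp k (Reg 3)) e') (Seq (Set_Reg 1 (Lit 0))
       (Seq (Set_Reg 2 (Lit 0)) (Set_Reg 3 (Plus (Reg 3) (Lit 1))))))))
     (Set_Reg 3 (Lit 0))"

text \<open>The language has no empty program. Clearing register 1, which is already 0 outside
  loops, takes its place, so that \<open>emit_prog []\<close> serves as a skip.\<close>

primrec emit_prog :: "ram_exp list \<Rightarrow> ram_prog" where
  "emit_prog [] = Set_Reg 1 (Lit 0)"
| "emit_prog (e # es) = Seq (Seq (Set_Mem (Reg 11) e) (Set_Reg 11 (Plus (Reg 11) (Lit 1)))) (emit_prog es)"

lemmas exp_defs = adj_exp_def addr_exp_def arr_exp_def not_exp_def eq_exp_def

text \<open>The base \<open>100 * n ^ 3\<close> bounds every stored number, the largest being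
  accumulated sums; the exponent 100 is the cost limit imposed by \<open>cheap\<close>.\<close>

locale array_machine =
  fixes n w :: nat and adj :: "nat \<Rightarrow> nat \<Rightarrow> bool"
  assumes n_pos: "1 \<le> n" and w: "(100 * n ^ 3) ^ 100 < w"
begin

definition B :: nat where "B = 100 * n ^ 3"

lemma n_le_cube: "n \<le> n ^ 3" "n * n \<le> n ^ 3" "1 \<le> n ^ 3"
  using n_pos by (simp_all add: power3_eq_cube)

text \<open>The fourth bound covers the keys and all output addresses, which stay below
  \<open>n * n + 8 * n + 35 * n\<close>. The last one covers a sum of \<open>n\<close> differences
  of keys, each at most \<open>n * n + n\<close>.\<close>

lemma B_ge: "100 \<le> B" "n \<le> B" "100 * n \<le> B" "50 * (n * n) + 50 * n \<le> B" "n * (n * n + n) \<le> B"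
proof -
  have "n * (n * n + n) = n ^ 3 + n * n" by (simp add: power3_eq_cube algebra_simps)
  then show "100 \<le> B" "n \<le> B" "100 * n \<le> B" "50 * (n * n) + 50 * n \<le> B" "n * (n * n + n) \<le> B"
    using n_le_cube unfolding B_def by linarith+
qed

text \<open>Memory contains the adjacency matrix, then eight arrays of length \<open>n\<close>, then the output: array 0 is the
  characteristic function of the independent set, array 2 the stack levels (0 for finished vertices)
  and array 3 the block on top of the stack; the others are scratch space.\<close>

definition layout :: "(nat \<Rightarrow> nat \<Rightarrow> nat) \<Rightarrow> nat list \<Rightarrow> nat \<Rightarrow> nat" where
  "layout arrs out = (\<lambda>c. if c < n * n then of_bool (adj (c div n) (c mod n))
     else if c < n * n + 8 * n then arrs ((c - n * n) div n) ((c - n * n) mod n)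
     else if c < n * n + 8 * n + length out then out ! (c - (n * n + 8 * n)) else 0)"

definition addr :: "nat \<Rightarrow> nat \<Rightarrow> nat" where
  "addr k v = n * n + k * n + v"

lemma layout_adj: "u < n \<Longrightarrow> v < n \<Longrightarrow> layout arrs out (u * n + v) = of_bool (adj u v)"
proof -
  assume uv: "u < n" "v < n"
  have "u * n + v < (u + 1) * n" using uv by simp
  also have "\<dots> \<le> n * n" using uv by (intro mult_right_mono) auto
  finally have "u * n + v < n * n" .
  moreover have "(u * n + v) div n = u" "(u * n + v) mod n = v" using uv by (simp_all add: div_add1_eq)
  ultimately show ?thesis by (simp add: layout_def)
qed

lemma addr_less: "k < 8 \<Longrightarrow> v < n \<Longrightarrow> addr k v < n * n + 8 * n"
proof -
  assume kv: "k < 8" "v < n"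
  have "k * n + v < (k + 1) * n" using kv by simp
  also have "\<dots> \<le> 8 * n" using kv by (intro mult_right_mono) auto
  finally show ?thesis unfolding addr_def by linarith
qed

lemma layout_arr:
  assumes "k < 8" "v < n"
  shows "layout arrs out (addr k v) = arrs k v"
proof -
  have "(k * n + v) div n = k" "(k * n + v) mod n = v" using assms by (simp_all add: div_add1_eq)
  then show ?thesis using addr_less[OF assms] by (simp add: layout_def addr_def)
qed

lemma layout_upd: 
  assumes "k < 8" "v < n"
  shows "(layout arrs out)(addr k v := x) = layout (arrs(k := (arrs k)(v := x))) out"
proof
  fix c
  have kv: "(k * n + v) div n = k" "(k * n + v) mod n = v" using assms by (simp_all add: div_add1_eq)
  have c: "c = addr k v" if "n * n \<le> c" "(c - n * n) div n = k" "(c - n * n) mod n = v"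
    using that div_mult_mod_eq[of "c - n * n" n] unfolding addr_def by simp
  have a: "n * n \<le> addr k v" "addr k v - n * n = k * n + v" by (simp_all add: addr_def)
  show "((layout arrs out)(addr k v := x)) c = layout (arrs(k := (arrs k)(v := x))) out c"
  proof (cases "c = addr k v")
    case True
    then show ?thesis using a kv addr_less[OF assms] by (simp add: layout_def)
  next
    case False
    then have "\<not> ((c - n * n) div n = k \<and> (c - n * n) mod n = v)" if "\<not> c < n * n"
      using that c by linarith
    then show ?thesis using False by (auto simp: layout_def)
  qed
qed

lemma layout_cong:
  assumes "\<And>k v. v < n \<Longrightarrow> arrs k v = arrs' k v" shows "layout arrs out = layout arrs' out"
  using assms n_pos by (auto simp: layout_def fun_eq_iff)

lemma layout_append: "(layout arrs out)(n * n + 8 * n + length out := x) = layout arrs (out @ [x])"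
  by (auto simp: layout_def fun_eq_iff nth_append)

definition sized :: "(nat \<Rightarrow> nat) \<Rightarrow> (nat \<Rightarrow> nat \<Rightarrow> nat) \<Rightarrow> nat list \<Rightarrow> bool" where
  "sized R arrs out \<longleftrightarrow> R 0 = n \<and> (\<forall>r. R r \<le> B) \<and> (\<forall>k<8. \<forall>v<n. arrs k v \<le> B) \<and> (\<forall>t\<in>set out. t \<le> B)"

definition idle :: "(nat \<Rightarrow> nat) \<Rightarrow> bool" where
  "idle R \<longleftrightarrow> R 1 = 0 \<and> R 2 = 0 \<and> R 3 = 0"

lemma sized_bounded: "sized R arrs out \<Longrightarrow> bounded B (St R (layout arrs out))"
proof -
  assume sized: "sized R arrs out"
  have "layout arrs out c \<le> B" for c
  proof -
    consider "c < n * n" | "n * n \<le> c" "c < n * n + 8 * n" |  "n * n + 8 * n \<le> c" by linarith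
    then show ?thesis
    proof cases
      case 1 then show ?thesis using B_ge(1) by (simp add: layout_def)
    next
      case 2
      then have "(c - n * n) div n < 8" "(c - n * n) mod n < n"
        using n_pos by (auto simp: less_mult_imp_div_less)
      then show ?thesis using sized 2 by (simp add: layout_def sized_def)
    next
      case 3 then show ?thesis using sized by (auto simp: layout_def sized_def)
    qed
  qed
  then show ?thesis using sized by (simp add: bounded_def sized_def)
qed

lemma sized_reg: "sized R arrs out \<Longrightarrow> x \<le> B \<Longrightarrow> r \<noteq> 0 \<Longrightarrow> sized (R(r := x)) arrs out"
  by (simp add: sized_def)

lemma sized_arr: "sized R arrs out \<Longrightarrow> (\<And>v. v < n \<Longrightarrow> F v \<le> B) \<Longrightarrow> sized R (arrs(k := F)) out"
  by (simp add: sized_def)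

lemma sized_out: "sized R arrs out \<Longrightarrow> x \<le> B \<Longrightarrow> sized R arrs (out @ [x])"
  by (auto simp: sized_def)

lemma idle_upd: "idle R \<Longrightarrow> r > 3 \<Longrightarrow> idle (R(r := x))"
  by (simp add: idle_def)

text \<open>Literals up to 100 are at most \<open>B\<close>, and a cost up to 100 keeps every value
  at most \<open>B ^ 100\<close>, which is below \<open>w\<close>.\<close>

definition cheap :: "ram_exp \<Rightarrow> bool" where
  "cheap e \<longleftrightarrow> ram_cost e \<le> 100 \<and> max_lit e \<le> 100"

lemma fits_cheap: "sized R arrs out \<Longrightarrow> cheap e \<Longrightarrow> ram_fits w (St R (layout arrs out)) e"
proof -
  assume sized: "sized R arrs out" and e: "cheap e"
  have "B ^ ram_cost e \<le> B ^ 100" using e B_ge(1) by (intro power_increasing) (auto simp: cheap_def)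
  also have "\<dots> < w" using w by (simp add: B_def)
  finally show ?thesis using e B_ge(1) by (intro ram_fitsI[OF sized_bounded[OF sized]]) (auto simp: cheap_def)
qed

lemma ram_val_arr [simp]:
  "R 0 = n \<Longrightarrow> k < 8 \<Longrightarrow> ram_val (St R (layout arrs out)) a < n \<Longrightarrow>
     ram_val (St R (layout arrs out)) (arr_exp k a) = arrs k (ram_val (St R (layout arrs out)) a)"
  by (simp add: arr_exp_def addr_exp_def layout_arr[unfolded addr_def])

lemma ram_val_adj [simp]:
  "R 0 = n \<Longrightarrow> ram_val (St R (layout arrs out)) a < n \<Longrightarrow> ram_val (St R (layout arrs out)) b < n \<Longrightarrow>
     ram_val (St R (layout arrs out)) (adj_exp a b) =
       of_bool (adj (ram_val (St R (layout arrs out)) a) (ram_val (St R (layout arrs out)) b))"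
  by (simp add: adj_exp_def layout_adj)

lemma runs_Set_Reg:
  assumes "sized R arrs out" "cheap e"
    and "R(r := ram_val (St R (layout arrs out)) e) = R'" "ram_cost e + 1 \<le> T"
  shows "runs w (Set_Reg r e) (St R (layout arrs out)) T (St R' (layout arrs out))"
  using ram_exec.Set_Reg[OF fits_cheap[OF assms(1,2)], of r] assms(3,4) unfolding runs_def by auto

lemma runs_Set_Mem:
  assumes "sized R arrs out" "cheap a" "cheap e"
    and "(layout arrs out)(ram_val (St R (layout arrs out)) a := ram_val (St R (layout arrs out)) e) = M'"
      "ram_cost a + ram_cost e + 1 \<le> T"
  shows "runs w (Set_Mem a e) (St R (layout arrs out)) T (St R M')"
  using ram_exec.Set_Mem[OF fits_cheap[OF assms(1,2)] fits_cheap[OF assms(1,3)]] assms(4,5)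
  unfolding runs_def by auto

text \<open>\<open>h x\<close> is the accumulator before index \<open>x\<close> is treated. One
  round costs at most 109: 4 for the test, 101 for the update and 4 for the index; the extra 4 is
  the failing last test.\<close>

lemma runs_iter:
  assumes sized: "sized R arrs out" and e: "cheap e"
    and h: "\<And>x. x \<le> n \<Longrightarrow> h x \<le> B"
      "\<And>x. x < n \<Longrightarrow> ram_val (St (R(1 := h x, 2 := x)) (layout arrs out)) e = h (Suc x)"
    and "x \<le> n"
  shows "runs w (iter_prog e) (St (R(1 := h x, 2 := x)) (layout arrs out)) ((n - x) * 109 + 4)
     (St (R(1 := h n, 2 := n)) (layout arrs out))"
  using \<open>x \<le> n\<close>
proof (induction "n - x" arbitrary: x)
  case 0
  then have x: "x = n" by simp
  have ok': "sized (R(1 := h n, 2 := n)) arrs out" using sized h(1) B_ge by (simp add: sized_reg)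
  have c: "cheap (Minus (Reg 0) (Reg 2))" by (simp add: cheap_def)
  have v: "ram_val (St (R(1 := h n, 2 := n)) (layout arrs out)) (Minus (Reg 0) (Reg 2)) = 0"
    using sized by (simp add: sized_def)
  show ?case unfolding x iter_prog_def
    by (rule runs_mono[OF runs_While_stop[OF fits_cheap[OF ok' c] v]]) simp
next
  case (Suc m)
  then have x: "x < n" by simp
  let ?R = "R(1 := h x, 2 := x)"
  have ok0: "sized ?R arrs out" using sized h(1) x B_ge by (simp add: sized_reg)
  have c: "cheap (Minus (Reg 0) (Reg 2))" "cheap (Plus (Reg 2) (Lit 1))" by (simp_all add: cheap_def)
  have v: "ram_val (St ?R (layout arrs out)) (Minus (Reg 0) (Reg 2)) \<noteq> 0" using sized x by (simp add: sized_def)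
  have ok1: "sized (R(1 := h (Suc x), 2 := x)) arrs out" using sized h(1)[of "Suc x"] x B_ge by (simp add: sized_reg)
  have 1: "runs w (Set_Reg 1 e) (St ?R (layout arrs out)) (ram_cost e + 1) (St (R(1 := h (Suc x), 2 := x)) (layout arrs out))"
    by (intro runs_Set_Reg[OF ok0 e]) (use h(2)[OF x] in \<open>simp_all add: fun_upd_twist\<close>)
  have 2: "runs w (Set_Reg 2 (Plus (Reg 2) (Lit 1))) (St (R(1 := h (Suc x), 2 := x)) (layout arrs out)) 4
      (St (R(1 := h (Suc x), 2 := Suc x)) (layout arrs out))"
    by (intro runs_Set_Reg[OF ok1 c(2)]) simp_all
  have 3: "runs w (iter_prog e) (St (R(1 := h (Suc x), 2 := Suc x)) (layout arrs out)) ((n - Suc x) * 109 + 4)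
     (St (R(1 := h n, 2 := n)) (layout arrs out))"
    using Suc by simp
  have "runs w (iter_prog e) (St ?R (layout arrs out)) (4 + (ram_cost e + 1 + 4) + ((n - Suc x) * 109 + 4))
     (St (R(1 := h n, 2 := n)) (layout arrs out))"
    using runs_While_step[OF fits_cheap[OF ok0 c(1)] v runs_Seq[OF 1 2] 3[unfolded iter_prog_def]]
    by (simp add: iter_prog_def)
  then show ?case
  proof (rule runs_mono)
    have "n - x = Suc (n - Suc x)" using x by simp
    then show "4 + (ram_cost e + 1 + 4) + ((n - Suc x) * 109 + 4) \<le> (n - x) * 109 + 4"
      using e by (simp add: cheap_def)
  qed
qed

lemma runs_fold:
  assumes sized: "sized R arrs out" "idle R" and e: "cheap e" and "h 0 = 0"
    and h: "\<And>x. x \<le> n \<Longrightarrow> h x \<le> B"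
      "\<And>x. x < n \<Longrightarrow> ram_val (St (R(1 := h x, 2 := x)) (layout arrs out)) e = h (Suc x)"
    and r: "r > 3"
  shows "runs w (fold_prog r e) (St R (layout arrs out)) (200 * n) (St (R(r := h n)) (layout arrs out))"
proof -
  have le0: "0 \<le> n" by simp
  have R: "R = R(1 := h 0, 2 := 0)" using sized \<open>h 0 = 0\<close> by (auto simp: idle_def fun_eq_iff)
  have 1: "runs w (iter_prog e) (St R (layout arrs out)) (n * 109 + 4) (St (R(1 := h n, 2 := n)) (layout arrs out))"
    using runs_iter[where h = h and x = 0, OF sized(1) e h le0, folded R, unfolded diff_zero] .
  have c: "cheap (Reg 1)" "cheap (Lit 0)" by (simp_all add: cheap_def)
  have o1: "sized (R(1 := h n, 2 := n)) arrs out" using sized h(1) B_ge by (simp add: sized_reg)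
  have o2: "sized (R(1 := h n, 2 := n, r := h n)) arrs out" using o1 h(1) r by (simp add: sized_reg)
  have o3: "sized (R(1 := h n, 2 := n, r := h n, 1 := 0)) arrs out" by (rule sized_reg[OF o2]) simp_all
  have 2: "runs w (Set_Reg r (Reg 1)) (St (R(1 := h n, 2 := n)) (layout arrs out)) 2
     (St (R(1 := h n, 2 := n, r := h n)) (layout arrs out))"
    by (intro runs_Set_Reg[OF o1 c(1)]) simp_all
  have 3: "runs w (Set_Reg 1 (Lit 0)) (St (R(1 := h n, 2 := n, r := h n)) (layout arrs out)) 2
     (St (R(1 := h n, 2 := n, r := h n, 1 := 0)) (layout arrs out))"
    by (intro runs_Set_Reg[OF o2 c(2)]) simp_all
  have "R(1 := h n, 2 := n, r := h n, 1 := 0, 2 := 0) = R(r := h n)"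
    using sized(2) r by (auto simp: idle_def fun_eq_iff)
  then have 4: "runs w (Set_Reg 2 (Lit 0)) (St (R(1 := h n, 2 := n, r := h n, 1 := 0)) (layout arrs out)) 2
     (St (R(r := h n)) (layout arrs out))"
    by (intro runs_Set_Reg[OF o3 c(2)]) simp_all
  show ?thesis unfolding fold_prog_def
    by (rule runs_mono[OF runs_Seq[OF 1 runs_Seq[OF 2 runs_Seq[OF 3 4]]]]) (use n_pos in simp)
qed

text \<open>The premises on \<open>e\<close> and \<open>e'\<close> refer to the half-finished array:
  entries below \<open>v\<close> are new, entry \<open>v\<close> is still old. This admits updates
  in place, as for the stack levels in array 2.\<close>

lemma runs_map:
  assumes sized: "sized R arrs out" "idle R" and e: "cheap e" "cheap e'" and k: "k < 8"
    and h: "\<And>v. v < n \<Longrightarrow> h v 0 = 0" "\<And>v x. v < n \<Longrightarrow> x \<le> n \<Longrightarrow> h v x \<le> B"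
      "\<And>v x. v < n \<Longrightarrow> x < n \<Longrightarrow> ram_val (St (R(1 := h v x, 2 := x, 3 := v))
          (layout (arrs(k := (\<lambda>u. if u < v then F u else arrs k u))) out)) e = h v (Suc x)"
    and F: "\<And>v. v < n \<Longrightarrow> F v \<le> B"
      "\<And>v. v < n \<Longrightarrow> ram_val (St (R(1 := h v n, 2 := n, 3 := v))
          (layout (arrs(k := (\<lambda>u. if u < v then F u else arrs k u))) out)) e' = F v"
  shows "runs w (map_prog k e e') (St R (layout arrs out)) (500 * n ^ 2) (St R (layout (arrs(k := F)) out))"
proof -
  define M where "M v = layout (arrs(k := (\<lambda>u. if u < v then F u else arrs k u))) out" for v
  define body where "body = Seq (iter_prog e) (Seq (Set_Mem (addr_exp k (Reg 3)) e') (Seq (Set_Reg 1 (Lit 0))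
       (Seq (Set_Reg 2 (Lit 0)) (Set_Reg 3 (Plus (Reg 3) (Lit 1))))))"
  have okM: "sized R (arrs(k := (\<lambda>u. if u < v then F u else arrs k u))) out" for v
    using sized(1) F(1) k by (auto intro!: sized_arr simp: sized_def)
  have c: "cheap (Minus (Reg 0) (Reg 3))" "cheap (Lit 0)" "cheap (Plus (Reg 3) (Lit 1))" "cheap (addr_exp k (Reg 3))"
    using k by (simp_all add: cheap_def addr_exp_def)
  \<comment> \<open>A round needs at most \<open>109 * n + 4\<close> for the inner loop and 122 for
    the rest, namely the outer test, the store, two resets and the index; 130 is a rounding.\<close>
  have loop: "runs w (While (Minus (Reg 0) (Reg 3)) body) (St (R(3 := v)) (M v)) ((n - v) * (109 * n + 130) + 4) (St (R(3 := n)) (M n))"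
    if "v \<le> n" for v
    using that
  proof (induction "n - v" arbitrary: v)
    case 0
    then have v: "v = n" by simp
    have z: "ram_val (St (R(3 := n)) (M n)) (Minus (Reg 0) (Reg 3)) = 0"
      using sized by (simp add: sized_def)
    have o: "sized (R(3 := n)) (arrs(k := (\<lambda>u. if u < n then F u else arrs k u))) out"
      by (rule sized_reg[OF okM B_ge(2)]) simp
    show ?case unfolding v
      by (rule runs_mono[OF runs_While_stop[OF fits_cheap[OF o c(1), folded M_def] z]]) simp
  next
    case (Suc m)
    then have v: "v < n" by simp
    note okv = okM[of v]
    let ?a = "arrs(k := (\<lambda>u. if u < v then F u else arrs k u))"
    have le: "v \<le> B" "n \<le> B" "h v n \<le> B" using v B_ge(2) h(2)[OF v, of n] by simp_all
    have le0: "0 \<le> n" "0 \<le> B" by simp_all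
    have o0: "sized (R(3 := v)) ?a out" by (rule sized_reg[OF okv le(1)]) simp
    have o1: "sized (R(1 := h v n, 2 := n, 3 := v)) ?a out" by (rule sized_reg[OF sized_reg[OF sized_reg[OF okv le(3)] le(2)] le(1)]) simp_all
    have R: "R(3 := v) = (R(3 := v))(1 := h v 0, 2 := 0)" 
      using sized(2) h(1)[OF v] by (intro ext) (simp add: idle_def)
    have tw: "(R(3 := v))(1 := x, 2 := y) = R(1 := x, 2 := y, 3 := v)" for x y by (intro ext) simp
    have hv: "ram_val (St ((R(3 := v))(1 := h v x, 2 := x)) (layout ?a out)) e = h v (Suc x)" if "x < n" for x
      using h(3)[OF v that] unfolding tw .
    have 1: "runs w (iter_prog e) (St (R(3 := v)) (M v)) (n * 109 + 4) (St (R(1 := h v n, 2 := n, 3 := v)) (M v))"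
      using runs_iter[where h = "h v" and x = 0, OF o0 e(1) h(2)[OF v] hv le0(1), folded R, unfolded tw diff_zero]
      unfolding M_def .
    have M': "(M v)(addr k v := F v) = M (Suc v)"
      unfolding M_def layout_upd[OF k v] by (rule layout_cong) (use v in \<open>auto simp: less_Suc_eq\<close>)
    have "ram_val (St (R(1 := h v n, 2 := n, 3 := v)) (M v)) (addr_exp k (Reg 3)) = addr k v"
      using sized by (simp add: addr_exp_def addr_def sized_def)
    then have 2: "runs w (Set_Mem (addr_exp k (Reg 3)) e') (St (R(1 := h v n, 2 := n, 3 := v)) (M v))
        (9 + ram_cost e' + 1) (St (R(1 := h v n, 2 := n, 3 := v)) (M (Suc v)))"
      using F(2)[OF v] M' unfolding M_def
      by (intro runs_Set_Mem[OF o1 c(4) e(2)]) (simp_all add: addr_exp_def)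
    note okS = okM[of "Suc v"]
    have o2: "sized (R(1 := h v n, 2 := n, 3 := v)) (arrs(k := (\<lambda>u. if u < Suc v then F u else arrs k u))) out"
      by (rule sized_reg[OF sized_reg[OF sized_reg[OF okS le(3)] le(2)] le(1)]) simp_all
    have o3: "sized (R(1 := 0, 2 := n, 3 := v)) (arrs(k := (\<lambda>u. if u < Suc v then F u else arrs k u))) out"
      by (rule sized_reg[OF sized_reg[OF sized_reg[OF okS le0(2)] le(2)] le(1)]) simp_all
    have o4: "sized (R(3 := v)) (arrs(k := (\<lambda>u. if u < Suc v then F u else arrs k u))) out"
      by (rule sized_reg[OF okS le(1)]) simp
    have "R(1 := h v n, 2 := n, 3 := v, 1 := 0) = R(1 := 0, 2 := n, 3 := v)" by (auto simp: fun_eq_iff)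
    then have 3: "runs w (Set_Reg 1 (Lit 0)) (St (R(1 := h v n, 2 := n, 3 := v)) (M (Suc v))) 2
        (St (R(1 := 0, 2 := n, 3 := v)) (M (Suc v)))"
      unfolding M_def by (intro runs_Set_Reg[OF o2 c(2)]) simp_all
    have "R(1 := 0, 2 := n, 3 := v, 2 := 0) = R(3 := v)" using sized by (auto simp: idle_def fun_eq_iff)
    then have 4: "runs w (Set_Reg 2 (Lit 0)) (St (R(1 := 0, 2 := n, 3 := v)) (M (Suc v))) 2
        (St (R(3 := v)) (M (Suc v)))"
      unfolding M_def by (intro runs_Set_Reg[OF o3 c(2)]) simp_all
    have 5: "runs w (Set_Reg 3 (Plus (Reg 3) (Lit 1))) (St (R(3 := v)) (M (Suc v))) 4
        (St (R(3 := Suc v)) (M (Suc v)))"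
      unfolding M_def by (intro runs_Set_Reg[OF o4 c(3)]) simp_all
    have 6: "runs w (While (Minus (Reg 0) (Reg 3)) body) (St (R(3 := Suc v)) (M (Suc v)))
        ((n - Suc v) * (109 * n + 130) + 4) (St (R(3 := n)) (M n))"
      using Suc by simp
    have b: "runs w body (St (R(3 := v)) (M v)) (n * 109 + 4 + (9 + ram_cost e' + 1 + (2 + (2 + 4))))
        (St (R(3 := Suc v)) (M (Suc v)))"
      unfolding body_def by (intro runs_Seq[OF 1] runs_Seq[OF 2] runs_Seq[OF 3] runs_Seq[OF 4] 5)
    have t: "ram_val (St (R(3 := v)) (M v)) (Minus (Reg 0) (Reg 3)) \<noteq> 0" using sized v by (simp add: sized_def)
    have eq: "n - v = Suc (n - Suc v)" using v by simp
    show ?case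
      by (rule runs_mono[OF runs_While_step[OF fits_cheap[OF o0 c(1), folded M_def] t b 6]])
        (use e(2) in \<open>simp add: eq cheap_def\<close>)
  qed
  have o: "sized (R(3 := n)) (arrs(k := (\<lambda>u. if u < n then F u else arrs k u))) out"
    by (rule sized_reg[OF okM B_ge(2)]) simp
  have Mn: "M n = layout (arrs(k := F)) out" unfolding M_def by (rule layout_cong) simp
  have "R(3 := n, 3 := 0) = R" using sized by (auto simp: idle_def fun_eq_iff)
  then have 2: "runs w (Set_Reg 3 (Lit 0)) (St (R(3 := n)) (M n)) 2 (St R (M n))"
    unfolding M_def by (intro runs_Set_Reg[OF o c(2)]) simp_all
  have "R(3 := 0) = R" using sized by (auto simp: idle_def fun_eq_iff)
  moreover have "M 0 = layout arrs out" by (simp add: M_def)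
  ultimately have 1: "runs w (While (Minus (Reg 0) (Reg 3)) body) (St R (layout arrs out)) (n * (109 * n + 130) + 4) (St (R(3 := n)) (M n))"
    using loop[of 0] by simp
  have "n \<le> n ^ 2" "1 \<le> n ^ 2" "n * n = n ^ 2" using n_pos by (simp_all add: power2_eq_square)
  then have "n * (109 * n + 130) + 4 + 2 \<le> 500 * n ^ 2" by (simp add: distrib_left)
  from runs_mono[OF runs_Seq[OF 1 2] this] show ?thesis unfolding map_prog_def body_def[symmetric] Mn .
qed

text \<open>Tokens read neither memory nor register 11, and register 1 is already 0. So all of them
  can be evaluated in the initial registers over a dummy memory.\<close>

lemma runs_emit:
  assumes sized: "sized R arrs out" and idle: "R 1 = 0"
    and p: "R 11 = n * n + 8 * n + length out" "R 11 + length es \<le> B"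
    and es: "\<And>e. e \<in> set es \<Longrightarrow> (\<exists>c\<le>100. e = Lit c) \<or> (\<exists>r. e = Reg r \<and> r \<noteq> 11)"
  shows "runs w (emit_prog es) (St R (layout arrs out)) (7 * length es + 2)
     (St (R(11 := R 11 + length es)) (layout arrs (out @ map (ram_val (St R (\<lambda>_. 0))) es)))"
  using assms
proof (induction es arbitrary: R out)
  case Nil
  have "R(Suc 0 := 0) = R" using Nil.prems(2) by (auto simp: fun_eq_iff)
  then show ?case 
    by (simp only: emit_prog.simps list.size(3) add_0_right append_Nil2 list.map)
      (intro runs_Set_Reg[OF Nil.prems(1)]; simp add: cheap_def)
next
  case (Cons e es)
  note sized = Cons.prems(1)
  let ?x = "ram_val (St R (\<lambda>_. 0)) e" and ?R = "R(11 := R 11 + 1)"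
  have e: "(\<exists>c\<le>100. e = Lit c) \<or> (\<exists>r. e = Reg r \<and> r \<noteq> 11)" using Cons.prems(5) by simp
  then have ec: "cheap e" "ram_cost e = 1" and x: "?x = ram_val (St R (layout arrs out)) e" "?x \<le> B"
    using sized B_ge(1) by (auto simp: cheap_def sized_def)
  have c: "cheap (Reg 11)" "cheap (Plus (Reg 11) (Lit 1))" by (simp_all add: cheap_def)
  have 1: "runs w (Set_Mem (Reg 11) e) (St R (layout arrs out)) 3 (St R (layout arrs (out @ [?x])))"
    using ec(2) x(1) Cons.prems(3) by (intro runs_Set_Mem[OF sized c(1) ec(1)]) (simp_all add: layout_append)
  have ok1: "sized R arrs (out @ [?x])" using sized_out[OF sized x(2)] .
  have 2: "runs w (Set_Reg 11 (Plus (Reg 11) (Lit 1))) (St R (layout arrs (out @ [?x]))) 4 (St ?R (layout arrs (out @ [?x])))"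
    by (intro runs_Set_Reg[OF ok1 c(2)]) simp_all
  have ok2: "sized ?R arrs (out @ [?x])" using sized_reg[OF ok1] Cons.prems(4) by simp
  have "ram_val (St ?R (\<lambda>_. 0)) e' = ram_val (St R (\<lambda>_. 0)) e'" if "e' \<in> set es" for e'
    using Cons.prems(5)[of e'] that by auto
  then have m: "map (ram_val (St ?R (\<lambda>_. 0))) es = map (ram_val (St R (\<lambda>_. 0))) es" by simp
  have 3: "runs w (emit_prog es) (St ?R (layout arrs (out @ [?x]))) (7 * length es + 2)
     (St (?R(11 := ?R 11 + length es)) (layout arrs ((out @ [?x]) @ map (ram_val (St ?R (\<lambda>_. 0))) es)))"
    by (rule Cons.IH[OF ok2]) (use Cons.prems in auto)
  have R: "?R(11 := ?R 11 + length es) = R(11 := R 11 + length (e # es))" by (intro ext) simp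
  have o: "(out @ [?x]) @ map (ram_val (St R (\<lambda>_. 0))) es = out @ map (ram_val (St R (\<lambda>_. 0))) (e # es)" by simp
  show ?case unfolding emit_prog.simps
    by (rule runs_mono[OF runs_Seq[OF runs_Seq[OF 1 2] 3[unfolded m R o]]]) simp
qed

end

section \<open>One step of the decomposition\<close>

definition K_flag :: "ram_exp \<Rightarrow> ram_exp" where
  "K_flag a = Times (arr_exp 3 a) (not_exp (arr_exp 0 a))"

definition I_flag :: "ram_exp \<Rightarrow> ram_exp" where
  "I_flag a = Times (arr_exp 3 a) (arr_exp 0 a)"

abbreviation sum_prog :: "nat \<Rightarrow> ram_exp \<Rightarrow> ram_prog" where
  "sum_prog r e \<equiv> fold_prog r (Plus (Reg 1) e)"

abbreviation skip_prog :: ram_prog where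
  "skip_prog \<equiv> emit_prog []"

definition header :: "nat list" where
  "header = [2, 5, 1, 2, 4, 2, 2, 3, 1, 3, 5, 4, 3, 5, 3, 3, 5, 1, 3, 3, 1, 3, 3, 2]"

text \<open>Registers: 4 stack level, 5 size of the top block, 6 and 7 its edges of minimum and maximum size,
  8 number of its clique vertices, 9 the vertex \<open>z\<close>, 10 size of the first part, 11 output address,
  12 label of \<open>z\<close>.\<close>

definition pick_prog :: ram_prog where
  "pick_prog =
     Seq (map_prog 4 (Plus (Reg 1) (Times (adj_exp (Reg 3) (Reg 2)) (K_flag (Reg 2))))
            (Plus (Times (Reg 0) (Reg 1)) (Reg 3)))
    (Seq (map_prog 5 (Plus (Reg 1) (Times (I_flag (Reg 2)) (Minus (arr_exp 4 (Reg 3)) (arr_exp 4 (Reg 2)))))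
            (Times (I_flag (Reg 3)) (not_exp (Reg 1))))
    (Seq (map_prog 6 (Plus (Reg 1) (Times (I_flag (Reg 2)) (Minus (arr_exp 4 (Reg 2)) (arr_exp 4 (Reg 3)))))
            (Times (I_flag (Reg 3)) (not_exp (Reg 1))))
    (Seq (sum_prog 6 (Times (Reg 2) (arr_exp 5 (Reg 2))))
    (Seq (sum_prog 7 (Times (Reg 2) (arr_exp 6 (Reg 2))))
    (Seq (sum_prog 8 (K_flag (Reg 2)))
    (Seq (map_prog 7 (Lit 0) (Times (arr_exp 3 (Reg 3)) (Plus (not_exp (Reg 8))
            (Times (not_exp (arr_exp 0 (Reg 3))) (Plus (eq_exp (Reg 6) (Reg 7))
               (Times (adj_exp (Reg 6) (Reg 3)) (not_exp (adj_exp (Reg 7) (Reg 3)))))))))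
         (fold_prog 9 (Plus (Times (not_exp (arr_exp 7 (Reg 2))) (Reg 1))
            (Times (not_exp (not_exp (arr_exp 7 (Reg 2)))) (Reg 2))))))))))"

definition split_prog :: ram_prog where
  "split_prog =
     Seq (map_prog 7 (Plus (Reg 1) (Times (I_flag (Reg 2)) (Times (adj_exp (Reg 2) (Reg 9)) (adj_exp (Reg 2) (Reg 3)))))
            (Times (Times (arr_exp 3 (Reg 3)) (not_exp (eq_exp (Reg 3) (Reg 9))))
              (Plus (Times (arr_exp 0 (Reg 3)) (adj_exp (Reg 3) (Reg 9)))
                (Times (not_exp (arr_exp 0 (Reg 3))) (not_exp (not_exp (Reg 1)))))))
    (Seq (sum_prog 10 (arr_exp 7 (Reg 2)))
         (map_prog 2 (Lit 0) (Times (not_exp (eq_exp (Reg 3) (Reg 9))) (Plus (arr_exp 2 (Reg 3)) (arr_exp 7 (Reg 3))))))"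

text \<open>\<open>5 - 3 * flag\<close> yields label 5 for a clique vertex and 2 for an independent
  one. The second part has size \<open>Reg 5 - 1 - Reg 10\<close>, the 1 accounting for
  \<open>z\<close>. The tokens come in the order of \<open>encode_glue\<close>.\<close>

definition output_prog :: ram_prog where
  "output_prog =
     Seq (Set_Reg 12 (Minus (Lit 5) (Times (Lit 3) (arr_exp 0 (Reg 9)))))
    (Seq (emit_prog (map Lit header))
    (Seq (Cond (Minus (Minus (Reg 5) (Lit 1)) (Reg 10)) (emit_prog [Lit 1]) skip_prog)
    (Seq (Cond (Reg 10) (emit_prog [Lit 1]) skip_prog)
    (Seq (emit_prog [Lit 0, Reg 12, Reg 9])
    (Seq (Cond (Reg 10) (emit_prog (map Lit [2, 1, 3, 2, 2, 4])) skip_prog)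
         (Set_Reg 4 (Plus (Reg 4) (Lit 1))))))))"

text \<open>A split always opens a level, even for an empty first part, so empty blocks do occur on
  top; they are popped without output.\<close>

definition body_prog :: ram_prog where
  "body_prog =
     Seq (map_prog 3 (Lit 0) (eq_exp (arr_exp 2 (Reg 3)) (Reg 4)))
    (Seq (sum_prog 5 (arr_exp 3 (Reg 2)))
         (Cond (Reg 5) (Seq pick_prog (Seq split_prog output_prog)) (Set_Reg 4 (Minus (Reg 4) (Lit 1)))))"

text \<open>The independent set is taken to be the vertices with a non-neighbour of larger degree
  key. A vertex counts as its own non-neighbour, but its key does not exceed itself.\<close>

definition init_prog :: ram_prog where
  "init_prog =
     Seq (map_prog 4 (Plus (Reg 1) (adj_exp (Reg 3) (Reg 2))) (Plus (Times (Reg 0) (Reg 1)) (Reg 3)))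
    (Seq (map_prog 0 (Plus (Reg 1) (Times (Minus (arr_exp 4 (Reg 2)) (arr_exp 4 (Reg 3))) (not_exp (adj_exp (Reg 3) (Reg 2)))))
            (not_exp (not_exp (Reg 1))))
    (Seq (map_prog 2 (Lit 0) (Lit 1))
    (Seq (Set_Reg 11 (addr_exp 8 (Lit 0)))
         (Set_Reg 4 (Lit 1)))))"

text \<open>All addresses are computed from \<open>n\<close> in register 0, so the output length is
  stored before that register is overwritten.\<close>

definition expression_prog :: ram_prog where
  "expression_prog =
     Seq init_prog
    (Seq (While (Reg 4) body_prog)
    (Seq (Set_Reg 1 (Minus (Reg 11) (addr_exp 8 (Lit 0))))
         (Set_Reg 0 (addr_exp 8 (Lit 0)))))"

lemmas flag_defs = K_flag_def I_flag_def

section \<open>Final states of the programs for one step\<close>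

context array_machine
begin

lemma runs_sum:
  assumes "sized R arrs out" "idle R" "cheap (Plus (Reg 1) e)"
    and "\<And>x. x < n \<Longrightarrow> F x \<le> b" "n * b \<le> B"
      "\<And>x y. x < n \<Longrightarrow> ram_val (St (R(1 := y, 2 := x)) (layout arrs out)) e = F x"
    and "r > 3" "(\<Sum>x<n. F x) = t"
  shows "runs w (sum_prog r e) (St R (layout arrs out)) (200 * n) (St (R(r := t)) (layout arrs out))"
  unfolding assms(8)[symmetric]
proof (rule runs_fold[where h = "\<lambda>x. \<Sum>y<x. F y", OF assms(1-3) _ _ _ assms(7)])
  fix x assume "x \<le> n"
  then have "(\<Sum>y<x. F y) \<le> x * b" using sum_bounded_above[of "{..<x}" F b] assms(4) by simp
  also have "\<dots> \<le> n * b" using \<open>x \<le> n\<close> by simp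
  finally show "(\<Sum>y<x. F y) \<le> B" using assms(5) by simp
qed (use assms(6) in simp_all)

lemma runs_sum_map:
  assumes "sized R arrs out" "idle R" "cheap (Plus (Reg 1) e)" "cheap e'" "k < 8"
    and "\<And>v x. v < n \<Longrightarrow> x < n \<Longrightarrow> G v x \<le> b" "n * b \<le> B"
      "\<And>v x y. v < n \<Longrightarrow> x < n \<Longrightarrow> ram_val (St (R(1 := y, 2 := x, 3 := v))
          (layout (arrs(k := (\<lambda>u. if u < v then F u else arrs k u))) out)) e = G v x"
    and "\<And>v. v < n \<Longrightarrow> F v \<le> B"
      "\<And>v. v < n \<Longrightarrow> ram_val (St (R(1 := (\<Sum>x<n. G v x), 2 := n, 3 := v))
          (layout (arrs(k := (\<lambda>u. if u < v then F u else arrs k u))) out)) e' = F v"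
  shows "runs w (map_prog k (Plus (Reg 1) e) e') (St R (layout arrs out)) (500 * n ^ 2) (St R (layout (arrs(k := F)) out))"
proof (rule runs_map[where h = "\<lambda>v x. \<Sum>y<x. G v y", OF assms(1-5) _ _ _ assms(9)])
  fix v x assume v: "v < n" "x \<le> n"
  then have "(\<Sum>y<x. G v y) \<le> x * b" using sum_bounded_above[of "{..<x}" "G v" b] assms(6) by simp
  also have "\<dots> \<le> n * b" using \<open>x \<le> n\<close> by simp
  finally show "(\<Sum>y<x. G v y) \<le> B" using assms(7) by simp
qed (use assms(8,10) in simp_all)

lemma runs_simple_map:
  assumes "sized R arrs out" "idle R" "cheap e'" "k < 8"
    and "\<And>v. v < n \<Longrightarrow> F v \<le> B"
      "\<And>v. v < n \<Longrightarrow> ram_val (St (R(1 := 0, 2 := n, 3 := v))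
          (layout (arrs(k := (\<lambda>u. if u < v then F u else arrs k u))) out)) e' = F v"
  shows "runs w (map_prog k (Lit 0) e') (St R (layout arrs out)) (500 * n ^ 2) (St R (layout (arrs(k := F)) out))"
  by (rule runs_map[where h = "\<lambda>_ _. 0", OF assms(1,2) _ assms(3,4) _ _ _ assms(5,6)])
    (simp_all add: cheap_def)

text \<open>The degree into the clique part of \<open>S\<close>, made injective by adding the vertex number.\<close>

definition key :: "nat set \<Rightarrow> nat set \<Rightarrow> nat \<Rightarrow> nat" where
  "key S I v = n * (\<Sum>x<n. of_bool (adj v x) * (of_bool (x \<in> S) * of_bool (x \<notin> I))) + v"

text \<open>With truncated subtraction the sum vanishes exactly when no independent vertex of
  \<open>S\<close> has a smaller key.\<close>

definition min_flag :: "nat set \<Rightarrow> nat set \<Rightarrow> nat \<Rightarrow> nat" where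
  "min_flag S I v = of_bool (v \<in> S) * of_bool (v \<in> I)
     * of_bool ((\<Sum>x<n. of_bool (x \<in> S) * of_bool (x \<in> I) * (key S I v - key S I x)) = 0)"

definition max_flag :: "nat set \<Rightarrow> nat set \<Rightarrow> nat \<Rightarrow> nat" where
  "max_flag S I v = of_bool (v \<in> S) * of_bool (v \<in> I)
     * of_bool ((\<Sum>x<n. of_bool (x \<in> S) * of_bool (x \<in> I) * (key S I x - key S I v)) = 0)"

text \<open>As keys are injective, at most one flag is set and the weighted sum returns its index.
  The value defaults to 0 if \<open>S\<close> has no independent vertex.\<close>

definition min_vertex :: "nat set \<Rightarrow> nat set \<Rightarrow> nat" where
  "min_vertex S I = (\<Sum>x<n. x * min_flag S I x)"

definition max_vertex :: "nat set \<Rightarrow> nat set \<Rightarrow> nat" where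
  "max_vertex S I = (\<Sum>x<n. x * max_flag S I x)"

definition num_K :: "nat set \<Rightarrow> nat set \<Rightarrow> nat" where
  "num_K S I = (\<Sum>x<n. of_bool (x \<in> S) * of_bool (x \<notin> I))"

text \<open>Sums and products stand for disjunction and conjunction, in the form computed by the
  program; the value may exceed 1, and only whether it is nonzero counts.\<close>

definition candidate :: "nat set \<Rightarrow> nat set \<Rightarrow> nat \<Rightarrow> nat" where
  "candidate S I v = of_bool (v \<in> S) * (of_bool (num_K S I = 0) + of_bool (v \<notin> I) *
     (of_bool (min_vertex S I = max_vertex S I) + of_bool (adj (min_vertex S I) v) * of_bool (\<not> adj (max_vertex S I) v)))"

primrec pick :: "nat set \<Rightarrow> nat set \<Rightarrow> nat \<Rightarrow> nat" where
  "pick S I 0 = 0"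
| "pick S I (Suc x) = (if candidate S I x = 0 then pick S I x else x)"

definition attached_flag :: "nat set \<Rightarrow> nat set \<Rightarrow> nat \<Rightarrow> nat \<Rightarrow> nat" where
  "attached_flag S I z v = of_bool (v \<in> S) * of_bool (v \<noteq> z) * (of_bool (v \<in> I) * of_bool (adj v z)
     + of_bool (v \<notin> I) * of_bool ((\<Sum>x<n. of_bool (x \<in> S) * of_bool (x \<in> I) * (of_bool (adj x z) * of_bool (adj x v))) \<noteq> (0 :: nat)))"

lemma key_le: "v < n \<Longrightarrow> key S I v \<le> n * n + n"
proof -
  assume "v < n"
  have "(\<Sum>x<n. of_bool (adj v x) * (of_bool (x \<in> S) * of_bool (x \<notin> I))) \<le> card {..<n} * (1 :: nat)"
    by (rule order_trans[OF sum_bounded_above[where K = 1]]) auto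
  then have "n * (\<Sum>x<n. of_bool (adj v x) * (of_bool (x \<in> S) * of_bool (x \<notin> I))) \<le> n * n"
    by (intro mult_left_mono) auto
  then show ?thesis using \<open>v < n\<close> unfolding key_def by linarith
qed

text \<open>The vertex number is the key modulo \<open>n\<close>.\<close>

lemma key_inj: "u < n \<Longrightarrow> v < n \<Longrightarrow> key S I u = key S I v \<Longrightarrow> u = v"
proof -
  assume uv: "u < n" "v < n" and eq: "key S I u = key S I v"
  have "key S I x mod n = x" if "x < n" for x using that unfolding key_def by simp
  from this[OF uv(1)] this[OF uv(2)] show "u = v" unfolding eq by (rule trans[OF sym])
qed

lemma flag_le: "min_flag S I v \<le> 1" "max_flag S I v \<le> 1" "attached_flag S I z v \<le> 1" "candidate S I v \<le> 3"
proof -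
  have "of_bool a * of_bool b * of_bool c \<le> (1 :: nat)" for a b c
    by (cases a; cases b; cases c) simp_all
  moreover have "of_bool a * of_bool b * (of_bool c * of_bool d + of_bool (\<not> c) * of_bool e) \<le> (1 :: nat)" for a b c d e
    by (cases a; cases b; cases c; cases d; cases e) simp_all
  moreover have "of_bool a * (of_bool b + of_bool c * (of_bool d + of_bool e * of_bool f)) \<le> (3 :: nat)" for a b c d e f
    by (cases a; cases b; cases c; cases d; cases e; cases f) simp_all
  ultimately show "min_flag S I v \<le> 1" "max_flag S I v \<le> 1" "attached_flag S I z v \<le> 1" "candidate S I v \<le> 3"
    unfolding min_flag_def max_flag_def attached_flag_def candidate_def by (simp_all only:)
qed

lemma num_K_eq: "S \<subseteq> {..<n} \<Longrightarrow> num_K S I = 0 \<longleftrightarrow> S - I = {}"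
  by (auto simp: num_K_def)

lemma min_flag_iff:
  assumes "S \<subseteq> {..<n}" shows "min_flag S I v = of_bool (v \<in> S \<inter> I \<and> (\<forall>x\<in>S \<inter> I. key S I v \<le> key S I x))"
  using assms unfolding min_flag_def by (auto simp: subset_iff)

lemma max_flag_iff:
  assumes "S \<subseteq> {..<n}" shows "max_flag S I v = of_bool (v \<in> S \<inter> I \<and> (\<forall>x\<in>S \<inter> I. key S I x \<le> key S I v))"
  using assms unfolding max_flag_def by (auto simp: subset_iff)

lemma sum_unique_flag:
  assumes "a < n" "\<And>x. x < n \<Longrightarrow> f x = (of_bool (x = a) :: nat)"
  shows "(\<Sum>x<n. x * f x) = a"
proof -
  have "(\<Sum>x<n. x * f x) = (\<Sum>x<n. if x = a then a else 0)" using assms(2) by (intro sum.cong) auto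
  then show ?thesis using assms(1) by simp
qed

lemma min_vertex_eq:
  assumes "S \<subseteq> {..<n}" "S \<inter> I \<noteq> {}"
  shows "min_vertex S I \<in> S \<inter> I" "x \<in> S \<inter> I \<Longrightarrow> key S I (min_vertex S I) \<le> key S I x"
proof -
  have fin: "finite (key S I ` (S \<inter> I))" using assms(1) finite_subset by blast
  have "Min (key S I ` (S \<inter> I)) \<in> key S I ` (S \<inter> I)" using assms(2) by (intro Min_in[OF fin]) simp
  then obtain a where a: "a \<in> S \<inter> I" "key S I a = Min (key S I ` (S \<inter> I))" by (metis imageE)
  have le: "key S I a \<le> key S I x" if "x \<in> S \<inter> I" for x
    unfolding a(2) by (rule Min_le[OF fin]) (use that in simp)
  have "min_flag S I x = of_bool (x = a)" if "x < n" for x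
  proof -
    have "x = a" if "x \<in> S \<inter> I" "\<forall>y\<in>S \<inter> I. key S I x \<le> key S I y"
      by (rule key_inj[where S = S and I = I]) (use that a(1) le[OF that(1)] assms(1) \<open>x < n\<close> in \<open>auto intro: antisym\<close>)
    then have "x \<in> S \<inter> I \<and> (\<forall>y\<in>S \<inter> I. key S I x \<le> key S I y) \<longleftrightarrow> x = a" using a(1) le by blast
    then show ?thesis unfolding min_flag_iff[OF assms(1)] by (simp only:)
  qed
  then have "min_vertex S I = a" unfolding min_vertex_def using a(1) assms(1) by (intro sum_unique_flag) auto
  then show "min_vertex S I \<in> S \<inter> I" "x \<in> S \<inter> I \<Longrightarrow> key S I (min_vertex S I) \<le> key S I x" using a(1) le by auto
qed

lemma max_vertex_eq:
  assumes "S \<subseteq> {..<n}" "S \<inter> I \<noteq> {}"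
  shows "max_vertex S I \<in> S \<inter> I" "x \<in> S \<inter> I \<Longrightarrow> key S I x \<le> key S I (max_vertex S I)"
proof -
  have fin: "finite (key S I ` (S \<inter> I))" using assms(1) finite_subset by blast
  have "Max (key S I ` (S \<inter> I)) \<in> key S I ` (S \<inter> I)" using assms(2) by (intro Max_in[OF fin]) simp
  then obtain a where a: "a \<in> S \<inter> I" "key S I a = Max (key S I ` (S \<inter> I))" by (metis imageE)
  have le: "key S I x \<le> key S I a" if "x \<in> S \<inter> I" for x
    unfolding a(2) by (rule Max_ge[OF fin]) (use that in simp)
  have "max_flag S I x = of_bool (x = a)" if "x < n" for x
  proof -
    have "x = a" if "x \<in> S \<inter> I" "\<forall>y\<in>S \<inter> I. key S I y \<le> key S I x"
      by (rule key_inj[where S = S and I = I]) (use that a(1) le[OF that(1)] assms(1) \<open>x < n\<close> in \<open>auto intro: antisym\<close>)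
    then have "x \<in> S \<inter> I \<and> (\<forall>y\<in>S \<inter> I. key S I y \<le> key S I x) \<longleftrightarrow> x = a" using a(1) le by blast
    then show ?thesis unfolding max_flag_iff[OF assms(1)] by (simp only:)
  qed
  then have "max_vertex S I = a" unfolding max_vertex_def using a(1) assms(1) by (intro sum_unique_flag) auto
  then show "max_vertex S I \<in> S \<inter> I" "x \<in> S \<inter> I \<Longrightarrow> key S I x \<le> key S I (max_vertex S I)" using a(1) le by auto
qed

text \<open>Both indices default to 0, so the test for equal extremal vertices treats the absence of
  edges like the presence of a single one.\<close>

lemma min_max_empty:
  assumes "S \<subseteq> {..<n}" "S \<inter> I = {}" shows "min_vertex S I = 0" "max_vertex S I = 0"
  using assms by (simp_all add: min_vertex_def max_vertex_def min_flag_iff max_flag_iff)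

lemma min_max_less:
  assumes "S \<subseteq> {..<n}" shows "min_vertex S I < n" "max_vertex S I < n"
  using min_vertex_eq(1)[OF assms, of I] max_vertex_eq(1)[OF assms, of I] min_max_empty[OF assms, of I] assms n_pos
  by (cases "S \<inter> I = {}"; auto)+

lemma pick_less: "x \<le> n \<Longrightarrow> pick S I x < n"
  using n_pos by (induction x) auto

lemma pick_cand: "v < x \<Longrightarrow> candidate S I v \<noteq> 0 \<Longrightarrow> candidate S I (pick S I x) \<noteq> 0"
  by (induction x) (auto simp: less_Suc_eq)

lemmas cheap_simps = cheap_def exp_defs flag_defs

lemma sum_flag_le: "(\<Sum>x<n. f x) \<le> n" if "\<And>x. x < n \<Longrightarrow> f x \<le> (1 :: nat)"
  using sum_bounded_above[of "{..<n}" f 1] that by simp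

lemma num_K_le: "num_K S I \<le> n"
  unfolding num_K_def by (rule sum_flag_le) (simp add: of_bool_def)

text \<open>Ties of degree are broken by the vertex number, so that of two non-adjacent vertices of
  equal degree exactly one yields to the other.\<close>

definition deg_key :: "nat \<Rightarrow> nat" where
  "deg_key v = n * (\<Sum>x<n. of_bool (adj v x)) + v"

lemma deg_key_le: "v < n \<Longrightarrow> deg_key v \<le> n * n + n"
proof -
  assume "v < n"
  have "(\<Sum>x<n. of_bool (adj v x)) \<le> n" by (rule sum_flag_le) (simp add: of_bool_def)
  then have "n * (\<Sum>x<n. of_bool (adj v x)) \<le> n * n" by (intro mult_left_mono) auto
  then show ?thesis using \<open>v < n\<close> unfolding deg_key_def by linarith
qed

lemma runs_pick:
  assumes sized: "sized R arrs out" "idle R" and S: "S \<subseteq> {..<n}"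
    and i: "\<And>v. v < n \<Longrightarrow> arrs 0 v = of_bool (v \<in> I)" and s: "\<And>v. v < n \<Longrightarrow> arrs 3 v = of_bool (v \<in> S)"
  defines "arrs' \<equiv> arrs(4 := key S I, 5 := min_flag S I, 6 := max_flag S I, 7 := candidate S I)"
    and "R' \<equiv> R(6 := min_vertex S I, 7 := max_vertex S I, 8 := num_K S I, 9 := pick S I n)"
  shows "runs w pick_prog (St R (layout arrs out)) (4 * (500 * n ^ 2) + 4 * (200 * n)) (St R' (layout arrs' out))"
    and "sized R' arrs' out" "idle R'"
proof -
  have R0: "R 0 = n" using sized(1) by (simp add: sized_def)
  let ?a4 = "arrs(4 := key S I)"
  let ?a5 = "arrs(4 := key S I, 5 := min_flag S I)"
  let ?a6 = "arrs(4 := key S I, 5 := min_flag S I, 6 := max_flag S I)"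
  let ?R6 = "R(6 := min_vertex S I)"
  let ?R7 = "R(6 := min_vertex S I, 7 := max_vertex S I)"
  let ?R8 = "R(6 := min_vertex S I, 7 := max_vertex S I, 8 := num_K S I)"
  have kB: "key S I v \<le> B" if "v < n" for v using key_le[OF that, of S I] B_ge(4) by linarith
  have fB: "min_flag S I v \<le> B" "max_flag S I v \<le> B" "candidate S I v \<le> B" for v
    using flag_le[of S I v] B_ge(1) by linarith+
  have lB: "min_vertex S I \<le> B" "max_vertex S I \<le> B" "num_K S I \<le> B" "pick S I n \<le> B"
    using min_max_less[OF S, of I] B_ge(2) num_K_le[of S I] pick_less[OF order_refl, of S I] by linarith+
  have o4: "sized R ?a4 out" by (rule sized_arr[OF sized(1) kB])
  have o5: "sized R ?a5 out" by (rule sized_arr[OF o4 fB(1)])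
  have o6: "sized R ?a6 out" by (rule sized_arr[OF o5 fB(2)])
  have o6': "sized ?R6 ?a6 out" by (rule sized_reg[OF o6 lB(1)]) simp
  have o7: "sized ?R7 ?a6 out" by (rule sized_reg[OF o6' lB(2)]) simp
  have o8: "sized ?R8 ?a6 out" by (rule sized_reg[OF o7 lB(3)]) simp
  have o9: "sized ?R8 arrs' out" unfolding arrs'_def by (rule sized_arr[OF o8 fB(3)])
  have i6: "idle ?R6" by (rule idle_upd[OF sized(2)]) simp
  have i7: "idle ?R7" by (rule idle_upd[OF i6]) simp
  have i8: "idle ?R8" by (rule idle_upd[OF i7]) simp
  show "sized R' arrs' out" unfolding R'_def by (rule sized_reg[OF o9 lB(4)]) simp
  show "idle R'" unfolding R'_def by (rule idle_upd[OF i8]) simp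
  have pB: "pick S I x \<le> B" if "x \<le> n" for x using pick_less[OF that, of S I] B_ge(2) by linarith
  have le: "of_bool a * of_bool b * (k - l) \<le> m" if "k \<le> m" for a b and k l m :: nat
    using that by (cases a; cases b) simp_all
  have le1: "of_bool (x \<in> S) * of_bool (x \<in> I) * (key S I v - key S I x) \<le> n * n + n"
    and le2: "of_bool (x \<in> S) * of_bool (x \<in> I) * (key S I x - key S I v) \<le> n * n + n"
    if "v < n" "x < n" for v x by (intro le key_le that)+
  have le3: "x * min_flag S I x \<le> n" and le4: "x * max_flag S I x \<le> n" if "x < n" for x
    using mult_mono[OF less_imp_le[OF that] flag_le(1)[of S I x]] mult_mono[OF less_imp_le[OF that] flag_le(2)[of S I x]] by simp_all
  have nB: "n * 1 \<le> B" "n * (n * n + n) \<le> B" "n * n \<le> B" using B_ge by linarith+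
  have 1: "runs w (map_prog 4 (Plus (Reg 1) (Times (adj_exp (Reg 3) (Reg 2)) (K_flag (Reg 2))))
            (Plus (Times (Reg 0) (Reg 1)) (Reg 3))) (St R (layout arrs out)) (500 * n ^ 2) (St R (layout ?a4 out))"
    by (rule runs_sum_map[where G = "\<lambda>v x. of_bool (adj v x) * (of_bool (x \<in> S) * of_bool (x \<notin> I))", OF sized _ _ _ _ nB(1)])
      (simp add: cheap_simps, simp add: cheap_simps, simp, simp add: of_bool_def, simp add: flag_defs R0 i s, rule kB, assumption, simp add: R0 key_def)
  have 2: "runs w (map_prog 5 (Plus (Reg 1) (Times (I_flag (Reg 2)) (Minus (arr_exp 4 (Reg 3)) (arr_exp 4 (Reg 2)))))
            (Times (I_flag (Reg 3)) (not_exp (Reg 1)))) (St R (layout ?a4 out)) (500 * n ^ 2) (St R (layout ?a5 out))"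
    by (rule runs_sum_map[where G = "\<lambda>v x. of_bool (x \<in> S) * of_bool (x \<in> I) * (key S I v - key S I x)", OF o4 sized(2) _ _ _ le1 nB(2)])
      (simp add: cheap_simps, simp add: cheap_simps, simp, assumption, assumption, simp add: flag_defs R0 i s, rule fB, simp add: flag_defs R0 i s min_flag_def)
  have 3: "runs w (map_prog 6 (Plus (Reg 1) (Times (I_flag (Reg 2)) (Minus (arr_exp 4 (Reg 2)) (arr_exp 4 (Reg 3)))))
            (Times (I_flag (Reg 3)) (not_exp (Reg 1)))) (St R (layout ?a5 out)) (500 * n ^ 2) (St R (layout ?a6 out))"
    by (rule runs_sum_map[where G = "\<lambda>v x. of_bool (x \<in> S) * of_bool (x \<in> I) * (key S I x - key S I v)", OF o5 sized(2) _ _ _ le2 nB(2)])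
      (simp add: cheap_simps, simp add: cheap_simps, simp, assumption, assumption, simp add: flag_defs R0 i s, rule fB, simp add: flag_defs R0 i s max_flag_def)
  have 4: "runs w (sum_prog 6 (Times (Reg 2) (arr_exp 5 (Reg 2)))) (St R (layout ?a6 out)) (200 * n) (St ?R6 (layout ?a6 out))"
    by (rule runs_sum[where F = "\<lambda>x. x * min_flag S I x", OF o6 sized(2) _ le3 nB(3)])
      (simp add: cheap_simps, assumption, simp add: R0, simp, simp add: min_vertex_def)
  have 5: "runs w (sum_prog 7 (Times (Reg 2) (arr_exp 6 (Reg 2)))) (St ?R6 (layout ?a6 out)) (200 * n) (St ?R7 (layout ?a6 out))"
    by (rule runs_sum[where F = "\<lambda>x. x * max_flag S I x", OF o6' i6 _ le4 nB(3)])
      (simp add: cheap_simps, assumption, simp add: R0, simp, simp add: max_vertex_def)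
  have 6: "runs w (sum_prog 8 (K_flag (Reg 2))) (St ?R7 (layout ?a6 out)) (200 * n) (St ?R8 (layout ?a6 out))"
    by (rule runs_sum[where F = "\<lambda>x. of_bool (x \<in> S) * of_bool (x \<notin> I)", OF o7 i7 _ _ nB(1)])
      (simp add: cheap_simps, simp add: of_bool_def, simp add: flag_defs R0 i s, simp, simp add: num_K_def)
  have 7: "runs w (map_prog 7 (Lit 0) (Times (arr_exp 3 (Reg 3)) (Plus (not_exp (Reg 8))
            (Times (not_exp (arr_exp 0 (Reg 3))) (Plus (eq_exp (Reg 6) (Reg 7))
               (Times (adj_exp (Reg 6) (Reg 3)) (not_exp (adj_exp (Reg 7) (Reg 3)))))))))
      (St ?R8 (layout ?a6 out)) (500 * n ^ 2) (St ?R8 (layout arrs' out))"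
    unfolding arrs'_def
    by (rule runs_simple_map[OF o8 i8])
      (simp add: cheap_simps, simp, rule fB, simp add: R0 i s min_max_less[OF S] candidate_def)
  have 8: "runs w (fold_prog 9 (Plus (Times (not_exp (arr_exp 7 (Reg 2))) (Reg 1))
            (Times (not_exp (not_exp (arr_exp 7 (Reg 2)))) (Reg 2))))
      (St ?R8 (layout arrs' out)) (200 * n) (St R' (layout arrs' out))"
    unfolding R'_def
    by (rule runs_fold[where h = "pick S I", OF o9 i8])
      (simp add: cheap_simps, simp, rule pB, assumption, simp add: R0 arrs'_def, simp)
  show "runs w pick_prog (St R (layout arrs out)) (4 * (500 * n ^ 2) + 4 * (200 * n)) (St R' (layout arrs' out))"
    unfolding pick_prog_def
    by (rule runs_mono[OF runs_Seq[OF 1 runs_Seq[OF 2 runs_Seq[OF 3 runs_Seq[OF 4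
        runs_Seq[OF 5 runs_Seq[OF 6 runs_Seq[OF 7 8]]]]]]]]) simp
qed

text \<open>On the block of level \<open>d\<close> the added flag lifts the first part to
  \<open>d + 1\<close>, the second part remains at \<open>d\<close>, and the factor marks
  \<open>z\<close> as finished.\<close>

definition relevel :: "(nat \<Rightarrow> nat) \<Rightarrow> nat set \<Rightarrow> nat set \<Rightarrow> nat \<Rightarrow> nat \<Rightarrow> nat" where
  "relevel L S I z v = of_bool (v \<noteq> z) * (L v + attached_flag S I z v)"

lemma runs_split:
  assumes sized: "sized R arrs out" "idle R" and S: "S \<subseteq> {..<n}"
    and i: "\<And>v. v < n \<Longrightarrow> arrs 0 v = of_bool (v \<in> I)" and s: "\<And>v. v < n \<Longrightarrow> arrs 3 v = of_bool (v \<in> S)"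
    and L: "\<And>v. v < n \<Longrightarrow> arrs 2 v \<le> n" and z: "R 9 = z" "z < n"
  defines "arrs' \<equiv> arrs(7 := attached_flag S I z, 2 := relevel (arrs 2) S I z)"
    and "R' \<equiv> R(10 := \<Sum>v<n. attached_flag S I z v)"
  shows "runs w split_prog (St R (layout arrs out)) (2 * (500 * n ^ 2) + 200 * n) (St R' (layout arrs' out))"
    and "sized R' arrs' out" "idle R'"
proof -
  have R0: "R 0 = n" using sized(1) by (simp add: sized_def)
  let ?a7 = "arrs(7 := attached_flag S I z)"
  have nB: "n * 1 \<le> B" using B_ge by linarith
  have aB: "attached_flag S I z v \<le> B" for v using flag_le(3)[of S I z v] B_ge(1) by linarith
  have sB: "(\<Sum>v<n. attached_flag S I z v) \<le> B"
    using sum_flag_le[OF flag_le(3)] B_ge(2) by (rule order_trans)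
  have lB: "relevel (arrs 2) S I z v \<le> B" if "v < n" for v
    using L[OF that] flag_le(3)[of S I z v] B_ge(1,3) unfolding relevel_def by (cases "v = z") auto
  have o7: "sized R ?a7 out" by (rule sized_arr[OF sized(1) aB])
  have o10: "sized R' ?a7 out" unfolding R'_def by (rule sized_reg[OF o7 sB]) simp
  show i10: "idle R'" unfolding R'_def by (rule idle_upd[OF sized(2)]) simp
  show "sized R' arrs' out" unfolding arrs'_def by (rule sized_arr[OF o10 lB])
  have le: "of_bool a * of_bool b * (of_bool c * of_bool d) \<le> (1 :: nat)" for a b c d
    by (cases a; cases b; cases c; cases d) simp_all
  have 1: "runs w (map_prog 7 (Plus (Reg 1) (Times (I_flag (Reg 2)) (Times (adj_exp (Reg 2) (Reg 9)) (adj_exp (Reg 2) (Reg 3)))))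
            (Times (Times (arr_exp 3 (Reg 3)) (not_exp (eq_exp (Reg 3) (Reg 9))))
              (Plus (Times (arr_exp 0 (Reg 3)) (adj_exp (Reg 3) (Reg 9)))
                (Times (not_exp (arr_exp 0 (Reg 3))) (not_exp (not_exp (Reg 1)))))))
      (St R (layout arrs out)) (500 * n ^ 2) (St R (layout ?a7 out))"
    by (rule runs_sum_map[where G = "\<lambda>v x. of_bool (x \<in> S) * of_bool (x \<in> I) * (of_bool (adj x z) * of_bool (adj x v))",
          OF sized _ _ _ le nB])
      (simp add: cheap_simps, simp add: cheap_simps, simp, simp add: flag_defs R0 i s z, rule aB, simp add: R0 i s z attached_flag_def)
  have 2: "runs w (sum_prog 10 (arr_exp 7 (Reg 2))) (St R (layout ?a7 out)) (200 * n) (St R' (layout ?a7 out))"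
    unfolding R'_def
    by (rule runs_sum[where F = "attached_flag S I z", OF o7 sized(2) _ flag_le(3) nB])
      (simp add: cheap_simps, simp add: R0, simp_all)
  have R9: "R' 0 = n" "R' 9 = z" by (simp_all add: R'_def R0 z)
  have 3: "runs w (map_prog 2 (Lit 0) (Times (not_exp (eq_exp (Reg 3) (Reg 9))) (Plus (arr_exp 2 (Reg 3)) (arr_exp 7 (Reg 3)))))
      (St R' (layout ?a7 out)) (500 * n ^ 2) (St R' (layout arrs' out))"
    unfolding arrs'_def
    by (rule runs_simple_map[OF o10 i10])
      (simp add: cheap_simps, simp, rule lB, assumption, simp add: R9 relevel_def)
  show "runs w split_prog (St R (layout arrs out)) (2 * (500 * n ^ 2) + 200 * n) (St R' (layout arrs' out))"
    unfolding split_prog_def by (rule runs_mono[OF runs_Seq[OF 1 runs_Seq[OF 2 3]]]) simp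
qed

definition writing :: "(nat \<Rightarrow> nat) \<Rightarrow> (nat \<Rightarrow> nat \<Rightarrow> nat) \<Rightarrow> nat list \<Rightarrow> bool" where
  "writing R arrs out \<longleftrightarrow> sized R arrs out \<and> idle R \<and> R 11 = n * n + 8 * n + length out"

lemma emit_step:
  assumes wr: "writing R arrs out" and p: "R 11 + length es \<le> B"
    and es: "\<And>e. e \<in> set es \<Longrightarrow> (\<exists>c\<le>100. e = Lit c) \<or> (\<exists>r. e = Reg r \<and> r \<noteq> 11)"
    and ts: "map (ram_val (St R (\<lambda>_. 0))) es = ts"
  shows "runs w (emit_prog es) (St R (layout arrs out)) (7 * length es + 2) (St (R(11 := R 11 + length ts)) (layout arrs (out @ ts)))"
    and "writing (R(11 := R 11 + length ts)) arrs (out @ ts)"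
proof -
  have len: "length es = length ts" using ts by auto
  show "runs w (emit_prog es) (St R (layout arrs out)) (7 * length es + 2) (St (R(11 := R 11 + length ts)) (layout arrs (out @ ts)))"
  proof -
    have "sized R arrs out" "R 1 = 0" "R 11 = n * n + 8 * n + length out"
      using wr unfolding writing_def idle_def by blast+
    from runs_emit[OF this p es] show ?thesis unfolding ts len .
  qed
  have "ram_val (St R (\<lambda>_. 0)) e \<le> B" if "e \<in> set es" for e
    using es[OF that] wr B_ge(1) unfolding writing_def sized_def by (auto intro: order_trans)
  then have "\<forall>t\<in>set ts. t \<le> B" unfolding ts[symmetric] by auto
  then show "writing (R(11 := R 11 + length ts)) arrs (out @ ts)"
    using wr p len unfolding writing_def sized_def idle_def by auto
qed

text \<open>Both branches are instances of \<open>emit_prog\<close>, for \<open>ts\<close> and for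
  the empty list, so \<open>emit_step\<close> handles them together.\<close>

lemma cond_emit_step:
  assumes wr: "writing R arrs out" and p: "R 11 + length ts \<le> B" and a: "cheap a"
    and ts: "\<forall>t\<in>set ts. t \<le> 100"
    and ts': "ts' = (if ram_val (St R (layout arrs out)) a \<noteq> 0 then ts else [])"
  shows "runs w (Cond a (emit_prog (map Lit ts)) skip_prog) (St R (layout arrs out)) (7 * length ts + 103)
      (St (R(11 := R 11 + length ts')) (layout arrs (out @ ts')))"
    and "writing (R(11 := R 11 + length ts')) arrs (out @ ts')"
proof -
  have sized: "sized R arrs out" using wr by (simp add: writing_def)
  define es where "es = (if ram_val (St R (layout arrs out)) a \<noteq> 0 then map Lit ts else [])"
  have es: "length es \<le> length ts" "map (ram_val (St R (\<lambda>_. 0))) es = ts'"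
    by (simp_all add: es_def ts' comp_def)
  have "\<And>e. e \<in> set es \<Longrightarrow> (\<exists>c\<le>100. e = Lit c) \<or> (\<exists>r. e = Reg r \<and> r \<noteq> 11)"
    using ts by (auto simp: es_def split: if_splits)
  note st = emit_step[OF wr _ this es(2)]
  have p': "R 11 + length es \<le> B" using p es(1) by simp
  show "writing (R(11 := R 11 + length ts')) arrs (out @ ts')" using st(2)[OF p'] by simp
  have e: "(if ram_val (St R (layout arrs out)) a \<noteq> 0 then emit_prog (map Lit ts) else skip_prog) = emit_prog es"
    by (simp add: es_def)
  have "runs w (Cond a (emit_prog (map Lit ts)) skip_prog) (St R (layout arrs out)) (ram_cost a + 1 + (7 * length es + 2))
      (St (R(11 := R 11 + length ts')) (layout arrs (out @ ts')))"
    by (rule runs_Cond[OF fits_cheap[OF sized a]], unfold e, rule st(1)[OF p'])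
  then show "runs w (Cond a (emit_prog (map Lit ts)) skip_prog) (St R (layout arrs out)) (7 * length ts + 103)
      (St (R(11 := R 11 + length ts')) (layout arrs (out @ ts')))"
    by (rule runs_mono) (use es(1) a in \<open>simp add: cheap_def\<close>)
qed

lemma writing_reg: "writing R arrs out \<Longrightarrow> x \<le> B \<Longrightarrow> r > 3 \<Longrightarrow> r \<noteq> 11 \<Longrightarrow> writing (R(r := x)) arrs out"
  by (simp add: writing_def sized_def idle_def)

text \<open>The portion of \<open>encode_glue\<close> that precedes the codes of the parts;
  \<open>b1\<close> and \<open>b2\<close> tell whether the first and the second part are
  nonempty.\<close>

definition tokens :: "nat \<Rightarrow> nat \<Rightarrow> bool \<Rightarrow> bool \<Rightarrow> nat list" where
  "tokens l z b1 b2 = header @ (if b2 then [1] else []) @ (if b1 then [1] else []) @ [0, l, z]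
     @ (if b1 then [2, 1, 3, 2, 2, 4] else [])"

text \<open>24 header tokens, one for each of two disjoint unions, 3 for creating \<open>z\<close>
  and 6 for the relabelling of the first part.\<close>

lemma length_tokens: "length (tokens l z b1 b2) \<le> 35"
  by (simp add: tokens_def header_def)

lemma runs_output:
  assumes wr: "writing R arrs out" and p: "R 11 + 35 \<le> B" "R 4 + 1 \<le> B"
    and z: "R 9 = z" "z < n" and i: "arrs 0 z = of_bool (z \<in> I)"
  defines "ts \<equiv> tokens (if z \<in> I then 2 else 5) z (R 10 \<noteq> 0) (R 5 - 1 - R 10 \<noteq> 0)"
  defines "R' \<equiv> R(12 := if z \<in> I then 2 else 5, 11 := R 11 + length ts, 4 := R 4 + 1)"
  shows "runs w output_prog (St R (layout arrs out)) 1000 (St R' (layout arrs (out @ ts)))"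
    and "writing R' arrs (out @ ts)"
proof -
  define l where "l = (if z \<in> I then 2 else (5 :: nat))"
  define t2 where "t2 = (if R 5 - 1 - R 10 \<noteq> 0 then [1] else ([] :: nat list))"
  define t3 where "t3 = (if R 10 \<noteq> 0 then [1] else ([] :: nat list))"
  define t5 where "t5 = (if R 10 \<noteq> 0 then [2, 1, 3, 2, 2, 4] else ([] :: nat list))"
  have ts: "ts = (((header @ t2) @ t3) @ [0, l, z]) @ t5"
    unfolding ts_def tokens_def l_def t2_def t3_def t5_def by simp
  have len: "length header = 24" "length t2 \<le> 1" "length t3 \<le> 1" "length t5 \<le> 6"
    by (simp_all add: header_def t2_def t3_def t5_def)
  have sized: "sized R arrs out" using wr by (simp add: writing_def)
  have R0: "R 0 = n" using sized by (simp add: sized_def)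
  define R1 where "R1 = R(12 := l)"
  define R2 where "R2 = R1(11 := R1 11 + length header)"
  define R3 where "R3 = R2(11 := R2 11 + length t2)"
  define R4 where "R4 = R3(11 := R3 11 + length t3)"
  define R5 where "R5 = R4(11 := R4 11 + length [0, l, z])"
  define R6 where "R6 = R5(11 := R5 11 + length t5)"
  note R_defs = R1_def R2_def R3_def R4_def R5_def R6_def
  have l5: "l \<le> B" using B_ge(1) by (simp add: l_def)
  have 1: "runs w (Set_Reg 12 (Minus (Lit 5) (Times (Lit 3) (arr_exp 0 (Reg 9))))) (St R (layout arrs out)) 15 (St R1 (layout arrs out))"
    unfolding R1_def
    by (intro runs_Set_Reg[OF sized]) (simp add: cheap_simps, simp add: R0 z i l_def, simp add: exp_defs)
  have w1: "writing R1 arrs out" unfolding R1_def by (rule writing_reg[OF wr l5]) simp_all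
  have hd: "map (ram_val (St R1 (\<lambda>_. 0))) (map Lit header) = header" by (simp add: comp_def)
  have "set header \<subseteq> {..100}" by (simp add: header_def)
  then have hs: "\<And>e. e \<in> set (map Lit header) \<Longrightarrow> (\<exists>c\<le>100. e = Lit c) \<or> (\<exists>r. e = Reg r \<and> r \<noteq> 11)" by auto
  have p1: "R1 11 + length (map Lit header) \<le> B" using p len by (simp add: R_defs)
  note 2 = emit_step(1)[OF w1 p1 hs hd, folded R2_def] and w2 = emit_step(2)[OF w1 p1 hs hd, folded R2_def]
  have c: "cheap (Minus (Minus (Reg 5) (Lit 1)) (Reg 10))" "cheap (Reg 10)" by (simp_all add: cheap_def)
  have p2: "R2 11 + length [1] \<le> B" using p len by (simp add: R_defs)
  have t2: "t2 = (if ram_val (St R2 (layout arrs (out @ header))) (Minus (Minus (Reg 5) (Lit 1)) (Reg 10)) \<noteq> 0 then [1] else [])"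
    by (simp add: t2_def R_defs)
  note cd = cond_emit_step[OF w2 p2 c(1) _ t2, folded R3_def]
  have 3: "runs w (Cond (Minus (Minus (Reg 5) (Lit 1)) (Reg 10)) (emit_prog [Lit 1]) skip_prog) (St R2 (layout arrs (out @ header))) 110
      (St R3 (layout arrs ((out @ header) @ t2)))" and w3: "writing R3 arrs ((out @ header) @ t2)"
    using cd by simp_all
  have p3: "R3 11 + length [1] \<le> B" using p len by (simp add: R_defs)
  have t3: "t3 = (if ram_val (St R3 (layout arrs ((out @ header) @ t2))) (Reg 10) \<noteq> 0 then [1] else [])"
    by (simp add: t3_def R_defs)
  note cd = cond_emit_step[OF w3 p3 c(2) _ t3, folded R4_def]
  have 4: "runs w (Cond (Reg 10) (emit_prog [Lit 1]) skip_prog) (St R3 (layout arrs ((out @ header) @ t2))) 110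
      (St R4 (layout arrs (((out @ header) @ t2) @ t3)))" and w4: "writing R4 arrs (((out @ header) @ t2) @ t3)"
    using cd by simp_all
  have p4: "R4 11 + length [Lit 0, Reg 12, Reg 9] \<le> B" using p len by (simp add: R_defs)
  have m4: "map (ram_val (St R4 (\<lambda>_. 0))) [Lit 0, Reg 12, Reg 9] = [0, l, z]" by (simp add: R_defs z)
  have s4: "\<And>e. e \<in> set [Lit 0, Reg 12, Reg 9] \<Longrightarrow> (\<exists>c\<le>100. e = Lit c) \<or> (\<exists>r. e = Reg r \<and> r \<noteq> 11)" by auto
  note 5 = emit_step(1)[OF w4 p4 s4 m4, folded R5_def] and w5 = emit_step(2)[OF w4 p4 s4 m4, folded R5_def]
  have p5: "R5 11 + length [2, 1, 3, 2, 2, 4 :: nat] \<le> B" using p len by (simp add: R_defs)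
  have t5: "t5 = (if ram_val (St R5 (layout arrs ((((out @ header) @ t2) @ t3) @ [0, l, z]))) (Reg 10) \<noteq> 0 then [2, 1, 3, 2, 2, 4] else [])"
    by (simp add: t5_def R_defs)
  note cd = cond_emit_step[OF w5 p5 c(2) _ t5, folded R6_def]
  have o: "out @ ts = ((((out @ header) @ t2) @ t3) @ [0, l, z]) @ t5" by (simp add: ts)
  have 6: "runs w (Cond (Reg 10) (emit_prog (map Lit [2, 1, 3, 2, 2, 4])) skip_prog)
      (St R5 (layout arrs ((((out @ header) @ t2) @ t3) @ [0, l, z]))) 145 (St R6 (layout arrs (out @ ts)))"
    and w6: "writing R6 arrs (out @ ts)"
    unfolding o using cd by simp_all
  have R': "R' = R6(4 := R6 4 + 1)"
    unfolding R'_def ts l_def[symmetric] by (simp add: R_defs add.assoc)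
  have 7: "runs w (Set_Reg 4 (Plus (Reg 4) (Lit 1))) (St R6 (layout arrs (out @ ts))) 4 (St R' (layout arrs (out @ ts)))"
    using w6 unfolding R' writing_def by (intro runs_Set_Reg) (simp_all add: cheap_def)
  show "writing R' arrs (out @ ts)" unfolding R' by (rule writing_reg[OF w6]) (use p in \<open>simp_all add: R_defs\<close>)
  show "runs w output_prog (St R (layout arrs out)) 1000 (St R' (layout arrs (out @ ts)))"
    unfolding output_prog_def
    by (rule runs_mono[OF runs_Seq[OF 1 runs_Seq[OF 2 runs_Seq[OF 3 runs_Seq[OF 4 runs_Seq[OF 5 runs_Seq[OF 6 7]]]]]]])
      (simp_all add: header_def)
qed

end

section \<open>The stack of blocks\<close>

locale split_machine = array_machine n w adj + split_relation adj "{..<n}" I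
  for n w :: nat and adj :: "nat \<Rightarrow> nat \<Rightarrow> bool" and I :: "nat set"
begin

lemma key_card:
  assumes "S \<subseteq> {..<n}" "v < n"
  shows "key S I v = n * card {x \<in> S - I. adj v x} + v"
proof -
  have "(\<Sum>x<n. of_bool (adj v x) * (of_bool (x \<in> S) * of_bool (x \<notin> I))) = card {x \<in> S - I. adj v x}"
  proof -
    have "(\<Sum>x<n. of_bool (adj v x) * (of_bool (x \<in> S) * of_bool (x \<notin> I)) :: nat) = (\<Sum>x<n. of_bool (x \<in> {x \<in> S - I. adj v x}))"
      by (rule sum.cong) (auto simp: of_bool_def)
    also have "\<dots> = card ({..<n} \<inter> {x \<in> S - I. adj v x})" by simp
    also have "{..<n} \<inter> {x \<in> S - I. adj v x} = {x \<in> S - I. adj v x}" using assms(1) by blast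
    finally show ?thesis .
  qed
  then show ?thesis by (simp only: key_def)
qed

text \<open>The summand added to \<open>n\<close> times the degree is below \<open>n\<close>, so
  keys are ordered by degree first.\<close>

lemma key_mono:
  assumes "S \<subseteq> {..<n}" "u < n" "v < n" "key S I u \<le> key S I v"
  shows "card {x \<in> S - I. adj u x} \<le> card {x \<in> S - I. adj v x}"
proof -
  have "n * card {x \<in> S - I. adj u x} + u \<le> n * card {x \<in> S - I. adj v x} + v"
    using assms(4) unfolding key_card[OF assms(1,2)] key_card[OF assms(1,3)] .
  then have "n * card {x \<in> S - I. adj u x} < n * (card {x \<in> S - I. adj v x} + 1)" using assms(3) by simp
  then show ?thesis unfolding mult_less_cancel1 by simp
qed

lemma candidate_iff:
  "candidate S I v \<noteq> 0 \<longleftrightarrow> v \<in> S \<and> (num_K S I = 0 \<or> v \<notin> I \<and> (min_vertex S I = max_vertex S I \<or> adj (min_vertex S I) v \<and> \<not> adj (max_vertex S I) v))"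
proof -
  have "of_bool a * (of_bool b + of_bool c * (of_bool d + of_bool e * of_bool f)) \<noteq> (0 :: nat)
    \<longleftrightarrow> a \<and> (b \<or> c \<and> (d \<or> e \<and> f))" for a b c d e f
    by (cases a; cases b; cases c; cases d; cases e; cases f) simp_all
  then show ?thesis unfolding candidate_def .
qed

lemma candidate_exists:
  assumes S: "S \<subseteq> {..<n}" "sub_Sperner S" "S \<noteq> {}"
  shows "\<exists>v<n. candidate S I v \<noteq> 0"
proof (cases "S - I = {}")
  case True
  then have "num_K S I = 0" using num_K_eq[OF S(1)] by simp
  moreover obtain v where "v \<in> S" using S(3) by blast
  ultimately show ?thesis using S(1) by (intro exI[of _ v] conjI iffD2[OF candidate_iff]) auto
next
  case False
  then obtain v where v: "v \<in> S" "v \<notin> I" by blast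
  show ?thesis
  proof (cases "min_vertex S I = max_vertex S I")
    case True
    then show ?thesis using v S(1) by (intro exI[of _ v] conjI iffD2[OF candidate_iff]) auto
  next
    case False
    then have "S \<inter> I \<noteq> {}" using min_max_empty[OF S(1), of I] by metis
    then obtain y where "y \<in> S - I" "adj (min_vertex S I) y" "\<not> adj (max_vertex S I) y"
      using min_max_vertex_exists[OF S(1,2) min_vertex_eq(1)[OF S(1)] max_vertex_eq(1)[OF S(1)] False] by blast
    then show ?thesis using S(1) by (intro exI[of _ y] conjI iffD2[OF candidate_iff]) auto
  qed
qed

text \<open>The three ways of being a candidate match \<open>gluing_no_clique\<close>,
  \<open>gluing_at_most_one\<close> and \<open>gluing_min_max\<close>.\<close>

lemma gluing_pick:
  assumes S: "S \<subseteq> {..<n}" "sub_Sperner S" "S \<noteq> {}"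
  shows "gluing S (pick S I n)"
proof -
  define z where "z = pick S I n"
  obtain v where "v < n" "candidate S I v \<noteq> 0" using candidate_exists[OF S] by blast
  then have "candidate S I z \<noteq> 0" unfolding z_def by (rule pick_cand)
  then have c: "z \<in> S \<and> (num_K S I = 0 \<or> z \<notin> I \<and> (min_vertex S I = max_vertex S I \<or> adj (min_vertex S I) z \<and> \<not> adj (max_vertex S I) z))"
    by (rule iffD1[OF candidate_iff])
  then have zS: "z \<in> S" ..
  have "gluing S z"
  proof (cases "num_K S I = 0")
    case True
    then have "S - I = {}" using num_K_eq[OF S(1), of I] by simp
    then show ?thesis by (rule gluing_no_clique[OF S(1,2) zS])
  next
    case nK: False
    then have zK: "z \<in> S - I" using c by simp
    show ?thesis
    proof (cases "min_vertex S I = max_vertex S I")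
      case True
      \<comment> \<open>If the extremal vertices coincide, the key of every independent vertex is
        squeezed to theirs, and injectivity leaves one such vertex.\<close>
      have min_vertex: "u = min_vertex S I" if u: "u \<in> S \<inter> I" for u
      proof (rule key_inj[OF _ min_max_less(1)[OF S(1)]])
        have ne: "S \<inter> I \<noteq> {}" using u by blast
        show "u < n" using u S(1) by blast
        show "key S I u = key S I (min_vertex S I)"
          using min_vertex_eq(2)[OF S(1) ne u] max_vertex_eq(2)[OF S(1) ne u] unfolding True by (rule antisym[rotated])
      qed
      show ?thesis
      proof (rule gluing_at_most_one[OF zK])
        fix u v assume "u \<in> S \<inter> I" "v \<in> S \<inter> I"
        then show "u = v" using min_vertex[of u] min_vertex[of v] by simp
      qed
    next
      case False
      then have adj: "adj (min_vertex S I) z" "\<not> adj (max_vertex S I) z" using c nK by simp_all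
      have ne: "S \<inter> I \<noteq> {}" using False min_max_empty[OF S(1), of I] by (metis)
      have less: "f < n" if "f \<in> S \<inter> I" for f using that S(1) by blast
      show ?thesis
      proof (rule gluing_min_max[OF S(1,2) zK min_vertex_eq(1)[OF S(1) ne] _ max_vertex_eq(1)[OF S(1) ne] _ adj])
        fix f assume f: "f \<in> S \<inter> I"
        show "card {x \<in> S - I. adj (min_vertex S I) x} \<le> card {x \<in> S - I. adj f x}"
          by (rule key_mono[OF S(1) min_max_less(1)[OF S(1)] less[OF f] min_vertex_eq(2)[OF S(1) ne f]])
        show "card {x \<in> S - I. adj f x} \<le> card {x \<in> S - I. adj (max_vertex S I) x}"
          by (rule key_mono[OF S(1) less[OF f] min_max_less(2)[OF S(1)] max_vertex_eq(2)[OF S(1) ne f]])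
      qed
    qed
  qed
  then show ?thesis unfolding z_def .
qed

lemma attached_flag_eq:
  assumes S: "S \<subseteq> {..<n}" and v: "v < n"
  shows "attached_flag S I z v = of_bool (v \<in> attached S z)"
proof -
  have "(\<Sum>x<n. of_bool (x \<in> S) * of_bool (x \<in> I) * (of_bool (adj x z) * of_bool (adj x v))) \<noteq> (0 :: nat)
     \<longleftrightarrow> (\<exists>u\<in>S \<inter> I. adj u z \<and> adj u v)"
    using S by (auto simp: subset_iff)
  then show ?thesis unfolding attached_flag_def attached_def by (auto simp: of_bool_def)
qed

section \<open>Invariant of the stack and termination\<close>

definition block :: "(nat \<Rightarrow> nat) \<Rightarrow> nat \<Rightarrow> nat set" where
  "block L i = {v. v < n \<and> L v = i}"

definition alive :: "(nat \<Rightarrow> nat) \<Rightarrow> nat" where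
  "alive L = card {v. v < n \<and> L v \<noteq> 0}"

text \<open>Replacing the pending blocks by arbitrary expressions for them, from the top of the stack
  downwards, turns the present output into an expression for the graph.\<close>

definition completes :: "nat \<Rightarrow> (nat \<Rightarrow> nat) \<Rightarrow> nat list \<Rightarrow> bool" where
  "completes d L out \<longleftrightarrow> (\<forall>es. (\<forall>i\<in>{1..d}. builds_opt (es i) (block L i)) \<longrightarrow>
     (\<exists>e. builds e {..<n} \<and> encode_kexp e = out @ concat (map (\<lambda>i. encode_opt (es i)) (rev [1..<Suc d]))))"

text \<open>A split opens one level and finishes one vertex, so \<open>d + alive L\<close> never
  grows and levels stay small. Every finished vertex accounts for at most 35 tokens, which bounds
  the output addresses.\<close>

definition stack_inv :: "nat \<Rightarrow> (nat \<Rightarrow> nat) \<Rightarrow> nat list \<Rightarrow> bool" where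
  "stack_inv d L out \<longleftrightarrow> (\<forall>v<n. L v \<le> d) \<and> (\<forall>i\<in>{1..d}. sub_Sperner (block L i)) \<and> d + alive L \<le> n + 1 \<and>
     length out + 35 * alive L \<le> 35 * n \<and> completes d L out"

text \<open>An empty block is filled by \<open>None\<close>, whose code is empty, so removing its
  level changes no completion.\<close>

lemma stack_inv_pop:
  assumes inv: "stack_inv d L out" and d: "1 \<le> d" "block L d = {}"
  shows "stack_inv (d - 1) L out"
proof -
  obtain c where c: "d = Suc c" using d(1) by (cases d) auto
  have "L v \<le> c" if "v < n" for v
  proof -
    have "L v \<le> d" "L v \<noteq> d" using inv d(2) that unfolding stack_inv_def block_def by auto
    then show ?thesis using c by simp
  qed
  moreover have "completes c L out" unfolding completes_def
  proof (intro allI impI)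
    fix es assume es: "\<forall>i\<in>{1..c}. builds_opt (es i) (block L i)"
    have "\<forall>i\<in>{1..d}. builds_opt ((es(d := None)) i) (block L i)"
      using es d(2) c by (auto simp: builds_opt_def)
    then obtain e where e: "builds e {..<n}"
      "encode_kexp e = out @ concat (map (\<lambda>i. encode_opt ((es(d := None)) i)) (rev [1..<Suc d]))"
      using inv unfolding stack_inv_def completes_def by blast
    have "map (\<lambda>i. encode_opt ((es(d := None)) i)) (rev [1..<Suc d]) = [] # map (\<lambda>i. encode_opt (es i)) (rev [1..<Suc c])"
      by (simp add: c encode_opt_def)
    then show "\<exists>e. builds e {..<n} \<and> encode_kexp e = out @ concat (map (\<lambda>i. encode_opt (es i)) (rev [1..<Suc c]))"
      using e by auto
  qed
  ultimately show ?thesis using inv unfolding stack_inv_def c by simp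
qed

text \<open>Expressions for the two new blocks glue to one for the old top block. Reading the stack
  from the top gives the first part before the second, as in \<open>encode_glue\<close>, so the
  emitted tokens supply exactly what is missing.\<close>

lemma stack_inv_split:
  assumes inv: "stack_inv d L out" and d: "1 \<le> d" and z: "gluing (block L d) z"
    and L': "\<And>v. v < n \<Longrightarrow> L' v = (if v = z then 0 else if v \<in> attached (block L d) z then d + 1 else L v)"
  shows "stack_inv (d + 1) L' (out @ tokens (if z \<in> I then 2 else 5) z (attached (block L d) z \<noteq> {}) (block L d - {z} - attached (block L d) z \<noteq> {}))"
    and "alive L = Suc (alive L')"
proof -
  define S where "S = block L d"
  have S: "S \<subseteq> {..<n}" by (auto simp: S_def block_def)
  have zS: "z \<in> S" using z by (simp add: gluing_def S_def)
  have Ld: "L v \<le> d" if "v < n" for v using inv that by (simp add: stack_inv_def)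
  have Sd: "v \<in> S \<longleftrightarrow> v < n \<and> L v = d" for v by (simp add: S_def block_def)
  note sub = attached_subset[of S z] and zS' = zS[unfolded Sd]
  have L'': "L' v = (if v = z then 0 else if v \<in> attached S z then d + 1 else L v)" if "v < n" for v
    using L'[OF that] by (simp add: S_def)
  have attS: "v < n \<and> L v = d \<and> v \<noteq> z" if "v \<in> attached S z" for v using sub that Sd by blast
  have b1: "block L' (d + 1) = attached S z"
    using attS Ld L'' by (fastforce simp: block_def split: if_splits)
  have b2: "block L' d = S - {z} - attached S z"
  proof (intro set_eqI iffI)
    fix v assume "v \<in> block L' d"
    then have v: "v < n" "L' v = d" by (simp_all add: block_def)
    then show "v \<in> S - {z} - attached S z" using L''[OF v(1)] d Sd by (auto split: if_splits)
  next
    fix v assume v: "v \<in> S - {z} - attached S z"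
    then have "v < n" "L v = d" using Sd by blast+
    then show "v \<in> block L' d" using v L'' by (simp add: block_def)
  qed
  have b3: "block L' i = block L i" if "1 \<le> i" "i < d" for i
  proof -
    have "L' v = i \<longleftrightarrow> L v = i" if "v < n" for v
      using L''[OF that] \<open>1 \<le> i\<close> \<open>i < d\<close> zS' attS[of v] by (cases "v = z"; cases "v \<in> attached S z") auto
    then show ?thesis by (auto simp: block_def)
  qed
  have "L' v \<noteq> 0 \<longleftrightarrow> v \<noteq> z \<and> L v \<noteq> 0" if "v < n" for v
    using L''[OF that] d attS[of v] by auto
  then have "{v. v < n \<and> L v \<noteq> 0} = insert z {v. v < n \<and> L' v \<noteq> 0}" "z \<notin> {v. v < n \<and> L' v \<noteq> 0}"
    using zS' d by auto
  then show al: "alive L = Suc (alive L')" unfolding alive_def by simp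
  define B1 where "B1 = attached S z"
  define B2 where "B2 = S - {z} - attached S z"
  define l where "l = (if z \<in> I then 2 else 5 :: nat)"
  define out' where "out' = out @ tokens l z (B1 \<noteq> {}) (B2 \<noteq> {})"
  have "L' v \<le> d + 1" if "v < n" for v using L''[OF that] Ld[OF that] by auto
  moreover have "sub_Sperner S" using inv d by (simp add: stack_inv_def S_def)
  note ss = sub_Sperner_attached[OF this z[folded S_def]]
  have "sub_Sperner (block L' i)" if i: "i \<in> {1..d + 1}" for i
  proof -
    from i consider "i = d + 1" | "i = d" | "1 \<le> i" "i < d" by fastforce
    then show ?thesis
    proof cases
      case 3
      then show ?thesis using b3 inv by (simp add: stack_inv_def)
    qed (use b1 b2 ss in simp_all)
  qed
  moreover have "completes (d + 1) L' out'" unfolding completes_def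
  proof (intro allI impI)
    fix es assume es: "\<forall>i\<in>{1..d + 1}. builds_opt (es i) (block L' i)"
    \<comment> \<open>A filling of the new stack is turned into one of the old stack, to which the
      old invariant applies.\<close>
    define es' where "es' = es(d := Some (glue l z (es (d + 1)) (es d)))"
    have o1: "builds_opt (es (d + 1)) B1" and o2: "builds_opt (es d) B2"
      using es[rule_format, of "d + 1"] es[rule_format, of d] d unfolding B1_def B2_def b1 b2 by simp_all
    have "builds (glue l z (es (d + 1)) (es d)) S"
      by (rule builds_attached[OF S z[folded S_def] o1[unfolded B1_def] o2[unfolded B2_def] l_def])
    then have bd: "builds_opt (es' d) (block L d)" using zS by (auto simp: es'_def builds_opt_def S_def)
    have es': "builds_opt (es' i) (block L i)" if i: "i \<in> {1..d}" for i
    proof (cases "i = d")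
      case False
      then have "1 \<le> i" "i < d" "i \<in> {1..d + 1}" using i by auto
      then show ?thesis using es[rule_format, of i] b3[of i] False by (simp add: es'_def)
    qed (use bd in simp)
    have "completes d L out" using inv by (simp add: stack_inv_def)
    from this[unfolded completes_def, rule_format, of es', OF es'] obtain e where e: "builds e {..<n}"
      "encode_kexp e = out @ concat (map (\<lambda>i. encode_opt (es' i)) (rev [1..<Suc d]))"
      by blast
    have r: "rev [1..<Suc (d + 1)] = (d + 1) # d # rev [1..<d]" "rev [1..<Suc d] = d # rev [1..<d]"
      using d by (simp_all add: upt_Suc)
    have m: "map (\<lambda>i. encode_opt (es' i)) (rev [1..<d]) = map (\<lambda>i. encode_opt (es i)) (rev [1..<d])"
      by (auto simp: es'_def)
    have n1: "es (d + 1) = None \<longleftrightarrow> B1 = {}" and n2: "es d = None \<longleftrightarrow> B2 = {}"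
      using o1 o2 by (auto simp: builds_opt_def split: option.splits)
    have "encode_opt (es' d) = tokens l z (B1 \<noteq> {}) (B2 \<noteq> {}) @ encode_opt (es (d + 1)) @ encode_opt (es d)"
      unfolding es'_def fun_upd_same encode_opt_def[of "Some _"] option.case encode_glue n1 n2 tokens_def header_def by simp
    then have "encode_kexp e = out' @ concat (map (\<lambda>i. encode_opt (es i)) (rev [1..<Suc (d + 1)]))"
      unfolding e(2) r list.map concat.simps m out'_def by simp
    then show "\<exists>e. builds e {..<n} \<and> encode_kexp e = out' @ concat (map (\<lambda>i. encode_opt (es i)) (rev [1..<Suc (d + 1)]))"
      using e(1) by blast
  qed
  moreover have "d + 1 + alive L' \<le> n + 1" using inv al by (simp add: stack_inv_def)
  moreover have "length out' + 35 * alive L' \<le> 35 * n"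
    using inv al length_tokens[of l z "B1 \<noteq> {}" "B2 \<noteq> {}"] by (simp add: stack_inv_def out'_def)
  ultimately have "stack_inv (d + 1) L' out'" unfolding stack_inv_def by blast
  then show "stack_inv (d + 1) L' (out @ tokens (if z \<in> I then 2 else 5) z (attached (block L d) z \<noteq> {}) (block L d - {z} - attached (block L d) z \<noteq> {}))"
    unfolding out'_def l_def B1_def B2_def S_def .
qed

definition loop_inv :: "(nat \<Rightarrow> nat) \<Rightarrow> (nat \<Rightarrow> nat \<Rightarrow> nat) \<Rightarrow> nat list \<Rightarrow> bool" where
  "loop_inv R arrs out \<longleftrightarrow> writing R arrs out \<and> stack_inv (R 4) (arrs 2) out \<and> (\<forall>v<n. arrs 0 v = of_bool (v \<in> I))"

text \<open>A split finishes a vertex of weight 2 and opens a level of weight 1; a pop closes a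
  level. Either kind of round lowers the total.\<close>

definition potential :: "(nat \<Rightarrow> nat) \<Rightarrow> (nat \<Rightarrow> nat \<Rightarrow> nat) \<Rightarrow> nat" where
  "potential R arrs = 2 * alive (arrs 2) + R 4"

lemma sum_of_bool_card: "S \<subseteq> {..<n} \<Longrightarrow> (\<Sum>v<n. of_bool (v \<in> S)) = card S"
  by (simp add: Int_absorb1)

lemma runs_process:
  assumes loop_inv: "loop_inv R arrs out" and d: "R 4 = d" "1 \<le> d" and S: "S = block (arrs 2) d" "S \<noteq> {}"
    and s: "\<And>v. v < n \<Longrightarrow> arrs 3 v = of_bool (v \<in> S)" and c: "R 5 = card S"
  shows "\<exists>R' arrs' out'. runs w (Seq pick_prog (Seq split_prog output_prog)) (St R (layout arrs out)) (6000 * n ^ 2) (St R' (layout arrs' out'))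
    \<and> loop_inv R' arrs' out' \<and> potential R' arrs' < potential R arrs"
proof -
  have wr: "writing R arrs out" and inv: "stack_inv d (arrs 2) out" and i: "\<And>v. v < n \<Longrightarrow> arrs 0 v = of_bool (v \<in> I)"
    using loop_inv d by (auto simp: loop_inv_def)
  have sized: "sized R arrs out" "idle R" and p: "R 11 = n * n + 8 * n + length out" using wr by (auto simp: writing_def)
  have Sn: "S \<subseteq> {..<n}" by (auto simp: S block_def)
  define z where "z = pick S I n"
  define a1 where "a1 = arrs(4 := key S I, 5 := min_flag S I, 6 := max_flag S I, 7 := candidate S I)"
  define R1 where "R1 = R(6 := min_vertex S I, 7 := max_vertex S I, 8 := num_K S I, 9 := z)"
  note pk = runs_pick[OF sized Sn i s, folded z_def, folded a1_def R1_def]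
  have subS: "sub_Sperner S" using inv d by (simp add: stack_inv_def S)
  have g: "gluing S z" unfolding z_def by (rule gluing_pick[OF Sn subS S(2)])
  then have zS: "z \<in> S" by (simp add: gluing_def)
  then have zn: "z < n" and alz: "arrs 2 z = d" by (simp_all add: S block_def)
  have a1: "a1 0 v = arrs 0 v" "a1 3 v = arrs 3 v" "a1 2 = arrs 2" for v by (simp_all add: a1_def)
  have R1: "R1 9 = z" "R1 4 = d" "R1 5 = card S" "R1 11 = R 11" by (simp_all add: R1_def d c)
  have d1: "alive (arrs 2) \<noteq> 0"
  proof -
    have "z \<in> {v. v < n \<and> arrs 2 v \<noteq> 0}" using zn alz d by simp
    then show ?thesis unfolding alive_def by auto
  qed
  then have dn: "d \<le> n" using inv by (simp add: stack_inv_def)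
  have L: "a1 2 v \<le> n" if "v < n" for v using inv that dn unfolding a1 stack_inv_def by (meson le_trans)
  define a2 where "a2 = a1(7 := attached_flag S I z, 2 := relevel (arrs 2) S I z)"
  define R2 where "R2 = R1(10 := \<Sum>v<n. attached_flag S I z v)"
  have i1: "a1 0 v = of_bool (v \<in> I)" "a1 3 v = of_bool (v \<in> S)" if "v < n" for v using that by (simp_all add: a1 i s)
  note sp = runs_split[OF pk(2,3) Sn i1 L R1(1) zn, unfolded a1(3), folded a2_def R2_def]
  have R2: "R2 9 = z" "R2 4 = d" "R2 5 = card S" "R2 11 = R 11" by (simp_all add: R2_def R1)
  have wr2: "writing R2 a2 out" using sp p R2 by (simp add: writing_def)
  have a2: "a2 0 v = arrs 0 v" "a2 2 = relevel (arrs 2) S I z" for v by (simp_all add: a2_def a1)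
  define B1 where "B1 = attached S z"
  define B2 where "B2 = S - {z} - attached S z"
  have fin: "finite S" using Sn finite_subset by blast
  have sub: "B1 \<subseteq> S - {z}" using attached_subset by (simp add: B1_def)
  have "(\<Sum>v<n. attached_flag S I z v) = (\<Sum>v<n. of_bool (v \<in> B1))"
    by (rule sum.cong) (simp_all add: attached_flag_eq[OF Sn] B1_def)
  also have "\<dots> = card B1" using sub Sn by (intro sum_of_bool_card) blast
  finally have r10: "R2 10 = card B1" by (simp add: R2_def)
  have "card B2 = card (S - {z}) - card B1"
    using card_Diff_subset[of B1 "S - {z}"] sub fin finite_subset unfolding B1_def B2_def by blast
  \<comment> \<open>The 1 removes \<open>z\<close>, so the program learns whether the second part is
    empty without counting it.\<close>
  then have r5: "R2 5 - 1 - R2 10 = card B2" using R2 r10 zS fin by simp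
  have n1: "R2 10 \<noteq> 0 \<longleftrightarrow> B1 \<noteq> {}" and n2: "R2 5 - 1 - R2 10 \<noteq> 0 \<longleftrightarrow> B2 \<noteq> {}"
    using r10 r5 fin sub finite_subset[of B1 S] by (auto simp: B2_def card_eq_0_iff)
  define ts where "ts = tokens (if z \<in> I then 2 else 5) z (B1 \<noteq> {}) (B2 \<noteq> {})"
  define R3 where "R3 = R2(12 := if z \<in> I then 2 else 5, 11 := R2 11 + length ts, 4 := R2 4 + 1)"
  have "length out + 35 \<le> 35 * n" using inv d1 by (simp add: stack_inv_def)
  then have p2: "R2 11 + 35 \<le> B" "R2 4 + 1 \<le> B" using B_ge R2 p dn by linarith+
  have iz: "a2 0 z = of_bool (z \<in> I)" by (simp add: a2 i zn)
  note out = runs_output[OF wr2 p2 R2(1) zn iz, unfolded n1 n2, folded ts_def, folded R3_def]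
  have rl: "relevel (arrs 2) S I z v = (if v = z then 0 else if v \<in> attached S z then d + 1 else arrs 2 v)" if "v < n" for v
    using that attached_flag_eq[OF Sn that, of z] sub by (auto simp: relevel_def B1_def S block_def)
  note st = stack_inv_split[OF inv d(2) g[unfolded S(1)] rl[unfolded S(1)], folded S(1), folded B1_def B2_def, folded B1_def ts_def]
  have R3: "R3 4 = d + 1" by (simp add: R3_def R2)
  have "n \<le> n ^ 2" "1 \<le> n ^ 2" using n_pos by (simp_all add: power2_eq_square)
  then have "4 * (500 * n ^ 2) + 4 * (200 * n) + (2 * (500 * n ^ 2) + 200 * n + 1000) \<le> 6000 * n ^ 2" by linarith
  from runs_mono[OF runs_Seq[OF pk(1) runs_Seq[OF sp(1) out(1)]] this]
  have "runs w (Seq pick_prog (Seq split_prog output_prog)) (St R (layout arrs out)) (6000 * n ^ 2) (St R3 (layout a2 (out @ ts)))" .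
  moreover have "loop_inv R3 a2 (out @ ts)" unfolding loop_inv_def R3 a2 using out(2) st(1) i by simp
  moreover have "potential R3 a2 < potential R arrs" using st(2) unfolding potential_def R3 a2 d(1) by simp
  ultimately show ?thesis by blast
qed

lemma runs_body:
  assumes loop_inv: "loop_inv R arrs out" and d: "R 4 \<noteq> 0"
  shows "\<exists>R' arrs' out'. runs w body_prog (St R (layout arrs out)) (8000 * n ^ 2) (St R' (layout arrs' out'))
    \<and> loop_inv R' arrs' out' \<and> potential R' arrs' < potential R arrs"
proof -
  define S where "S = block (arrs 2) (R 4)"
  have Sn: "S \<subseteq> {..<n}" by (auto simp: S_def block_def)
  have wr: "writing R arrs out" and inv: "stack_inv (R 4) (arrs 2) out" and i: "\<And>v. v < n \<Longrightarrow> arrs 0 v = of_bool (v \<in> I)"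
    using loop_inv by (auto simp: loop_inv_def)
  have sized: "sized R arrs out" "idle R" using wr by (auto simp: writing_def)
  have R0: "R 0 = n" using sized by (simp add: sized_def)
  let ?a = "arrs(3 := (\<lambda>v. of_bool (v \<in> S)))" and ?R = "R(5 := card S)"
  have bB: "of_bool b \<le> B" for b using B_ge(1) by (cases b) simp_all
  have sB: "card S \<le> B" using card_mono[OF _ Sn] B_ge(2) by simp
  have o3: "sized R ?a out" by (rule sized_arr[OF sized(1) bB])
  have o5: "sized ?R ?a out" by (rule sized_reg[OF o3 sB]) simp
  have 1: "runs w (map_prog 3 (Lit 0) (eq_exp (arr_exp 2 (Reg 3)) (Reg 4))) (St R (layout arrs out)) (500 * n ^ 2) (St R (layout ?a out))"
    by (rule runs_simple_map[OF sized])
      (simp add: cheap_simps, simp, rule bB, simp add: R0 S_def block_def)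
  have nB: "n * 1 \<le> B" using B_ge(2) by simp
  have 2: "runs w (sum_prog 5 (arr_exp 3 (Reg 2))) (St R (layout ?a out)) (200 * n) (St ?R (layout ?a out))"
    by (rule runs_sum[where F = "\<lambda>v. of_bool (v \<in> S)", OF o3 sized(2) _ _ nB])
      (simp add: cheap_simps, simp add: of_bool_def, simp add: R0, simp, rule sum_of_bool_card[OF Sn])
  have c5: "cheap (Reg 5)" by (simp add: cheap_def)
  have wr5: "writing ?R ?a out" using wr o5 by (simp add: writing_def idle_def)
  have good5: "loop_inv ?R ?a out" using loop_inv wr5 by (simp add: loop_inv_def)
  have pot: "potential ?R ?a = potential R arrs" by (simp add: potential_def)
  have fin: "finite S" using Sn finite_subset by blast
  let ?C = "Cond (Reg 5) (Seq pick_prog (Seq split_prog output_prog)) (Set_Reg 4 (Minus (Reg 4) (Lit 1)))"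
  have "\<exists>R' arrs' out'. runs w ?C (St ?R (layout ?a out)) (1 + 1 + 6000 * n ^ 2) (St R' (layout arrs' out'))
    \<and> loop_inv R' arrs' out' \<and> potential R' arrs' < potential R arrs"
  proof (cases "S = {}")
    case True
    have 3: "runs w (Set_Reg 4 (Minus (Reg 4) (Lit 1))) (St ?R (layout ?a out)) (6000 * n ^ 2) (St (?R(4 := R 4 - 1)) (layout ?a out))"
    proof (rule runs_Set_Reg[OF o5])
      have "1 \<le> n ^ 2" using n_pos by simp
      then show "ram_cost (Minus (Reg 4) (Lit 1)) + 1 \<le> 6000 * n ^ 2" by simp
    qed (simp_all add: cheap_def)
    have "R 4 \<le> B" using sized(1) unfolding sized_def by blast
    then have R4: "R 4 - 1 \<le> B" by linarith
    have "writing (?R(4 := R 4 - 1)) ?a out" by (rule writing_reg[OF wr5 R4]) simp_all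
    moreover have "stack_inv (R 4 - 1) (arrs 2) out"
      by (rule stack_inv_pop[OF inv]) (use d True in \<open>simp_all add: S_def\<close>)
    ultimately have "loop_inv (?R(4 := R 4 - 1)) ?a out" using i by (simp add: loop_inv_def)
    moreover have "potential (?R(4 := R 4 - 1)) ?a < potential R arrs" using d by (simp add: potential_def)
    moreover have "runs w ?C (St ?R (layout ?a out)) (ram_cost (Reg 5) + 1 + 6000 * n ^ 2) (St (?R(4 := R 4 - 1)) (layout ?a out))"
      by (rule runs_Cond[OF fits_cheap[OF o5 c5]]) (use 3 True in simp)
    ultimately show ?thesis by auto
  next
    case False
    have b: "S = block (?a 2) (R 4)" by (simp add: S_def)
    have pr: "?R 4 = R 4" "1 \<le> R 4" "?a 3 v = of_bool (v \<in> S)" "?R 5 = card S" for v using d by simp_all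
    obtain R' arrs' out' where *: "runs w (Seq pick_prog (Seq split_prog output_prog)) (St ?R (layout ?a out)) (6000 * n ^ 2) (St R' (layout arrs' out'))"
      "loop_inv R' arrs' out'" "potential R' arrs' < potential ?R ?a"
      using runs_process[OF good5 pr(1,2) b False pr(3,4)] by blast
    have "runs w ?C (St ?R (layout ?a out)) (ram_cost (Reg 5) + 1 + 6000 * n ^ 2) (St R' (layout arrs' out'))"
      by (rule runs_Cond[OF fits_cheap[OF o5 c5]]) (use *(1) False fin in simp)
    then show ?thesis using *(2,3) unfolding pot by auto
  qed
  then obtain R' arrs' out' where *: "runs w ?C (St ?R (layout ?a out)) (1 + 1 + 6000 * n ^ 2) (St R' (layout arrs' out'))"
    "loop_inv R' arrs' out'" "potential R' arrs' < potential R arrs" by blast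
  have "n \<le> n ^ 2" "1 \<le> n ^ 2" using n_pos by (simp_all add: power2_eq_square)
  then have "500 * n ^ 2 + (200 * n + (1 + 1 + 6000 * n ^ 2)) \<le> 8000 * n ^ 2" by linarith
  from runs_mono[OF runs_Seq[OF 1 runs_Seq[OF 2 *(1)]] this] show ?thesis
    using *(2,3) unfolding body_prog_def by blast
qed

lemma runs_loop:
  assumes "loop_inv R arrs out" "potential R arrs \<le> m"
  shows "\<exists>R' arrs' out'. runs w (While (Reg 4) body_prog) (St R (layout arrs out)) (m * (8000 * n ^ 2 + 2) + 2) (St R' (layout arrs' out'))
    \<and> loop_inv R' arrs' out' \<and> R' 4 = 0"
  using assms
proof (induction m arbitrary: R arrs out rule: less_induct)
  case (less m)
  have sized: "sized R arrs out" using less.prems(1) by (simp add: loop_inv_def writing_def)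
  have c: "cheap (Reg 4)" by (simp add: cheap_def)
  note fits = fits_cheap[OF sized c]
  show ?case
  proof (cases "R 4 = 0")
    case True
    have "runs w (While (Reg 4) body_prog) (St R (layout arrs out)) (m * (8000 * n ^ 2 + 2) + 2) (St R (layout arrs out))"
      by (rule runs_mono[OF runs_While_stop[OF fits]]) (use True in simp_all)
    then show ?thesis using less.prems(1) True by blast
  next
    case False
    obtain R1 arrs1 out1 where 1: "runs w body_prog (St R (layout arrs out)) (8000 * n ^ 2) (St R1 (layout arrs1 out1))"
      "loop_inv R1 arrs1 out1" "potential R1 arrs1 < potential R arrs"
      using runs_body[OF less.prems(1) False] by blast
    then have m: "m - 1 < m" "potential R1 arrs1 \<le> m - 1" using less.prems(2) by linarith+
    obtain R' arrs' out' where 2: "runs w (While (Reg 4) body_prog) (St R1 (layout arrs1 out1)) ((m - 1) * (8000 * n ^ 2 + 2) + 2) (St R' (layout arrs' out'))"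
      "loop_inv R' arrs' out'" "R' 4 = 0"
      using less.IH[OF m(1) 1(2) m(2)] by blast
    have v: "ram_val (St R (layout arrs out)) (Reg 4) \<noteq> 0" using False by simp
    obtain k where k: "m = Suc k" using m(1) by (cases m) auto
    have "runs w (While (Reg 4) body_prog) (St R (layout arrs out)) (m * (8000 * n ^ 2 + 2) + 2) (St R' (layout arrs' out'))"
      by (rule runs_mono[OF runs_While_step[OF fits v 1(1) 2(1)]]) (simp add: k)
    then show ?thesis using 2(2,3) by blast
  qed
qed

text \<open>The premise on \<open>I\<close> matches the set that the program computes into array 0.
  Initially all vertices form the block of level 1.\<close>

lemma runs_init:
  assumes I: "\<And>v. v < n \<Longrightarrow> v \<in> I \<longleftrightarrow> (\<exists>x<n. \<not> adj v x \<and> deg_key v < deg_key x)"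
    and sub: "sub_Sperner {..<n}"
  defines "R0 \<equiv> (\<lambda>r. if r = 0 then n else 0)"
  shows "\<exists>R arrs. runs w init_prog (St R0 (layout (\<lambda>_ _. 0) [])) (1600 * n ^ 2) (St R (layout arrs []))
     \<and> loop_inv R arrs [] \<and> potential R arrs = 2 * n + 1"
proof -
  let ?z = "(\<lambda>_ _. 0) :: nat \<Rightarrow> nat \<Rightarrow> nat"
  define i where "i v = (of_bool (v \<in> I) :: nat)" for v
  let ?a4 = "?z(4 := deg_key)" and ?a0 = "?z(4 := deg_key, 0 := i)" and ?a2 = "?z(4 := deg_key, 0 := i, 2 := \<lambda>_. 1)"
  have R0: "R0 0 = n" by (simp add: R0_def)
  have nB: "n * 1 \<le> B" "n * (n * n + n) \<le> B" "n * n + 8 * n \<le> B" "n \<le> B" "1 \<le> B" using B_ge by linarith+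
  have kB: "deg_key v \<le> B" if "v < n" for v using deg_key_le[OF that] B_ge(4) by linarith
  have iB: "i v \<le> B" for v using nB by (simp add: i_def)
  have sized: "sized R0 ?z []" using nB by (simp add: sized_def R0_def)
  have idle: "idle R0" by (simp add: idle_def R0_def)
  have o4: "sized R0 ?a4 []" by (rule sized_arr[OF sized kB])
  have o0: "sized R0 ?a0 []" by (rule sized_arr[OF o4 iB])
  have o2: "sized R0 ?a2 []" by (rule sized_arr[OF o0 nB(5)])
  have 1: "runs w (map_prog 4 (Plus (Reg 1) (adj_exp (Reg 3) (Reg 2))) (Plus (Times (Reg 0) (Reg 1)) (Reg 3)))
      (St R0 (layout ?z [])) (500 * n ^ 2) (St R0 (layout ?a4 []))"
    by (rule runs_sum_map[OF sized idle _ _ _ _ nB(1), where G = "\<lambda>v x. of_bool (adj v x)"])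
      (simp add: cheap_simps, simp add: cheap_simps, simp, simp add: of_bool_def, simp add: R0, rule kB, assumption,
        simp add: R0 deg_key_def)
  have le: "(deg_key x - deg_key v) * of_bool b \<le> n * n + n" if "x < n" for v x b
    using deg_key_le[OF that] by (cases b) auto
  have iv: "i v = of_bool ((\<Sum>x<n. (deg_key x - deg_key v) * of_bool (\<not> adj v x)) \<noteq> 0)" if "v < n" for v
  proof -
    have "(\<Sum>x<n. (deg_key x - deg_key v) * of_bool (\<not> adj v x)) = 0
      \<longleftrightarrow> (\<forall>x\<in>{..<n}. (deg_key x - deg_key v) * of_bool (\<not> adj v x) = 0)" by (rule sum_eq_0_iff) simp
    also have "\<dots> \<longleftrightarrow> v \<notin> I" 
    proof -
      have *: "(deg_key x - deg_key v) * of_bool (\<not> adj v x) = 0 \<longleftrightarrow> adj v x \<or> \<not> deg_key v < deg_key x" for x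
        by (cases "adj v x") auto
      show ?thesis unfolding * I[OF that] by blast
    qed
    finally show ?thesis by (simp only: i_def not_not)
  qed
  have 2: "runs w (map_prog 0 (Plus (Reg 1) (Times (Minus (arr_exp 4 (Reg 2)) (arr_exp 4 (Reg 3))) (not_exp (adj_exp (Reg 3) (Reg 2)))))
            (not_exp (not_exp (Reg 1))))
      (St R0 (layout ?a4 [])) (500 * n ^ 2) (St R0 (layout ?a0 []))"
    by (rule runs_sum_map[where G = "\<lambda>v x. (deg_key x - deg_key v) * of_bool (\<not> adj v x)", OF o4 idle _ _ _ le nB(2)])
      (simp add: cheap_simps, simp add: cheap_simps, simp, assumption, simp add: R0, rule iB, simp add: iv)
  have 3: "runs w (map_prog 2 (Lit 0) (Lit 1)) (St R0 (layout ?a0 [])) (500 * n ^ 2) (St R0 (layout ?a2 []))"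
    by (rule runs_simple_map[OF o0 idle]) (simp add: cheap_simps, simp, rule nB, simp)
  let ?R1 = "R0(11 := n * n + 8 * n)" and ?R2 = "R0(11 := n * n + 8 * n, 4 := 1)"
  have o11: "sized ?R1 ?a2 []" by (rule sized_reg[OF o2 nB(3)]) simp
  have 4: "runs w (Set_Reg 11 (addr_exp 8 (Lit 0))) (St R0 (layout ?a2 [])) 10 (St ?R1 (layout ?a2 []))"
    by (rule runs_Set_Reg[OF o2]) (simp_all add: cheap_simps addr_exp_def R0)
  have 5: "runs w (Set_Reg 4 (Lit 1)) (St ?R1 (layout ?a2 [])) 2 (St ?R2 (layout ?a2 []))"
    by (rule runs_Set_Reg[OF o11]) (simp_all add: cheap_simps)
  have wr: "writing ?R2 ?a2 []"
    using sized_reg[OF o11 nB(5), of 4] by (simp add: writing_def idle_def R0_def)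
  have bl: "block (\<lambda>_. 1) 1 = {..<n}" by (auto simp: block_def)
  have al: "alive (\<lambda>_. 1) = n" by (simp add: alive_def)
  have "completes 1 (\<lambda>_. 1) []" unfolding completes_def
  proof (intro allI impI)
    fix es assume "\<forall>i\<in>{1..1}. builds_opt (es i) (block (\<lambda>_. 1) i)"
    then have "builds_opt (es 1) {..<n}" using bl by simp
    \<comment> \<open>A nonempty block excludes \<open>None\<close>, so the filling itself is the
      wanted expression.\<close>
    moreover have "0 \<in> {..<n}" using n_pos by simp
    ultimately obtain e where "es 1 = Some e" "builds e {..<n}"
      unfolding builds_opt_def by (auto split: option.splits)
    then show "\<exists>e. builds e {..<n} \<and> encode_kexp e = [] @ concat (map (\<lambda>i. encode_opt (es i)) (rev [1..<Suc 1]))"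
      by (intro exI[of _ e]) (simp add: encode_opt_def)
  qed
  then have "stack_inv 1 (\<lambda>_. 1) []" using sub bl al by (simp add: stack_inv_def)
  moreover have upd: "?R2 4 = 1" "?a2 2 = (\<lambda>_. 1)" "?a2 0 v = of_bool (v \<in> I)" for v by (simp_all add: i_def)
  ultimately have "loop_inv ?R2 ?a2 []" using wr unfolding loop_inv_def upd by blast
  moreover have "potential ?R2 ?a2 = 2 * n + 1" unfolding potential_def upd al by simp
  moreover have "runs w init_prog (St R0 (layout ?z [])) (1600 * n ^ 2) (St ?R2 (layout ?a2 []))"
    unfolding init_prog_def
  proof (rule runs_mono[OF runs_Seq[OF 1 runs_Seq[OF 2 runs_Seq[OF 3 runs_Seq[OF 4 5]]]]])
    have "1 \<le> n ^ 2" using n_pos by simp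
    then show "500 * n ^ 2 + (500 * n ^ 2 + (500 * n ^ 2 + (10 + 2))) \<le> 1600 * n ^ 2" by linarith
  qed
  ultimately show ?thesis by blast
qed

lemma layout_output: "map (layout arrs out) [n * n + 8 * n..<n * n + 8 * n + length out] = out"
  by (rule nth_equalityI) (simp_all add: layout_def)

lemma runs_expression_prog:
  assumes I: "\<And>v. v < n \<Longrightarrow> v \<in> I \<longleftrightarrow> (\<exists>x<n. \<not> adj v x \<and> deg_key v < deg_key x)"
    and sub: "sub_Sperner {..<n}"
  shows "\<exists>s e. runs w expression_prog (St (\<lambda>r. if r = 0 then n else 0) (layout (\<lambda>_ _. 0) [])) (30000 * n ^ 3) s
     \<and> ram_output s = encode_kexp e \<and> builds e {..<n}"
proof -
  let ?s0 = "St (\<lambda>r. if r = 0 then n else 0) (layout (\<lambda>_ _. 0) [])"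
  obtain R arrs where 1: "runs w init_prog ?s0 (1600 * n ^ 2) (St R (layout arrs []))"
    and "loop_inv R arrs []" "potential R arrs = 2 * n + 1"
    using runs_init[OF I sub] by blast
  then obtain R' arrs' out where 2: "runs w (While (Reg 4) body_prog) (St R (layout arrs [])) ((2 * n + 1) * (8000 * n ^ 2 + 2) + 2) (St R' (layout arrs' out))"
    and g: "loop_inv R' arrs' out" "R' 4 = 0"
    using runs_loop[of R arrs "[]" "2 * n + 1"] by auto
  \<comment> \<open>With no pending block the concatenation is empty, so the output itself is a
    complete code.\<close>
  have "completes 0 (arrs' 2) out" using g by (simp add: loop_inv_def stack_inv_def)
  then obtain e where e: "builds e {..<n}" "encode_kexp e = out" by (auto simp: completes_def)
  have wr: "writing R' arrs' out" using g by (simp add: loop_inv_def)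
  then have sized: "sized R' arrs' out" and R11: "R' 11 = n * n + 8 * n + length out" and R0: "R' 0 = n"
    by (simp_all add: writing_def sized_def)
  let ?R1 = "R'(1 := length out)" and ?R2 = "R'(1 := length out, 0 := n * n + 8 * n)"
  have "R' 11 \<le> B" using sized by (simp add: sized_def)
  then have ok1: "sized ?R1 arrs' out" using R11 by (intro sized_reg[OF sized]) simp_all
  have 3: "runs w (Set_Reg 1 (Minus (Reg 11) (addr_exp 8 (Lit 0)))) (St R' (layout arrs' out)) 12 (St ?R1 (layout arrs' out))"
    by (rule runs_Set_Reg[OF sized]) (simp_all add: cheap_simps addr_exp_def R0 R11)
  have 4: "runs w (Set_Reg 0 (addr_exp 8 (Lit 0))) (St ?R1 (layout arrs' out)) 10 (St ?R2 (layout arrs' out))"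
    by (rule runs_Set_Reg[OF ok1]) (simp_all add: cheap_simps addr_exp_def R0)
  have "ram_output (St ?R2 (layout arrs' out)) = encode_kexp e"
    unfolding ram_output_def e(2) by (simp add: layout_output)
  moreover have "runs w expression_prog ?s0 (30000 * n ^ 3) (St ?R2 (layout arrs' out))"
    unfolding expression_prog_def
  proof (rule runs_mono[OF runs_Seq[OF 1 runs_Seq[OF 2 runs_Seq[OF 3 4]]]])
    have "n ^ 2 \<le> n ^ 3" "n \<le> n ^ 3" "1 \<le> n ^ 3" "n * n ^ 2 = n ^ 3"
      using n_pos by (simp_all add: power2_eq_square power3_eq_cube)
    moreover have "(2 * n + 1) * (8000 * n ^ 2 + 2) = 16000 * (n * n ^ 2) + 8000 * n ^ 2 + 4 * n + 2"
      by (simp add: algebra_simps)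
    ultimately show "1600 * n ^ 2 + ((2 * n + 1) * (8000 * n ^ 2 + 2) + 2 + (12 + 10)) \<le> 30000 * n ^ 3" by linarith
  qed
  ultimately show ?thesis using e(1) by blast
qed

end

section \<open>Recognition of the split partition\<close>

text \<open>\<open>cross\<close> is what remains of the excluded induced subgraph: of two
  independent vertices, one has at most one private neighbour. Everything is stated through
  \<open>adj\<close>, so that vertices can be renumbered.\<close>

locale Sperner_split =
  fixes adj :: "'v \<Rightarrow> 'v \<Rightarrow> bool" and V K I :: "'v set"
  assumes finite_V: "finite V"
    and sym: "u \<in> V \<Longrightarrow> v \<in> V \<Longrightarrow> adj u v \<Longrightarrow> adj v u"
    and irrefl: "u \<in> V \<Longrightarrow> \<not> adj u u"
    and partition: "K \<union> I = V" "K \<inter> I = {}"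
    and clique_K: "u \<in> K \<Longrightarrow> v \<in> K \<Longrightarrow> u \<noteq> v \<Longrightarrow> adj u v"
    and independent_I: "u \<in> I \<Longrightarrow> v \<in> I \<Longrightarrow> \<not> adj u v"
    and Sperner: "u \<in> I \<Longrightarrow> v \<in> I \<Longrightarrow> (\<And>x. x \<in> V \<Longrightarrow> adj u x \<Longrightarrow> adj v x) \<Longrightarrow> u = v"
    and cross: "u \<in> I \<Longrightarrow> v \<in> I \<Longrightarrow> {a, b, c, d} \<subseteq> V \<Longrightarrow> adj u a \<Longrightarrow> adj u b \<Longrightarrow> \<not> adj v a \<Longrightarrow> \<not> adj v b \<Longrightarrow>
      adj v c \<Longrightarrow> adj v d \<Longrightarrow> \<not> adj u c \<Longrightarrow> \<not> adj u d \<Longrightarrow> a = b \<or> c = d"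
begin

lemma split_relation_I: "split_relation adj V I"
proof
  show "finite V" by (rule finite_V)
  show "adj v u" if "u \<in> V" "v \<in> V" "adj u v" for u v using sym that by blast
  show "\<not> adj u u" if "u \<in> V" for u using irrefl that by blast
  show "\<not> adj u v" if "u \<in> V" "v \<in> V" "u \<in> I" "v \<in> I" for u v using independent_I that by blast
  show "adj u v" if "u \<in> V" "v \<in> V" "u \<notin> I" "v \<notin> I" "u \<noteq> v" for u v
    using clique_K that partition by blast
qed

text \<open>Independent vertices have all their neighbours in the clique, so restricting
  neighbourhoods to it loses nothing.\<close>

lemma one_Sperner_I: "one_Sperner (V - I) (V \<inter> I) (\<lambda>u. {v. adj u v})"
  unfolding one_Sperner_def
proof (intro ballI impI conjI)
  fix e f assume ef: "e \<in> V \<inter> I" "f \<in> V \<inter> I" "e \<noteq> f"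
  then have I: "e \<in> I" "f \<in> I" by simp_all
  show "\<not> {v. adj e v} \<inter> (V - I) \<subseteq> {v. adj f v}"
  proof
    assume sub: "{v. adj e v} \<inter> (V - I) \<subseteq> {v. adj f v}"
    have "adj f x" if "x \<in> V" "adj e x" for x
      using sub that independent_I[OF I(1), of x] by blast
    then show False using Sperner[OF I] ef(3) by blast
  qed
  show "card ({v. adj e v} \<inter> (V - I) - {v. adj f v}) \<le> 1 \<or> card ({v. adj f v} \<inter> (V - I) - {v. adj e v}) \<le> 1"
  proof (rule ccontr)
    assume contr: "\<not> ?thesis"
    have fin: "finite ({v. adj e v} \<inter> (V - I) - {v. adj f v})" "finite ({v. adj f v} \<inter> (V - I) - {v. adj e v})"
      using finite_V by simp_all
    obtain a b where ab: "a \<in> {v. adj e v} \<inter> (V - I) - {v. adj f v}" "b \<in> {v. adj e v} \<inter> (V - I) - {v. adj f v}" "a \<noteq> b"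
      using contr card_le_Suc0_iff_eq[OF fin(1)] by (metis One_nat_def)
    obtain c d where cd: "c \<in> {v. adj f v} \<inter> (V - I) - {v. adj e v}" "d \<in> {v. adj f v} \<inter> (V - I) - {v. adj e v}" "c \<noteq> d"
      using contr card_le_Suc0_iff_eq[OF fin(2)] by (metis One_nat_def)
    show False using cross[OF I, of a b c d] ab cd by simp
  qed
qed

definition deg :: "'v \<Rightarrow> nat" where
  "deg v = card {x \<in> V. adj v x}"

text \<open>A vertex of \<open>I\<close> has smaller degree than its non-neighbours in \<open>K\<close>, unless the graph is
  complete up to the edge between the two.\<close>

lemma degree_tie:
  assumes u: "u \<in> I" and v: "v \<in> K" and "\<not> adj u v" "deg v \<le> deg u"
    and xy: "x \<in> V" "y \<in> V" "x \<noteq> y" "\<not> adj x y"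
  shows "{x, y} = {u, v}"
proof -
  define N where "N w = {x \<in> V. adj w x}" for w
  have uV: "u \<in> V" and vV: "v \<in> V" using u v partition by blast+
  have fin: "finite K" "finite (N w)" for w using finite_V partition by (auto simp: N_def)
  have NI: "N w \<subseteq> K" if "w \<in> I" for w
    using independent_I[OF that] partition by (auto simp: N_def)
  then have Nu: "N u \<subseteq> K - {v}" using u assms(3) by (auto simp: N_def)
  have Nv: "K - {v} \<subseteq> N v" using clique_K[OF v] partition by (auto simp: N_def)
  have c: "card (N v) \<le> card (N u)" using assms(4) by (simp add: deg_def N_def)
  \<comment> \<open>\<open>N u\<close> lies in \<open>K - {v}\<close>, which lies in
    \<open>N v\<close>; the assumed order of the degrees turns both inclusions into
    equalities.\<close>
  have "card (N u) \<le> card (K - {v})" "card (K - {v}) \<le> card (N v)"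
    using Nu Nv fin by (auto intro!: card_mono)
  then have eq: "card (N u) = card (K - {v})" "card (K - {v}) = card (N v)" using c by linarith+
  have Nu': "N u = K - {v}" by (rule card_subset_eq[OF finite_Diff[OF fin(1)] Nu eq(1)])
  have Nv': "N v = K - {v}" by (rule card_subset_eq[OF fin(2) Nv eq(2), symmetric])
  \<comment> \<open>As \<open>N v\<close> now contains no independent vertex, every
    \<open>N w\<close> avoids \<open>v\<close> and lies in \<open>K - {v}\<close>, which is
    \<open>N u\<close>. The Sperner property reduces \<open>I\<close> to \<open>u\<close>.\<close>
  have Iu: "w = u" if w: "w \<in> I" for w
  proof (rule Sperner[OF w u])
    fix x assume x: "x \<in> V" "adj w x"
    have wV: "w \<in> V" using w partition by blast
    have "x \<noteq> v"
    proof
      assume "x = v"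
      then have "w \<in> N v" using sym[OF wV x(1,2)] wV by (simp add: N_def)
      then show False using Nv' w partition by blast
    qed
    moreover have "x \<in> K" using NI[OF w] x by (auto simp: N_def)
    ultimately have "x \<in> N u" using Nu' by blast
    then show "adj u x" by (simp add: N_def)
  qed
  have K: "w = v" if "w \<in> K" "\<not> adj u w" for w
  proof -
    have "w \<notin> N u" using that by (simp add: N_def)
    then show ?thesis using that(1) Nu' by blast
  qed
  show ?thesis
  proof (cases "x \<in> I")
    case True
    then have "x = u" by (rule Iu)
    moreover have "y \<in> K" using Iu[of y] xy \<open>x = u\<close> partition by blast
    ultimately show ?thesis using K[of y] xy by blast
  next
    case False
    then have "x \<in> K" using xy partition by blast
    then have "y \<in> I" using clique_K[of x y] xy partition by blast
    then have "y = u" by (rule Iu)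
    then show ?thesis using K[of x] \<open>x \<in> K\<close> sym[of u x] uV xy by blast
  qed
qed

text \<open>With at most one edge there are no two distinct edges to compare, and the complement of
  \<open>J\<close> is a clique because every non-adjacent pair meets \<open>J\<close>.\<close>

lemma split_relation_singleton:
  assumes "J \<subseteq> {j}" "\<And>x y. x \<in> V \<Longrightarrow> y \<in> V \<Longrightarrow> x \<noteq> y \<Longrightarrow> \<not> adj x y \<Longrightarrow> x \<in> J \<or> y \<in> J"
  shows "split_relation adj V J \<and> one_Sperner (V - J) (V \<inter> J) (\<lambda>u. {v. adj u v})"
proof
  have J: "u = j" if "u \<in> J" for u using assms(1) that by blast
  show "one_Sperner (V - J) (V \<inter> J) (\<lambda>u. {v. adj u v})"
    unfolding one_Sperner_def using J by blast
  show "split_relation adj V J"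
  proof
    show "finite V" by (rule finite_V)
    show "adj v u" if "u \<in> V" "v \<in> V" "adj u v" for u v using sym that by blast
    show "\<not> adj u u" if "u \<in> V" for u using irrefl that by blast
    show "\<not> adj u v" if "u \<in> V" "v \<in> V" "u \<in> J" "v \<in> J" for u v
      using irrefl[OF that(1)] J[OF that(3)] J[OF that(4)] by simp
    show "adj u v" if "u \<in> V" "v \<in> V" "u \<notin> J" "v \<notin> J" "u \<noteq> v" for u v
      using assms(2) that by blast
  qed
qed

end

text \<open>The set \<open>J\<close> differs from the given \<open>I\<close> only if the graph is complete or lacks a single edge; then
  \<open>J\<close> has at most one element.\<close>

lemma (in array_machine) recognise_split:
  assumes "Sperner_split adj {..<n} K I"
  defines "J \<equiv> {v. v < n \<and> (\<exists>x<n. \<not> adj v x \<and> deg_key v < deg_key x)}"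
  shows "split_relation adj {..<n} J \<and> one_Sperner ({..<n} - J) ({..<n} \<inter> J) (\<lambda>u. {v. adj u v})"
proof -
  interpret Sperner_split adj "{..<n}" K I by fact
  have dk: "deg_key v = n * deg v + v" for v
  proof -
    have "(\<Sum>x<n. of_bool (adj v x)) = card {x \<in> {..<n}. adj v x}" by (simp add: Int_def)
    then show ?thesis by (simp only: deg_key_def deg_def)
  qed
  have less: "deg_key u < deg_key v" if "u < n" "deg u < deg v" for u v
  proof -
    have "n * deg u + u < n * (deg u + 1)" using that(1) by simp
    also have "\<dots> \<le> n * deg v" using that(2) by (intro mult_left_mono) simp_all
    finally show ?thesis unfolding dk by simp
  qed
  have inj: "u = v" if "u < n" "v < n" "deg_key u = deg_key v" for u v
  proof -
    have "deg_key x mod n = x" if "x < n" for x using that unfolding dk by simp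
    then show ?thesis using that by metis
  qed
  have JD: "\<exists>x<n. \<not> adj v x \<and> deg_key v < deg_key x \<and> x \<noteq> v" if "v \<in> J" for v
    using that unfolding J_def by blast
  consider (complete) "\<forall>x<n. \<forall>y<n. x \<noteq> y \<longrightarrow> adj x y"
    | (tie) u v where "u \<in> I" "v \<in> K" "\<not> adj u v" "deg v \<le> deg u"
    | (strict) "\<not> (\<forall>x<n. \<forall>y<n. x \<noteq> y \<longrightarrow> adj x y)" "\<forall>u\<in>I. \<forall>v\<in>K. \<not> adj u v \<longrightarrow> deg u < deg v"
    by (meson not_le)
  then show ?thesis
  proof cases
    case complete
    have "J = {}"
    proof -
      have False if "v \<in> J" for v
      proof -
        have "v < n" using that by (simp add: J_def)
        then show False using JD[OF that] complete by metis
      qed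
      then show ?thesis by blast
    qed
    then show ?thesis
      using split_relation_singleton[of J 0] complete by simp
  next
    case tie
    have uv: "u < n" "v < n" "u \<noteq> v" using tie(1,2) partition by auto
    \<comment> \<open>In a tie, \<open>u\<close> and \<open>v\<close> are the only non-adjacent
      pair, so the one with the smaller key is the only vertex with a non-neighbour of larger
      key.\<close>
    define j where "j = (if deg_key u < deg_key v then u else v)"
    have vu: "\<not> adj v u" using sym[of v u] uv tie(3) by auto
    have "w = j" if w: "w \<in> J" for w
    proof -
      obtain x where x: "x < n" "\<not> adj w x" "deg_key w < deg_key x" "x \<noteq> w" using JD[OF w] by blast
      have "w < n" using w by (simp add: J_def)
      then have "{w, x} = {u, v}" using degree_tie[OF tie, of w x] x by auto
      then show ?thesis using x(3) unfolding j_def by (auto simp: doubleton_eq_iff)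
    qed
    moreover have "j \<in> J"
    proof (cases "deg_key u < deg_key v")
      case True
      then show ?thesis using uv tie(3) unfolding J_def j_def by auto
    next
      case False
      then have "deg_key v < deg_key u" using inj[OF uv(1,2)] uv(3) by linarith
      then show ?thesis using uv vu False unfolding J_def j_def by auto
    qed
    ultimately have J: "J = {j}" by blast
    have "x \<in> J \<or> y \<in> J" if xy: "x \<in> {..<n}" "y \<in> {..<n}" "x \<noteq> y" "\<not> adj x y" for x y
    proof -
      have "j \<in> {x, y}" unfolding degree_tie[OF tie xy] by (simp add: j_def)
      then show ?thesis unfolding J by blast
    qed
    then show ?thesis
      using split_relation_singleton[of J j] J by blast
  next
    case strict
    \<comment> \<open>The non-neighbours of a clique vertex are independent and have smaller degree,
      so no clique vertex enters \<open>J\<close>. Every independent vertex has a non-neighbour in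
      the clique, and that one has larger degree.\<close>
    have "J = I"
    proof (intro set_eqI iffI)
      fix v assume v: "v \<in> J"
      obtain x where x: "x < n" "\<not> adj v x" "deg_key v < deg_key x" "x \<noteq> v" using JD[OF v] by blast
      have vn: "v < n" using v by (simp add: J_def)
      show "v \<in> I"
      proof (rule ccontr)
        assume "v \<notin> I"
        then have vK: "v \<in> K" using vn partition by auto
        have "x \<notin> K" using clique_K[OF vK, of x] x by blast
        then have "x \<in> I" using x(1) partition by auto
        moreover have "\<not> adj x v" using sym[of x v] x vn by auto
        ultimately have "deg x < deg v" using strict(2) vK by blast
        then show False using less[OF x(1)] x(3) by fastforce
      qed
    next
      fix u assume u: "u \<in> I"
      then have un: "u < n" using partition by auto
      \<comment> \<open>A vertex \<open>u\<close> adjacent to the whole clique would absorb all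
        other edges by the Sperner property, and the graph would be complete.\<close>
      have "\<exists>v\<in>K. \<not> adj u v"
      proof (rule ccontr)
        assume "\<not> ?thesis"
        then have all: "adj u v" if "v \<in> K" for v using that by blast
        have Iu: "w = u" if w: "w \<in> I" for w
        proof (rule Sperner[OF w u])
          fix x assume "x \<in> {..<n}" "adj w x"
          then show "adj u x" using all independent_I[OF w, of x] partition by blast
        qed
        have "adj x y" if "x < n" "y < n" "x \<noteq> y" for x y
        proof (cases "x \<in> I \<or> y \<in> I")
          case True
          then show ?thesis using Iu[of x] Iu[of y] all sym[of u x] that partition un by auto
        next
          case False
          then show ?thesis using clique_K[of x y] that partition by auto
        qed
        then show False using strict(1) by blast
      qed
      then obtain v where v: "v \<in> K" "\<not> adj u v" by blast
      then have "deg u < deg v" using strict(2) u by blast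
      then have "deg_key u < deg_key v" by (rule less[OF un])
      then show "u \<in> J" using v un partition unfolding J_def by auto
    qed
    then show ?thesis using split_relation_I one_Sperner_I by simp
  qed
qed

section \<open>Graphs without induced complement of H\<close>

lemma digraph_iso_with_proj:
  assumes f: "bij_betw f (pverts A) (pverts B)" and wf: "parcs A \<subseteq> pverts A \<times> pverts A" "parcs B \<subseteq> pverts B \<times> pverts B"
    and arcs: "\<And>x y. x \<in> pverts A \<Longrightarrow> y \<in> pverts A \<Longrightarrow> (x, y) \<in> parcs A \<longleftrightarrow> (f x, f y) \<in> parcs B"
  shows "digraph_iso (with_proj A) (with_proj B)"
proof -
  define hom where "hom = \<lparr>iso_verts = f, iso_arcs = map_prod f f, iso_head = snd, iso_tail = fst\<rparr>"
  have inj: "inj_on f (pverts A)" and im: "f ` pverts A = pverts B" using f by (simp_all add: bij_betw_def)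
  have "wf_digraph (with_proj A)" by unfold_locales (use wf in auto)
  moreover have "inj_on (map_prod f f) (parcs A)"
    by (rule inj_on_subset[OF map_prod_inj_on[OF inj inj] wf(1)])
  ultimately have "pre_digraph.digraph_isomorphism (with_proj A) hom"
    using inj by (simp add: pre_digraph.digraph_isomorphism_def hom_def)
  moreover have "parcs B = map_prod f f ` parcs A"
  proof (intro set_eqI iffI)
    fix p assume "p \<in> parcs B"
    then obtain x y where xy: "x \<in> pverts A" "y \<in> pverts A" "p = (f x, f y)" "(f x, f y) \<in> parcs B"
      using wf(2) unfolding im[symmetric] by auto
    then have "(x, y) \<in> parcs A" using arcs by blast
    then show "p \<in> map_prod f f ` parcs A" unfolding xy(3) by (metis map_prod_imageI)
  next
    fix p assume "p \<in> map_prod f f ` parcs A"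
    then obtain x y where "(x, y) \<in> parcs A" "p = (f x, f y)" by auto
    then show "p \<in> parcs B" using arcs wf(1) by blast
  qed
  then have "with_proj B = app_iso hom (with_proj A)"
    by (simp add: app_iso_def hom_def with_proj_def im)
  ultimately show ?thesis unfolding digraph_iso_def by blast
qed

text \<open>The subgraph induced by the image of \<open>f\<close> is the witness. The definition
  asks for an isomorphism from it to \<open>F\<close>, hence the inverse of
  \<open>f\<close>.\<close>

lemma has_inducedI:
  assumes wf: "parcs G \<subseteq> pverts G \<times> pverts G" "parcs F \<subseteq> pverts F \<times> pverts F"
    and f: "inj_on f (pverts F)" "f ` pverts F \<subseteq> pverts G"
    and arcs: "\<And>x y. x \<in> pverts F \<Longrightarrow> y \<in> pverts F \<Longrightarrow> (x, y) \<in> parcs F \<longleftrightarrow> (f x, f y) \<in> parcs G"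
  shows "has_induced G F"
proof -
  define T where "T = \<lparr>pverts = f ` pverts F, parcs = {e \<in> parcs G. fst e \<in> f ` pverts F \<and> snd e \<in> f ` pverts F}\<rparr>"
  have T: "pverts T = f ` pverts F" "parcs T = {e \<in> parcs G. fst e \<in> f ` pverts F \<and> snd e \<in> f ` pverts F}"
    by (simp_all add: T_def)
  have "wf_digraph (with_proj G)" "wf_digraph (with_proj T)"
    by (unfold_locales; use wf T in auto)+
  then have "induced_subgraph (with_proj T) (with_proj G)"
    using f(2) by (auto simp: induced_subgraph_def subgraph_def compatible_def T)
  moreover have "digraph_iso (with_proj T) (with_proj F)"
  proof (rule digraph_iso_with_proj[OF _ _ wf(2)])
    have b: "bij_betw f (pverts F) (pverts T)" using f(1) T by (simp add: bij_betw_def)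
    then show "bij_betw (inv_into (pverts F) f) (pverts T) (pverts F)" by (rule bij_betw_inv_into)
    show "parcs T \<subseteq> pverts T \<times> pverts T" unfolding T by auto
    fix x y assume xy: "x \<in> pverts T" "y \<in> pverts T"
    then have fx: "f (inv_into (pverts F) f x) = x" "f (inv_into (pverts F) f y) = y"
      "inv_into (pverts F) f x \<in> pverts F" "inv_into (pverts F) f y \<in> pverts F"
      unfolding T by (auto intro: f_inv_into_f inv_into_into)
    show "(x, y) \<in> parcs T \<longleftrightarrow> (inv_into (pverts F) f x, inv_into (pverts F) f y) \<in> parcs F"
      unfolding arcs[OF fx(3,4)] fx(1,2) using xy T by auto
  qed
  ultimately show ?thesis unfolding has_induced_def by blast
qed

text \<open>The leaves are crossed: in the complement \<open>HC1\<close> is adjacent to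
  \<open>HX2\<close> and \<open>HY2\<close>, so the private neighbours \<open>a\<close>,
  \<open>b\<close> of \<open>u\<close> take these places.\<close>

definition H_embedding :: "'a \<Rightarrow> 'a \<Rightarrow> 'a \<Rightarrow> 'a \<Rightarrow> 'a \<Rightarrow> 'a \<Rightarrow> H_vertex \<Rightarrow> 'a" where
  "H_embedding u v a b c d x = (case x of HC1 \<Rightarrow> u | HC2 \<Rightarrow> v | HX2 \<Rightarrow> a | HY2 \<Rightarrow> b | HX1 \<Rightarrow> c | HY1 \<Rightarrow> d)"

text \<open>Only \<open>cross\<close> needs an argument: two private neighbours on each side would
  be four distinct clique vertices which, with \<open>u\<close> and \<open>v\<close>, induce the
  complement of H.\<close>

lemma Sperner_split_of_graph:
  assumes G: "split_graph G" and H: "\<not> has_induced G (complement_graph H_graph)" and S: "independent_Sperner G"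
  shows "\<exists>K I. Sperner_split (\<lambda>u v. (u, v) \<in> parcs G) (pverts G) K I"
proof -
  interpret pair_graph G using G by (simp add: split_graph_def)
  obtain K I where sp: "split_partition G K I" and Sp: "\<And>u v. u \<in> I \<Longrightarrow> v \<in> I \<Longrightarrow> nbhd G u \<subseteq> nbhd G v \<Longrightarrow> u = v"
    using S unfolding independent_Sperner_def by blast
  have KI: "K \<union> I = pverts G" "K \<inter> I = {}" and cl: "\<And>u v. u \<in> K \<Longrightarrow> v \<in> K \<Longrightarrow> u \<noteq> v \<Longrightarrow> (u, v) \<in> parcs G"
    and ind: "\<And>u v. u \<in> I \<Longrightarrow> v \<in> I \<Longrightarrow> (u, v) \<notin> parcs G"
    using sp by (auto simp: split_partition_def is_clique_def is_independent_def)
  have sym: "(v, u) \<in> parcs G" if "(u, v) \<in> parcs G" for u v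
    using that pair_sym_arcs by (auto simp: symmetric_def sym_def)
  have loop: "(u, u) \<notin> parcs G" for u using pair_no_loops by fastforce
  have wf: "parcs G \<subseteq> pverts G \<times> pverts G" using in_arcsD1 in_arcsD2 by auto
  have "Sperner_split (\<lambda>u v. (u, v) \<in> parcs G) (pverts G) K I"
  proof
    show "finite (pverts G)" by (rule pair_finite_verts)
    show "K \<union> I = pverts G" "K \<inter> I = {}" by fact+
    show "u = v" if "u \<in> I" "v \<in> I" "\<And>x. x \<in> pverts G \<Longrightarrow> (u, x) \<in> parcs G \<Longrightarrow> (v, x) \<in> parcs G" for u v
      using Sp[OF that(1,2)] that(3) by (auto simp: nbhd_def)
    fix u v a b c d
    assume uv: "u \<in> I" "v \<in> I" and V: "{a, b, c, d} \<subseteq> pverts G"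
      and 1: "(u, a) \<in> parcs G" "(u, b) \<in> parcs G" "(v, a) \<notin> parcs G" "(v, b) \<notin> parcs G"
      and 2: "(v, c) \<in> parcs G" "(v, d) \<in> parcs G" "(u, c) \<notin> parcs G" "(u, d) \<notin> parcs G"
    show "a = b \<or> c = d"
    proof (rule ccontr)
      assume "\<not> (a = b \<or> c = d)"
      then have ne: "a \<noteq> b" "c \<noteq> d" by blast+
      have K: "a \<in> K" "b \<in> K" "c \<in> K" "d \<in> K" using ind[OF uv(1)] ind[OF uv(2)] 1 2 V KI(1) by blast+
      have ne2: "a \<noteq> c" "a \<noteq> d" "b \<noteq> c" "b \<noteq> d" "u \<noteq> v" using 1 2 by blast+
      have ne3: "x \<noteq> y" if "x \<in> I" "y \<in> K" for x y using that KI(2) by blast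
      let ?F = "complement_graph H_graph" and ?f = "H_embedding u v a b c d"
      have univ: "x \<in> {HC1, HC2, HX1, HY1, HX2, HY2}" for x by (cases x) simp_all
      have F: "pverts ?F = UNIV" using univ by (auto simp: complement_graph_def H_graph_def Let_def)
      have n: "u \<noteq> a" "u \<noteq> b" "u \<noteq> c" "u \<noteq> d" "v \<noteq> a" "v \<noteq> b" "v \<noteq> c" "v \<noteq> d"
        using ne3 uv K by blast+
      have "has_induced G ?F"
      proof (rule has_inducedI[OF wf])
        show "parcs ?F \<subseteq> pverts ?F \<times> pverts ?F" unfolding F by simp
        have "?f x = ?f y \<Longrightarrow> x = y" for x y
          using n ne ne2 by (cases x; cases y; simp add: H_embedding_def)
        then show "inj_on ?f (pverts ?F)" by (rule inj_onI)
        show "?f ` pverts ?F \<subseteq> pverts G"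
        proof
          fix p assume "p \<in> ?f ` pverts ?F"
          then obtain x where "p = ?f x" by blast
          then show "p \<in> pverts G" using V uv KI by (cases x) (auto simp: H_embedding_def)
        qed
        have arcs: "(x, y) \<in> parcs ?F \<longleftrightarrow> x \<noteq> y \<and> (x, y) \<notin> parcs H_graph" for x y
          using univ by (auto simp: complement_graph_def H_graph_def Let_def)
        have ab: "(a, b) \<in> parcs G" "(a, c) \<in> parcs G" "(a, d) \<in> parcs G" "(b, c) \<in> parcs G" "(b, d) \<in> parcs G" "(c, d) \<in> parcs G"
          using cl K ne ne2 by blast+
        have uv': "(u, v) \<notin> parcs G" using ind uv by blast
        have rev: "(a, u) \<in> parcs G" "(b, u) \<in> parcs G" "(a, v) \<notin> parcs G" "(b, v) \<notin> parcs G"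
          "(c, v) \<in> parcs G" "(d, v) \<in> parcs G" "(c, u) \<notin> parcs G" "(d, u) \<notin> parcs G" "(v, u) \<notin> parcs G"
          "(b, a) \<in> parcs G" "(c, a) \<in> parcs G" "(d, a) \<in> parcs G" "(c, b) \<in> parcs G" "(d, b) \<in> parcs G" "(d, c) \<in> parcs G"
          using 1 2 ab uv' sym by blast+
        fix x y
        show "(x, y) \<in> parcs ?F \<longleftrightarrow> (?f x, ?f y) \<in> parcs G"
          unfolding arcs
          by (cases x; cases y; simp add: H_embedding_def H_graph_def Let_def loop 1 2 ab uv' rev)
      qed
      then show False using H by blast
    qed
  qed (use sym loop cl ind in blast)+
  then show ?thesis by blast
qed

section \<open>Numbering of the vertices and the final theorem\<close>

lemma Sperner_split_transfer:
  assumes "Sperner_split adj V K I" and f: "bij_betw f V' V"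
  shows "Sperner_split (\<lambda>u v. adj (f u) (f v)) V' {x \<in> V'. f x \<in> K} {x \<in> V'. f x \<in> I}"
proof -
  interpret Sperner_split adj V K I by fact
  have fV: "f x \<in> V" if "x \<in> V'" for x using f that by (auto simp: bij_betw_def)
  have inj: "f x = f y \<Longrightarrow> x = y" if "x \<in> V'" "y \<in> V'" for x y
    using f that by (auto simp: bij_betw_def inj_on_def)
  show ?thesis
  proof
    show "finite V'" using f finite_V bij_betw_finite by blast
    show "{x \<in> V'. f x \<in> K} \<union> {x \<in> V'. f x \<in> I} = V'" using partition fV by blast
    show "{x \<in> V'. f x \<in> K} \<inter> {x \<in> V'. f x \<in> I} = {}" using partition by blast
    show "adj (f v) (f u)" if "u \<in> V'" "v \<in> V'" "adj (f u) (f v)" for u v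
      using sym fV that by blast
    show "\<not> adj (f u) (f u)" if "u \<in> V'" for u using irrefl fV that by blast
    show "adj (f u) (f v)" if "u \<in> {x \<in> V'. f x \<in> K}" "v \<in> {x \<in> V'. f x \<in> K}" "u \<noteq> v" for u v
      using clique_K[of "f u" "f v"] inj[of u v] that by blast
    show "\<not> adj (f u) (f v)" if "u \<in> {x \<in> V'. f x \<in> I}" "v \<in> {x \<in> V'. f x \<in> I}" for u v
      using independent_I that by blast
    show "u = v" if uv: "u \<in> {x \<in> V'. f x \<in> I}" "v \<in> {x \<in> V'. f x \<in> I}"
      and sub: "\<And>x. x \<in> V' \<Longrightarrow> adj (f u) (f x) \<Longrightarrow> adj (f v) (f x)" for u v
    proof -
      have "adj (f v) y" if y: "y \<in> V" "adj (f u) y" for y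
      proof -
        obtain x where "x \<in> V'" "f x = y" using f y(1) by (auto simp: bij_betw_def)
        then show ?thesis using sub[of x] y(2) by simp
      qed
      then have "f u = f v" using Sperner[of "f u" "f v"] uv by blast
      then show ?thesis using inj uv by blast
    qed
    fix u v a b c d
    assume uv: "u \<in> {x \<in> V'. f x \<in> I}" "v \<in> {x \<in> V'. f x \<in> I}" and V: "{a, b, c, d} \<subseteq> V'"
      and "adj (f u) (f a)" "adj (f u) (f b)" "\<not> adj (f v) (f a)" "\<not> adj (f v) (f b)"
      and "adj (f v) (f c)" "adj (f v) (f d)" "\<not> adj (f u) (f c)" "\<not> adj (f u) (f d)"
    then have "f a = f b \<or> f c = f d"
      using cross[of "f u" "f v" "f a" "f b" "f c" "f d"] fV by simp
    then show "a = b \<or> c = d" using inj V by blast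
  qed
qed

text \<open>The decomposition uses the recognised set \<open>J\<close> instead of the given
  \<open>I\<close>, for the program can compute only the former. The word bound is the least one
  that \<open>array_machine\<close> admits.\<close>

lemma five_expression_computed:
  assumes n: "1 \<le> n" and S: "Sperner_split adj {..<n} K I"
  shows "\<exists>t s e. ram_exec ((100 * n ^ 3) ^ 100 + 1) expression_prog
       \<lparr>reg = (\<lambda>r. if r = 0 then n else 0), mem = (\<lambda>c. if c < n * n \<and> adj (c div n) (c mod n) then 1 else 0)\<rparr> t s \<and>
     t \<le> 30000 * n ^ 3 \<and> ram_output s = encode_kexp e \<and> k_expression 5 e \<and>
     kexp_graph e = \<lparr>pverts = {..<n}, parcs = {(u, v). u < n \<and> v < n \<and> adj u v}\<rparr>"
proof -
  interpret array_machine n "(100 * n ^ 3) ^ 100 + 1" adj by unfold_locales (use n in simp_all)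
  define J where "J = {v. v < n \<and> (\<exists>x<n. \<not> adj v x \<and> deg_key v < deg_key x)}"
  have J: "split_relation adj {..<n} J" "one_Sperner ({..<n} - J) ({..<n} \<inter> J) (\<lambda>u. {v. adj u v})"
    using recognise_split[OF S] unfolding J_def by blast+
  interpret split_relation adj "{..<n}" J by fact
  interpret split_machine n "(100 * n ^ 3) ^ 100 + 1" adj J by unfold_locales
  have "sub_Sperner {..<n}" unfolding sub_Sperner_def by (rule J(2))
  moreover have "v \<in> J \<longleftrightarrow> (\<exists>x<n. \<not> adj v x \<and> deg_key v < deg_key x)" if "v < n" for v
    using that by (simp add: J_def)
  ultimately obtain s e where se: "runs ((100 * n ^ 3) ^ 100 + 1) expression_prog (St (\<lambda>r. if r = 0 then n else 0) (layout (\<lambda>_ _. 0) [])) (30000 * n ^ 3) s"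
     "ram_output s = encode_kexp e" "builds e {..<n}"
    using runs_expression_prog by blast
  have m: "layout (\<lambda>_ _. 0) [] = (\<lambda>c. if c < n * n \<and> adj (c div n) (c mod n) then 1 else 0)"
    by (auto simp: layout_def fun_eq_iff)
  have e: "k_expression 5 e" "pverts (kexp_graph e) = {..<n}" "parcs (kexp_graph e) = {(u, v). u \<in> {..<n} \<and> v \<in> {..<n} \<and> adj u v}"
    using se(3) by (simp_all add: builds_def)
  then have "kexp_graph e = \<lparr>pverts = {..<n}, parcs = {(u, v). u < n \<and> v < n \<and> adj u v}\<rparr>" by simp
  then show ?thesis using se(1,2) e(1) unfolding runs_def m by blast
qed

text \<open>Vertices are numbered by a bijection, and the existence of an expression is read off a
  run of the program on the numbered graph.\<close>

lemma clique_width_le_5: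
  assumes G: "split_graph G" "pverts G \<noteq> {}" "\<not> has_induced G (complement_graph H_graph)" "independent_Sperner G"
  shows "clique_width G \<le> 5"
proof -
  interpret pair_graph G using G(1) by (simp add: split_graph_def)
  obtain K I where S: "Sperner_split (\<lambda>u v. (u, v) \<in> parcs G) (pverts G) K I"
    using Sperner_split_of_graph[OF G(1,3,4)] by blast
  define n where "n = card (pverts G)"
  have n: "1 \<le> n" using G(2) pair_finite_verts by (simp add: n_def Suc_le_eq card_gt_0_iff)
  obtain f where f: "bij_betw f {..<n} (pverts G)"
    using ex_bij_betw_nat_finite[OF pair_finite_verts] by (auto simp: n_def atLeast0LessThan)
  obtain e :: "nat kexp" where e: "k_expression 5 e"
    "kexp_graph e = \<lparr>pverts = {..<n}, parcs = {(u, v). u < n \<and> v < n \<and> (f u, f v) \<in> parcs G}\<rparr>"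
    using five_expression_computed[OF n Sperner_split_transfer[OF S f]] by blast
  have "digraph_iso (with_proj (kexp_graph e)) (with_proj G)"
  proof (rule digraph_iso_with_proj)
    show "bij_betw f (pverts (kexp_graph e)) (pverts G)" using f by (simp add: e)
    show "parcs G \<subseteq> pverts G \<times> pverts G" using in_arcsD1 in_arcsD2 by auto
  qed (auto simp: e)
  then have "5 \<in> {k. \<exists>e :: nat kexp. k_expression k e \<and> digraph_iso (with_proj (kexp_graph e)) (with_proj G)}"
    using e(1) by blast
  then have "clique_width G \<le> enat 5" unfolding clique_width_def by (rule INF_lower)
  then show ?thesis by (simp add: numeral_eq_enat)
qed

theorem theorem6p3:
  shows "(\<forall>G :: 'a pair_pre_digraph.
            split_graph G \<and> pverts G \<noteq> {} \<and> \<not> has_induced G (complement_graph H_graph) \<and>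
            independent_Sperner G \<longrightarrow>
            clique_width G \<le> 5) \<and>
         (\<exists>(prog :: ram_prog) (T :: nat \<Rightarrow> nat) (W :: nat \<Rightarrow> nat) (d :: nat).
            (\<lambda>n. real (T n)) \<in> O(\<lambda>n. real n ^ 4) \<and>
            (\<lambda>n. real (W n)) \<in> O(\<lambda>n. real n ^ d) \<and>
            (\<forall>(n :: nat) (G :: nat pair_pre_digraph).
               split_graph G \<and> pverts G = {..<n} \<and> n > 0 \<and>
               \<not> has_induced G (complement_graph H_graph) \<and> independent_Sperner G \<longrightarrow>
               (\<exists>t s e. ram_exec (W n) prog (graph_input n G) t s \<and> t \<le> T n \<and>
                  ram_output s = encode_kexp e \<and>
                  k_expression 5 e \<and> kexp_graph e = G)))"
proof (intro conjI)
  show "\<forall>G :: 'a pair_pre_digraph. split_graph G \<and> pverts G \<noteq> {} \<and>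
      \<not> has_induced G (complement_graph H_graph) \<and> independent_Sperner G \<longrightarrow> clique_width G \<le> 5"
    using clique_width_le_5 by blast
  \<comment> \<open>At most \<open>2 * n + 1\<close> rounds of quadratic cost give a cubic bound,
    which lies within the fourth power.\<close>
  define T :: "nat \<Rightarrow> nat" where "T n = 30000 * n ^ 3" for n
  define W :: "nat \<Rightarrow> nat" where "W n = (100 * n ^ 3) ^ 100 + 1" for n
  have T: "(\<lambda>n. real (T n)) \<in> O(\<lambda>n. real n ^ 4)"
  proof (rule bigoI[where c = 30000])
    have "real (T n) \<le> 30000 * real n ^ 4" if "n > 0" for n
    proof -
      have "real n ^ 3 \<le> real n ^ 4" using that by (intro power_increasing) simp_all
      then show ?thesis by (simp add: T_def)
    qed
    then show "\<forall>\<^sub>F n in sequentially. norm (real (T n)) \<le> 30000 * norm (real n ^ 4)"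
      by (intro eventually_mono[OF eventually_gt_at_top[of 0]]) simp
  qed
  \<comment> \<open>The degree 300 is 3 from the bound on stored numbers times 100 from the cost
    limit.\<close>
  have W: "(\<lambda>n. real (W n)) \<in> O(\<lambda>n. real n ^ 300)"
  proof (rule bigoI[where c = "100 ^ 100 + 1"])
    have "real (W n) \<le> (100 ^ 100 + 1) * real n ^ 300" if "n > 0" for n
    proof -
      have "1 \<le> real n ^ 300" using that by (intro one_le_power) simp
      moreover have "real (W n) = 100 ^ 100 * real n ^ 300 + 1"
        unfolding W_def by (simp only: of_nat_add of_nat_power of_nat_mult of_nat_numeral of_nat_1 power_mult_distrib
            power_mult[symmetric]) simp
      ultimately show ?thesis unfolding distrib_right by linarith
    qed
    then show "\<forall>\<^sub>F n in sequentially. norm (real (W n)) \<le> (100 ^ 100 + 1) * norm (real n ^ 300)"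
      by (intro eventually_mono[OF eventually_gt_at_top[of 0]]) simp
  qed
  have "\<exists>t s e. ram_exec (W n) expression_prog (graph_input n G) t s \<and> t \<le> T n \<and>
      ram_output s = encode_kexp e \<and> k_expression 5 e \<and> kexp_graph e = G"
    if G: "split_graph G" "pverts G = {..<n}" "n > 0" "\<not> has_induced G (complement_graph H_graph)" "independent_Sperner G"
    for n and G :: "nat pair_pre_digraph"
  proof -
    interpret pair_graph G using G(1) by (simp add: split_graph_def)
    obtain K I where S: "Sperner_split (\<lambda>u v. (u, v) \<in> parcs G) {..<n} K I"
      using Sperner_split_of_graph[OF G(1,4,5)] unfolding G(2) by blast
    have "parcs G = {(u, v). u < n \<and> v < n \<and> (u, v) \<in> parcs G}"
      using in_arcsD1 in_arcsD2 G(2) by auto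
    then have "\<lparr>pverts = {..<n}, parcs = {(u, v). u < n \<and> v < n \<and> (u, v) \<in> parcs G}\<rparr> = G"
      using G(2) by simp
    then show ?thesis
      using five_expression_computed[OF _ S] G(3) unfolding T_def W_def graph_input_def by auto
  qed
  then show "\<exists>(prog :: ram_prog) (T :: nat \<Rightarrow> nat) (W :: nat \<Rightarrow> nat) (d :: nat).
            (\<lambda>n. real (T n)) \<in> O(\<lambda>n. real n ^ 4) \<and>
            (\<lambda>n. real (W n)) \<in> O(\<lambda>n. real n ^ d) \<and>
            (\<forall>(n :: nat) (G :: nat pair_pre_digraph).
               split_graph G \<and> pverts G = {..<n} \<and> n > 0 \<and>
               \<not> has_induced G (complement_graph H_graph) \<and> independent_Sperner G \<longrightarrow>
               (\<exists>t s e. ram_exec (W n) prog (graph_input n G) t s \<and> t \<le> T n \<and>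
                  ram_output s = encode_kexp e \<and>
                  k_expression 5 e \<and> kexp_graph e = G))"
    using T W by blast
qed

end
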